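(* Let $M$ be a complete $n$-dimensional smooth orientable Riemannian manifold that is locally Euclidean. Let $\{R_t\}_{t=1}^N$ be an iterated relation system (IRS) on a nonempty compact subset of $M$, and let $K$ be its attractor. Assume that there exists a graph-directed iterated function system (GIFS) $G=(V,E)$ associated to $\{R_t\}_{t=1}^N$ and that $G$ consists of contractive similitudes. Suppose that $G$ satisfies the graph open set condition (GOSC). For $\alpha\ge0$ let $\lambda_\alpha$ be the spectral radius of the incidence matrix $A_\alpha$ associated to $G$. Then $$\dim_H(K)=\alpha,$$ where $\alpha$ is the unique number such that $\lambda_\alpha=1$.
   Context: Locally Euclidean means locally isometric to $\mathbb R^n$ (flat). Distances on $M$ are Riemannian distances; $\dim_H$ is Hausdorff dimension. A contractive similitude $f$ with contraction ratio $\rho\in(0,1)$ satisfies $d(f(x),f(y))=\rho\, d(x,y)$ on its domain. IRS. A relation $R$ on $E_0$ assigns to each $x\in E_0$ a set $R(x)$; $R(F):=\bigcup_{x\in F}R(x)$. Let $E_0\subseteq M$ be nonempty compact. A family $\{R_t\}_{t=1}^N$ of relations on $E_0$ is an IRS if (1) $R_t(F)$ is nonempty compact for every nonempty compact $F\subseteq E_0$ and every $t$; (2) $R_t(E_0)\subseteq E_0$ for every $t$. Put $E_{k+1}:=\bigcup_{t=1}^NR_t(E_k)$ for $k\ge0$. The attractor is $K:=\bigcap_{k=0}^\infty E_k$. Put $\Sigma=\{1,\dots,N\}$; for $t=(t_1,\dots,t_q)\in\Sigma^q$ let $R_t:=R_{t_1}\circ\cdots\circ R_{t_q}$. GIFS.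 A GIFS of contractions on $M$ is a directed graph $G=(V,E)$ with $V=\{1,\dots,m\}$, finite edge set $E$ (multiple edges allowed), with domains $X_j\subseteq M$ ($j\in V$) and contractions $f_e:X_j\to X_i$ for each $e\in E^{i,j}$, the set of edges from $i$ to $j$. $E_q^{i,j}$ is the set of directed paths $\mathbf e=(e_1,\dots,e_q)$ from $i$ to $j$, and $f_{\mathbf e}=f_{e_1}\circ\cdots\circ f_{e_q}$. Associated GIFS. $G$ is associated to $\{R_t\}_{t=1}^N$ (on $E_{k_0}$) if for some integer $k_0\ge0$ one has $E_{k_0}=\bigcup_{j=1}^mW_j$ with each $W_j\subseteq E_{k_0}$ compact (and $W_j\subseteq X_j$), and for every $q\ge1$ $$\bigcup_{t\in\Sigma^q}R_t(E_{k_0})=\bigcup_{i,j=1}^m\bigcup_{\mathbf e\in E_q^{i,j}}f_{\mathbf e}(W_j).$$ GOSC. $G$ satisfies (GOSC) if there are nonempty bounded open sets $U_1,\dots,U_m$ of $M$ (with $U_j\subseteq X_j$) such that for all $i$: (a) $\bigcup_{e\in E^{i,j}}f_e(U_j)\subseteq U_i$ for all $j$; (b) $f_e(U_{j_1})\cap f_{e'}(U_{j_2})=\emptyset$ for all distinct $e\in E^{i,j_1}$, $e'\in E^{i,j_2}$. Incidence matrix. Let $\rho_e$ be the contraction ratio of $f_e$. $A_\alpha$ is the $m\times m$ matrix with $(i,j)$ entry $\sum_{e\in E^{i,j}}\rho_e^\alpha$ (equal to $0$ if $E^{i,j}=\emptyset$).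
   Formalization: The compact sets W_j in the definition of an associated GIFS are required to be nonempty; if some W_j may be empty, its vertex can carry an unrelated subsystem that raises λ_α without affecting K, and the claim fails. *)

theory Defs
  imports
    "HOL-Analysis.Analysis"
    "Jordan_Normal_Form.Spectral_Radius"
    "Graph_Theory.Digraph"
    "Graph_Theory.Arc_Walk"
begin

section \<open>Smooth and Riemannian manifolds\<close>

text \<open>
  A chart is a domain together with a coordinate map that is meaningful on that domain only.
  The metric tensor is given by its coordinate expressions: \<open>mtensor M c x u v\<close> is
  \<open>\<Sum>i j. g\<^sub>i\<^sub>j(x) u\<^sub>i v\<^sub>j\<close> in the chart \<open>c\<close> at the coordinate point \<open>x\<close>.
  The dimension is \<open>CARD('n)\<close>, hence at least 1.
\<close>

type_synonym ('a, 'n) chart = "'a set \<times> ('a \<Rightarrow> real ^ 'n)"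

record ('a, 'n::finite) riemannian =
  mtop :: "'a topology"
  atlas :: "('a, 'n::finite) chart set"
  mtensor :: "('a, 'n::finite) chart \<Rightarrow> real ^ 'n \<Rightarrow> real ^ 'n \<Rightarrow> real ^ 'n \<Rightarrow> real"

abbreviation points :: "('a, 'n::finite) riemannian \<Rightarrow> 'a set" where
  "points M \<equiv> topspace (mtop M)"

text \<open>Intended for open \<open>S\<close>: all iterated directional derivatives up to order \<open>k\<close> exist and are
  continuous.\<close>

primrec Ck_on :: "nat \<Rightarrow> 'b::real_normed_vector set \<Rightarrow> ('b \<Rightarrow> 'c::real_normed_vector) \<Rightarrow> bool" where
  "Ck_on 0 S f \<longleftrightarrow> continuous_on S f"
| "Ck_on (Suc k) S f \<longleftrightarrow>
     (\<forall>x\<in>S. f differentiable (at x)) \<and> (\<forall>v. Ck_on k S (\<lambda>x. frechet_derivative f (at x) v))"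

definition smooth_on :: "'b::real_normed_vector set \<Rightarrow> ('b \<Rightarrow> 'c::real_normed_vector) \<Rightarrow> bool" where
  "smooth_on S f \<longleftrightarrow> (\<forall>k. Ck_on k S f)"

definition is_chart :: "'a topology \<Rightarrow> ('a, 'n::finite) chart \<Rightarrow> bool" where
  "is_chart T c \<longleftrightarrow> openin T (fst c) \<and> open (snd c ` fst c) \<and>
     homeomorphic_map (subtopology T (fst c)) (top_of_set (snd c ` fst c)) (snd c)"

definition transition :: "('a, 'n::finite) chart \<Rightarrow> ('a, 'n::finite) chart \<Rightarrow> real ^ 'n \<Rightarrow> real ^ 'n" where
  "transition c c' = snd c' \<circ> inv_into (fst c) (snd c)"

definition overlap :: "('a, 'n::finite) chart \<Rightarrow> ('a, 'n::finite) chart \<Rightarrow> (real ^ 'n) set" where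
  "overlap c c' = snd c ` (fst c \<inter> fst c')"

abbreviation jacobian ::
  "('a, 'n::finite) chart \<Rightarrow> ('a, 'n::finite) chart \<Rightarrow> real ^ 'n \<Rightarrow> real ^ 'n \<Rightarrow> real ^ 'n" where
  "jacobian c c' x \<equiv> frechet_derivative (transition c c') (at x)"

definition smooth_compatible :: "('a, 'n::finite) chart \<Rightarrow> ('a, 'n::finite) chart \<Rightarrow> bool" where
  "smooth_compatible c c' \<longleftrightarrow>
     smooth_on (overlap c c') (transition c c') \<and> smooth_on (overlap c' c) (transition c' c)"

definition smooth_manifold :: "('a, 'n::finite) riemannian \<Rightarrow> bool" where
  "smooth_manifold M \<longleftrightarrow>
     Hausdorff_space (mtop M) \<and> second_countable (mtop M) \<and> connected_space (mtop M) \<and>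
     \<Union> (fst ` atlas M) = points M \<and>
     (\<forall>c \<in> atlas M. is_chart (mtop M) c) \<and>
     (\<forall>c \<in> atlas M. \<forall>c' \<in> atlas M. smooth_compatible c c')"

text \<open>The atlas need not be maximal; this is the membership test for the maximal atlas.\<close>

definition smooth_chart :: "('a, 'n::finite) riemannian \<Rightarrow> ('a, 'n::finite) chart \<Rightarrow> bool" where
  "smooth_chart M c \<longleftrightarrow> is_chart (mtop M) c \<and> (\<forall>c' \<in> atlas M. smooth_compatible c c')"

definition orientable :: "('a, 'n::finite) riemannian \<Rightarrow> bool" where
  "orientable M \<longleftrightarrow>
     (\<exists>B. (\<forall>c \<in> B. smooth_chart M c) \<and> \<Union> (fst ` B) = points M \<and>
        (\<forall>c \<in> B. \<forall>c' \<in> B. \<forall>x \<in> overlap c c'. Determinants.det (matrix (jacobian c c' x)) > 0))"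

definition riemannian_manifold :: "('a, 'n::finite) riemannian \<Rightarrow> bool" where
  "riemannian_manifold M \<longleftrightarrow> smooth_manifold M \<and>
     (\<forall>c \<in> atlas M. \<forall>x \<in> snd c ` fst c.
        bilinear (mtensor M c x) \<and>
        (\<forall>u v. mtensor M c x u v = mtensor M c x v u) \<and>
        (\<forall>u. u \<noteq> 0 \<longrightarrow> mtensor M c x u u > 0)) \<and>
     (\<forall>c \<in> atlas M. \<forall>u v. smooth_on (snd c ` fst c) (\<lambda>x. mtensor M c x u v)) \<and>
     (\<forall>c \<in> atlas M. \<forall>c' \<in> atlas M. \<forall>x \<in> overlap c c'. \<forall>u v.
        mtensor M c x u v =
        mtensor M c' (transition c c' x) (jacobian c c' x u) (jacobian c c' x v))"

text \<open>Locally isometric, in the Riemannian sense, to Euclidean space: around each point there is a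
  smooth chart that pulls the Euclidean metric back to the given one.\<close>

definition locally_euclidean :: "('a, 'n::finite) riemannian \<Rightarrow> bool" where
  "locally_euclidean M \<longleftrightarrow>
     (\<forall>p \<in> points M. \<exists>h. smooth_chart M h \<and> p \<in> fst h \<and>
        (\<forall>c \<in> atlas M. \<forall>x \<in> overlap c h. \<forall>u v.
           mtensor M c x u v = inner (jacobian c h x u) (jacobian c h x v)))"

text \<open>\<open>curve_length M \<gamma> a b L\<close>: the restriction of \<open>\<gamma>\<close> to \<open>{a..b}\<close> is a piecewise \<open>C\<^sup>1\<close> curve of
  length \<open>L\<close>. Each piece is \<open>C\<^sup>1\<close> up to its end points and lies in a single chart of the atlas (by
  compactness this loses no generality).\<close>

inductive curve_length ::
  "('a, 'n::finite) riemannian \<Rightarrow> (real \<Rightarrow> 'a) \<Rightarrow> real \<Rightarrow> real \<Rightarrow> real \<Rightarrow> bool"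
  for M :: "('a, 'n::finite) riemannian" and \<gamma> :: "real \<Rightarrow> 'a" and a :: real where
  point: "\<gamma> a \<in> points M \<Longrightarrow> curve_length M \<gamma> a a 0"
| piece: "\<lbrakk> curve_length M \<gamma> a b L; b < b'; c \<in> atlas M; \<gamma> ` {b..b'} \<subseteq> fst c;
           \<forall>t \<in> {b..b'}. ((snd c \<circ> \<gamma>) has_vector_derivative w t) (at t within {b..b'});
           continuous_on {b..b'} w \<rbrakk>
         \<Longrightarrow> curve_length M \<gamma> a b'
              (L + integral {b..b'} (\<lambda>t. sqrt (mtensor M c (snd c (\<gamma> t)) (w t) (w t))))"

definition riem_dist :: "('a, 'n::finite) riemannian \<Rightarrow> 'a \<Rightarrow> 'a \<Rightarrow> real" where
  "riem_dist M x y = Inf {L. \<exists>\<gamma>. \<gamma> 0 = x \<and> \<gamma> 1 = y \<and> curve_length M \<gamma> 0 1 L}"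

definition complete_manifold :: "('a, 'n::finite) riemannian \<Rightarrow> bool" where
  "complete_manifold M \<longleftrightarrow> Metric_space.mcomplete (points M) (riem_dist M)"


section \<open>Hausdorff dimension\<close>

text \<open>Convention: \<open>0\<^sup>0 = 1\<close>, and the empty set has weight 0 for every exponent.\<close>

definition hweight :: "('a \<Rightarrow> 'a \<Rightarrow> real) \<Rightarrow> real \<Rightarrow> 'a set \<Rightarrow> ennreal" where
  "hweight d s C =
     (if C = {} then 0 else if s = 0 then 1
      else ennreal ((SUP (x, y) \<in> C \<times> C. d x y) powr s))"

definition hausdorff_premeasure ::
  "'a set \<Rightarrow> ('a \<Rightarrow> 'a \<Rightarrow> real) \<Rightarrow> real \<Rightarrow> real \<Rightarrow> 'a set \<Rightarrow> ennreal" where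
  "hausdorff_premeasure X d \<delta> s F =
     Inf {(\<Sum>i. hweight d s (C i)) | C :: nat \<Rightarrow> 'a set.
            F \<subseteq> (\<Union>i. C i) \<and> (\<forall>i. C i \<subseteq> X \<and> (\<forall>x \<in> C i. \<forall>y \<in> C i. d x y \<le> \<delta>))}"

definition hausdorff_measure ::
  "'a set \<Rightarrow> ('a \<Rightarrow> 'a \<Rightarrow> real) \<Rightarrow> real \<Rightarrow> 'a set \<Rightarrow> ennreal" where
  "hausdorff_measure X d s F = (SUP \<delta> \<in> {0<..}. hausdorff_premeasure X d \<delta> s F)"

definition hausdorff_dim :: "'a set \<Rightarrow> ('a \<Rightarrow> 'a \<Rightarrow> real) \<Rightarrow> 'a set \<Rightarrow> ereal" where
  "hausdorff_dim X d F = Inf {ereal s | s. 0 \<le> s \<and> hausdorff_measure X d s F = 0}"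


section \<open>Iterated relation systems\<close>

definition IRS :: "'a topology \<Rightarrow> nat \<Rightarrow> 'a set \<Rightarrow> (nat \<Rightarrow> 'a rel) \<Rightarrow> bool" where
  "IRS T N E0 R \<longleftrightarrow>
     1 \<le> N \<and> E0 \<noteq> {} \<and> compactin T E0 \<and>
     (\<forall>t \<in> {1..N}. Domain (R t) \<subseteq> E0 \<and>
        (\<forall>F. F \<subseteq> E0 \<and> F \<noteq> {} \<and> compactin T F \<longrightarrow> R t `` F \<noteq> {} \<and> compactin T (R t `` F)) \<and>
        R t `` E0 \<subseteq> E0)"

primrec irs_level :: "nat \<Rightarrow> 'a set \<Rightarrow> (nat \<Rightarrow> 'a rel) \<Rightarrow> nat \<Rightarrow> 'a set" where
  "irs_level N E0 R 0 = E0"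
| "irs_level N E0 R (Suc k) = (\<Union>t \<in> {1..N}. R t `` irs_level N E0 R k)"

definition attractor :: "nat \<Rightarrow> 'a set \<Rightarrow> (nat \<Rightarrow> 'a rel) \<Rightarrow> 'a set" where
  "attractor N E0 R = (\<Inter>k. irs_level N E0 R k)"

text \<open>\<open>R\<^bsub>t\<^sub>1\<^esub> \<circ> \<dots> \<circ> R\<^bsub>t\<^sub>q\<^esub>\<close> with the last relation applied first; note that \<^const>\<open>relcomp\<close> composes in
  the opposite order.\<close>

primrec rel_word :: "(nat \<Rightarrow> 'a rel) \<Rightarrow> nat list \<Rightarrow> 'a rel" where
  "rel_word R [] = Id"
| "rel_word R (t # ts) = rel_word R ts O R t"


section \<open>Graph-directed iterated function systems\<close>

definition edges :: "(nat, 'e) pre_digraph \<Rightarrow> nat \<Rightarrow> nat \<Rightarrow> 'e set" where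
  "edges G i j = {e \<in> arcs G. tail G e = i \<and> head G e = j}"

definition paths :: "(nat, 'e) pre_digraph \<Rightarrow> nat \<Rightarrow> nat \<Rightarrow> nat \<Rightarrow> 'e list set" where
  "paths G q i j = {es. length es = q \<and> pre_digraph.awalk G i es j}"

definition GIFS ::
  "'a set \<Rightarrow> ('a \<Rightarrow> 'a \<Rightarrow> real) \<Rightarrow> nat \<Rightarrow> (nat, 'e) pre_digraph \<Rightarrow> (nat \<Rightarrow> 'a set) \<Rightarrow>
   ('e \<Rightarrow> 'a \<Rightarrow> 'a) \<Rightarrow> bool" where
  "GIFS M d m G X f \<longleftrightarrow>
     fin_digraph G \<and> verts G = {1..m} \<and>
     (\<forall>j \<in> {1..m}. X j \<subseteq> M) \<and>
     (\<forall>i \<in> {1..m}. \<forall>j \<in> {1..m}. \<forall>e \<in> edges G i j.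
        f e ` X j \<subseteq> X i \<and>
        (\<exists>c. 0 \<le> c \<and> c < 1 \<and> (\<forall>x \<in> X j. \<forall>y \<in> X j. d (f e x) (f e y) \<le> c * d x y)))"

definition contractive_similitudes ::
  "('a \<Rightarrow> 'a \<Rightarrow> real) \<Rightarrow> (nat, 'e) pre_digraph \<Rightarrow> (nat \<Rightarrow> 'a set) \<Rightarrow> ('e \<Rightarrow> 'a \<Rightarrow> 'a) \<Rightarrow>
   ('e \<Rightarrow> real) \<Rightarrow> bool" where
  "contractive_similitudes d G X f \<rho> \<longleftrightarrow>
     (\<forall>e \<in> arcs G. 0 < \<rho> e \<and> \<rho> e < 1 \<and>
        (\<forall>x \<in> X (head G e). \<forall>y \<in> X (head G e). d (f e x) (f e y) = \<rho> e * d x y))"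

text \<open>Here \<^term>\<open>foldr f es\<close> is \<open>f\<^bsub>e\<^sub>1\<^esub> \<circ> \<dots> \<circ> f\<^bsub>e\<^sub>q\<^esub>\<close> for \<open>es = [e\<^sub>1, \<dots>, e\<^sub>q]\<close>.
  The sets \<open>W j\<close> have to be nonempty: with \<open>W j = {}\<close> the vertex \<open>j\<close> could carry an arbitrary
  subsystem, which contributes to the incidence matrix but not to the attractor.\<close>

definition associated ::
  "'a topology \<Rightarrow> nat \<Rightarrow> 'a set \<Rightarrow> (nat \<Rightarrow> 'a rel) \<Rightarrow> nat \<Rightarrow> (nat, 'e) pre_digraph \<Rightarrow>
   (nat \<Rightarrow> 'a set) \<Rightarrow> ('e \<Rightarrow> 'a \<Rightarrow> 'a) \<Rightarrow> bool" where
  "associated T N E0 R m G X f \<longleftrightarrow>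
     (\<exists>k W.
        irs_level N E0 R k = (\<Union>j \<in> {1..m}. W j) \<and>
        (\<forall>j \<in> {1..m}. W j \<noteq> {} \<and> compactin T (W j) \<and> W j \<subseteq> irs_level N E0 R k \<and> W j \<subseteq> X j) \<and>
        (\<forall>q\<ge>1. (\<Union>ts \<in> {ts. set ts \<subseteq> {1..N} \<and> length ts = q}. rel_word R ts `` irs_level N E0 R k)
              = (\<Union>i \<in> {1..m}. \<Union>j \<in> {1..m}. \<Union>es \<in> paths G q i j. foldr f es ` W j)))"

definition GOSC ::
  "'a topology \<Rightarrow> ('a \<Rightarrow> 'a \<Rightarrow> real) \<Rightarrow> nat \<Rightarrow> (nat, 'e) pre_digraph \<Rightarrow> (nat \<Rightarrow> 'a set) \<Rightarrow>
   ('e \<Rightarrow> 'a \<Rightarrow> 'a) \<Rightarrow> bool" where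
  "GOSC T d m G X f \<longleftrightarrow>
     (\<exists>U. (\<forall>j \<in> {1..m}. U j \<noteq> {} \<and> openin T (U j) \<and>
             Metric_space.mbounded (topspace T) d (U j) \<and> U j \<subseteq> X j) \<and>
        (\<forall>i \<in> {1..m}.
           (\<forall>j \<in> {1..m}. (\<Union>e \<in> edges G i j. f e ` U j) \<subseteq> U i) \<and>
           (\<forall>j\<^sub>1 \<in> {1..m}. \<forall>j\<^sub>2 \<in> {1..m}. \<forall>e \<in> edges G i j\<^sub>1. \<forall>e' \<in> edges G i j\<^sub>2.
              e \<noteq> e' \<longrightarrow> f e ` U j\<^sub>1 \<inter> f e' ` U j\<^sub>2 = {})))"

text \<open>Matrix indices start at 0, vertices at 1. The entries are nonnegative reals;
  they are complex because \<^const>\<open>spectral_radius\<close> is defined for complex matrices.\<close>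

definition incidence_matrix ::
  "nat \<Rightarrow> (nat, 'e) pre_digraph \<Rightarrow> ('e \<Rightarrow> real) \<Rightarrow> real \<Rightarrow> complex Matrix.mat" where
  "incidence_matrix m G \<rho> \<alpha> =
     Matrix.mat m m (\<lambda>(i, j). complex_of_real (\<Sum>e \<in> edges G (Suc i) (Suc j). \<rho> e powr \<alpha>))"

end

theory Submission
  imports Defs "HOL-Library.Sublist"
begin

text \<open>
  In a flat chart the length of a curve is Euclidean, so small Riemannian balls are isometric to
  Euclidean balls, and only this metric fact about \<open>M\<close> matters afterwards. By compactness the attractor
  is the intersection of the decreasing compact sets \<open>\<Union> f\<^bsub>e\<^esub>(W\<^sub>j)\<close> over the paths \<open>e\<close> of length \<open>q\<close>.
  If the spectral radius \<open>\<lambda>\<^sub>s\<close> is below 1, these covers show that the \<open>s\<close>-dimensional measure is 0.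
  If \<open>\<lambda>\<^sub>s \<ge> 1\<close>, the moduli of an eigenvector form a vector \<open>h\<close> with \<open>A\<^sub>s h \<ge> h\<close>; damping the rows gives
  edge weights \<open>c\<^sub>e \<le> \<rho>\<^sub>e\<^sup>s\<close> for which \<open>h\<close> is invariant, hence an additive weight on paths. The open set
  condition and a packing count in Euclidean balls bound the weight seen by a ball of radius \<open>r\<close> by a
  multiple of \<open>r\<^sup>s\<close>, so that the measure is positive (mass distribution principle).
\<close>

section \<open>Spectral radii of nonnegative matrices\<close>

text \<open>The graph need not be strongly connected, so the incidence matrix may be reducible:
  \<open>h\<close> is only nonnegative, and vertices without outgoing edges may occur. A word of
  positive weight ends where \<open>h\<close> is positive, hence extends to every length; this is
  what places a point of the attractor near its images. The sets \<open>W j\<close> have no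
  prescribed position relative to \<open>U j\<close> within \<open>X j\<close>, so the attractor is
  compared with the images of fixed points \<open>u j\<close> of \<open>U j\<close>, at distance at
  most \<open>B\<close> times the ratio. No measure is constructed: as the attractor is compact,
  covers may be taken finite, and the additive weight on the words of one sufficiently large length
  replaces the measure. The counting needs genuine Euclidean balls inside the images of the
  \<open>U j\<close>; that a similitude maps small balls onto balls follows from a compactness
  argument for isometries, in place of invariance of domain. The flat radius may vary with the point
  of \<open>M\<close>, so it is made uniform only near the attractor.\<close>

definition matop :: "nat \<Rightarrow> (nat \<Rightarrow> nat \<Rightarrow> real) \<Rightarrow> (nat \<Rightarrow> real) \<Rightarrow> nat \<Rightarrow> real" where
  "matop n a h i = (\<Sum>j<n. a i j * h j)"

abbreviation cmat :: "nat \<Rightarrow> (nat \<Rightarrow> nat \<Rightarrow> real) \<Rightarrow> complex Matrix.mat" where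
  "cmat n a \<equiv> Matrix.mat n n (\<lambda>(i, j). complex_of_real (a i j))"

lemma matop_mono:
  assumes "\<And>j. j < n \<Longrightarrow> 0 \<le> a i j" "\<And>j. j < n \<Longrightarrow> h j \<le> h' j"
  shows "matop n a h i \<le> matop n a h' i"
  unfolding matop_def by (intro sum_mono mult_left_mono) (use assms in auto)

lemma matop_scale: "matop n a (\<lambda>j. c * h j) i = c * matop n a h i"
  by (simp add: matop_def sum_distrib_left mult_ac)

text \<open>Order arguments run on real functions and growth bounds come from complex matrix powers;
  this identity is the passage between them. The induction varies \<open>h\<close>, since the
  innermost application must be absorbed into the vector to match
  \<open>A ^ (k + 1) = A ^ k * A\<close>.\<close>

lemma funpow_matop_eq:
  assumes "i < n"
  shows "complex_of_real ((matop n a ^^ k) h i) = (\<Sum>j<n. (cmat n a ^\<^sub>m k) $$ (i, j) * complex_of_real (h j))"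
proof (induction k arbitrary: h)
  case 0
  have "(\<Sum>j<n. 1\<^sub>m n $$ (i, j) * complex_of_real (h j)) = (\<Sum>j<n. if j = i then complex_of_real (h i) else 0)"
    using assms by (intro sum.cong) auto
  then show ?case using assms by simp
next
  case (Suc k)
  let ?A = "cmat n a"
  have car: "?A ^\<^sub>m k \<in> carrier_mat n n" by (intro pow_carrier_mat) auto
  have entry: "(?A ^\<^sub>m Suc k) $$ (i, l) = (\<Sum>j<n. (?A ^\<^sub>m k) $$ (i, j) * complex_of_real (a j l))"
    if "l < n" for l
    using that assms car
    by (auto simp: scalar_prod_def atLeast0LessThan intro!: sum.cong)
  have "complex_of_real ((matop n a ^^ Suc k) h i) = complex_of_real ((matop n a ^^ k) (matop n a h) i)"
    by (simp add: funpow_Suc_right del: funpow.simps)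
  also have "\<dots> = (\<Sum>j<n. (?A ^\<^sub>m k) $$ (i, j) * (\<Sum>l<n. complex_of_real (a j l) * complex_of_real (h l)))"
    unfolding Suc by (simp add: matop_def)
  also have "\<dots> = (\<Sum>j<n. \<Sum>l<n. (?A ^\<^sub>m k) $$ (i, j) * complex_of_real (a j l) * complex_of_real (h l))"
    by (simp add: sum_distrib_left mult.assoc)
  also have "\<dots> = (\<Sum>l<n. \<Sum>j<n. (?A ^\<^sub>m k) $$ (i, j) * complex_of_real (a j l) * complex_of_real (h l))"
    by (rule sum.swap)
  also have "\<dots> = (\<Sum>l<n. (?A ^\<^sub>m Suc k) $$ (i, l) * complex_of_real (h l))"
    by (intro sum.cong refl) (simp add: entry sum_distrib_right del: pow_mat.simps)
  finally show ?case .
qed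

lemma eigenvalue_cmat_divide:
  assumes "t > 0" "eigenvalue (cmat n (\<lambda>i j. a i j / t)) \<mu>"
  shows "eigenvalue (cmat n a) (complex_of_real t * \<mu>)"
proof -
  let ?A = "cmat n a" and ?B = "cmat n (\<lambda>i j. a i j / t)"
  have AB: "?A = complex_of_real t \<cdot>\<^sub>m ?B" using assms(1) by auto
  obtain v where v: "v \<in> carrier_vec n" "v \<noteq> 0\<^sub>v n" "?B *\<^sub>v v = \<mu> \<cdot>\<^sub>v v"
    using assms(2) unfolding eigenvalue_def eigenvector_def by auto
  have "?A *\<^sub>v v = complex_of_real t \<cdot>\<^sub>v (?B *\<^sub>v v)"
    unfolding AB using v(1) by auto
  also have "\<dots> = (complex_of_real t * \<mu>) \<cdot>\<^sub>v v"
    unfolding v(3) by (simp add: smult_smult_assoc)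
  finally show ?thesis unfolding eigenvalue_def eigenvector_def using v by auto
qed

lemma spectral_radius_cmat_divide_less_1:
  assumes "0 < n" "t > 0" "spectral_radius (cmat n a) < t"
  shows "spectral_radius (cmat n (\<lambda>i j. a i j / t)) < 1"
proof -
  let ?A = "cmat n a" and ?B = "cmat n (\<lambda>i j. a i j / t)"
  have car: "?A \<in> carrier_mat n n" "?B \<in> carrier_mat n n" by auto
  obtain \<mu> where \<mu>: "eigenvalue ?B \<mu>" "spectral_radius ?B = norm \<mu>"
    using spectral_radius_mem_max(1)[OF car(2) assms(1)] unfolding spectrum_def by auto
  have "norm (complex_of_real t * \<mu>) \<le> spectral_radius ?A"
    using spectral_radius_mem_max(2)[OF car(1) assms(1)] eigenvalue_cmat_divide[OF assms(2) \<mu>(1)]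
    unfolding spectrum_def by blast
  then have "t * norm \<mu> \<le> spectral_radius ?A" using assms(2) by (simp add: norm_mult)
  also have "\<dots> < t * 1" using assms(3) by simp
  finally have "norm \<mu> < 1" using assms(2) by (simp only: mult_less_cancel_left_pos)
  then show ?thesis using \<mu>(2) by simp
qed

lemma spectral_radius_nonneg: "0 < n \<Longrightarrow> 0 \<le> spectral_radius (cmat n a)"
  using spectral_radius_mem_max(1)[of "cmat n a" n] by auto

text \<open>Below radius 1 the Jordan normal form bounds all entries of all powers by one constant
  \<open>c\<close>; a row sum is then at most \<open>n * c\<close>.\<close>

lemma funpow_matop_bounded:
  assumes "0 < n" "spectral_radius (cmat n a) < 1"
  shows "\<exists>c. \<forall>k. \<forall>i<n. \<bar>(matop n a ^^ k) (\<lambda>_. 1) i\<bar> \<le> c"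
proof -
  have car: "cmat n a \<in> carrier_mat n n" by auto
  obtain as where "char_poly (cmat n a) = (\<Prod>a\<leftarrow>as. [:- a, 1:])"
    using char_poly_factorized[OF car] by auto
  then have "\<exists>n_as. jordan_nf (cmat n a) n_as" by (rule jordan_nf_exists[OF car])
  then obtain c where c: "\<And>k. norm_bound (cmat n a ^\<^sub>m k) c"
    using spectral_radius_jnf_norm_bound_less_1[OF car assms(2)] by auto
  have "\<bar>(matop n a ^^ k) (\<lambda>_. 1) i\<bar> \<le> real n * c" if i: "i < n" for k i
  proof -
    have dim: "dim_row (cmat n a ^\<^sub>m k) = n" "dim_col (cmat n a ^\<^sub>m k) = n"
      using pow_carrier_mat[OF car] by blast+
    have "\<bar>(matop n a ^^ k) (\<lambda>_. 1) i\<bar> = norm (complex_of_real ((matop n a ^^ k) (\<lambda>_. 1) i))"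
      by simp
    also have "\<dots> = norm (\<Sum>j<n. (cmat n a ^\<^sub>m k) $$ (i, j))"
      by (simp add: funpow_matop_eq[OF i])
    also have "\<dots> \<le> (\<Sum>j<n. norm ((cmat n a ^\<^sub>m k) $$ (i, j)))" by (rule norm_sum)
    also have "\<dots> \<le> (\<Sum>j<n. c)"
      using c[of k] i dim unfolding norm_bound_def by (intro sum_mono) auto
    finally show ?thesis by simp
  qed
  then show ?thesis by blast
qed

lemma funpow_matop_divide:
  "(matop n (\<lambda>i j. a i j / t) ^^ k) h i = (matop n a ^^ k) h i / t ^ k"
proof (induction k arbitrary: i)
  case (Suc k)
  have "matop n (\<lambda>i j. a i j / t) (\<lambda>i. (matop n a ^^ k) h i / t ^ k) i = matop n a ((matop n a ^^ k) h) i / t ^ Suc k"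
    by (simp add: matop_def sum_divide_distrib)
  moreover have "(matop n (\<lambda>i j. a i j / t) ^^ k) h = (\<lambda>i. (matop n a ^^ k) h i / t ^ k)"
    using Suc by blast
  ultimately show ?case by simp
qed simp

text \<open>Boundedness becomes decay by rescaling: for \<open>u\<close> strictly between the
  spectral radius and 1 the matrix divided by \<open>u\<close> still has radius below 1, so the
  original iterates are at most a multiple of \<open>u ^ k\<close>.\<close>

lemma funpow_matop_tendsto_0:
  assumes "0 < n" "spectral_radius (cmat n a) < 1" "i < n"
  shows "(\<lambda>k. (matop n a ^^ k) (\<lambda>_. 1) i) \<longlonglongrightarrow> 0"
proof -
  obtain u where u: "spectral_radius (cmat n a) < u" "u < 1" using assms(2) dense by blast
  have u0: "0 < u" using spectral_radius_nonneg[OF assms(1), of a] u by simp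
  obtain c where c: "\<And>k. \<bar>(matop n (\<lambda>i j. a i j / u) ^^ k) (\<lambda>_. 1) i\<bar> \<le> c"
    using funpow_matop_bounded[OF assms(1) spectral_radius_cmat_divide_less_1[OF assms(1) u0 u(1)]] assms(3)
    by blast
  show ?thesis
  proof (rule Lim_null_comparison[OF always_eventually])
    show "(\<lambda>k. c * u ^ k) \<longlonglongrightarrow> 0"
      using LIMSEQ_power_zero[of u] u u0 by (auto intro: tendsto_mult_right_zero)
    show "\<forall>k. norm ((matop n a ^^ k) (\<lambda>_. 1) i) \<le> c * u ^ k"
    proof
      fix k
      show "norm ((matop n a ^^ k) (\<lambda>_. 1) i) \<le> c * u ^ k"
        using c[of k] u0 by (simp add: funpow_matop_divide abs_divide field_simps)
    qed
  qed
qed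

text \<open>Half of the Collatz-Wielandt principle. If the radius were below \<open>t\<close>, the
  iterates of the matrix divided by \<open>t\<close> would drive the constant vector to 0, whereas
  positivity keeps the fixed vector \<open>h\<close> below a multiple of these iterates.\<close>

lemma subinvariant_le_spectral_radius:
  assumes n: "0 < n" and a: "\<And>i j. i < n \<Longrightarrow> j < n \<Longrightarrow> 0 \<le> a i j"
    and h: "\<And>i. i < n \<Longrightarrow> 0 \<le> h i" "i0 < n" "h i0 > 0"
    and sub: "\<And>i. i < n \<Longrightarrow> t * h i \<le> matop n a h i"
  shows "t \<le> spectral_radius (cmat n a)"
proof (rule ccontr)
  assume "\<not> ?thesis"
  then have lt: "spectral_radius (cmat n a) < t" by simp
  then have t: "0 < t" using spectral_radius_nonneg[OF n, of a] by simp
  define b where "b = (\<lambda>i j. a i j / t)"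
  have b: "0 \<le> b i j" if "i < n" "j < n" for i j using a[OF that] t by (simp add: b_def)
  have subb: "h i \<le> matop n b h i" if "i < n" for i
  proof -
    have "matop n b h i = matop n a h i / t" by (simp add: matop_def b_def sum_divide_distrib)
    then have "t * h i \<le> t * matop n b h i" using sub[OF that] t by (simp add: field_simps)
    then show ?thesis using t by (simp only: mult_le_cancel_left_pos)
  qed
  define H where "H = Max (h ` {..<n})"
  have H: "h i \<le> H" if "i < n" for i unfolding H_def using that by (intro Max_ge) auto
  have le: "h i \<le> H * (matop n b ^^ k) (\<lambda>_. 1) i" if "i < n" for k i
    using that
  proof (induction k arbitrary: i)
    case 0
    then show ?case using H by simp
  next
    case (Suc k)
    have "h i \<le> matop n b h i" using subb Suc.prems .
    also have "\<dots> \<le> matop n b (\<lambda>j. H * (matop n b ^^ k) (\<lambda>_. 1) j) i"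
      by (rule matop_mono) (use b Suc in auto)
    finally show ?case by (simp add: matop_scale)
  qed
  have "(\<lambda>k. (matop n b ^^ k) (\<lambda>_. 1) i0) \<longlonglongrightarrow> 0"
    unfolding b_def
    by (rule funpow_matop_tendsto_0[OF n spectral_radius_cmat_divide_less_1[OF n t lt] h(2)])
  then have "(\<lambda>k. H * (matop n b ^^ k) (\<lambda>_. 1) i0) \<longlonglongrightarrow> 0"
    by (auto intro: tendsto_mult_right_zero)
  then have "h i0 \<le> 0" by (rule LIMSEQ_le_const) (use le h(2) in auto)
  then show False using h(3) by simp
qed

text \<open>The triangle inequality, applied in each row of the eigenvector equation for an
  eigenvalue of largest modulus. Some entries of \<open>h\<close> may vanish, hence the separate
  witness \<open>i0\<close>.\<close>

lemma spectral_radius_subinvariant: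
  assumes n: "0 < n" and a: "\<And>i j. i < n \<Longrightarrow> j < n \<Longrightarrow> 0 \<le> a i j"
  obtains h i0 where "\<And>i. 0 \<le> h i" "i0 < n" "h i0 > 0"
    "\<And>i. i < n \<Longrightarrow> spectral_radius (cmat n a) * h i \<le> matop n a h i"
proof -
  have car: "cmat n a \<in> carrier_mat n n" by auto
  obtain \<mu> where \<mu>: "eigenvalue (cmat n a) \<mu>" "spectral_radius (cmat n a) = norm \<mu>"
    using spectral_radius_mem_max(1)[OF car n] unfolding spectrum_def by auto
  obtain v where v: "v \<in> carrier_vec n" "v \<noteq> 0\<^sub>v n" "cmat n a *\<^sub>v v = \<mu> \<cdot>\<^sub>v v"
    using \<mu>(1) unfolding eigenvalue_def eigenvector_def by auto
  define h where "h i = norm (vec_index v i)" for i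
  have "\<exists>i0<n. vec_index v i0 \<noteq> 0"
  proof (rule ccontr)
    assume "\<not> ?thesis"
    then have "v = 0\<^sub>v n" using v(1) by (intro eq_vecI) auto
    then show False using v(2) by simp
  qed
  then obtain i0 where i0: "i0 < n" "vec_index v i0 \<noteq> 0" by blast
  have "norm \<mu> * h i \<le> matop n a h i" if i: "i < n" for i
  proof -
    have "vec_index (cmat n a *\<^sub>v v) i = (\<Sum>j<n. complex_of_real (a i j) * vec_index v j)"
      using i v(1) by (auto simp: scalar_prod_def atLeast0LessThan intro!: sum.cong)
    then have "\<mu> * vec_index v i = (\<Sum>j<n. complex_of_real (a i j) * vec_index v j)"
      using v i by simp
    then have "norm \<mu> * h i = norm (\<Sum>j<n. complex_of_real (a i j) * vec_index v j)"
      unfolding h_def by (metis norm_mult)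
    also have "\<dots> \<le> (\<Sum>j<n. norm (complex_of_real (a i j) * vec_index v j))" by (rule norm_sum)
    also have "\<dots> = matop n a h i"
      unfolding matop_def h_def using a i by (intro sum.cong) (auto simp: norm_mult)
    finally show ?thesis .
  qed
  then show ?thesis using i0 \<mu>(2) by (intro that[of h i0]) (auto simp: h_def)
qed

text \<open>Subinvariant vectors control the radius from both sides: one for \<open>a\<close> at the
  level of its own spectral radius is one for \<open>b\<close> at that level divided by
  \<open>k\<close>.\<close>

lemma spectral_radius_mono_scaled:
  assumes n: "0 < n" and a: "\<And>i j. i < n \<Longrightarrow> j < n \<Longrightarrow> 0 \<le> a i j"
    and b: "\<And>i j. i < n \<Longrightarrow> j < n \<Longrightarrow> 0 \<le> b i j" and k: "0 < k"
    and le: "\<And>i j. i < n \<Longrightarrow> j < n \<Longrightarrow> a i j \<le> k * b i j"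
  shows "spectral_radius (cmat n a) \<le> k * spectral_radius (cmat n b)"
proof -
  obtain h i0 where h: "\<And>i. 0 \<le> h i" "i0 < n" "h i0 > 0"
    "\<And>i. i < n \<Longrightarrow> spectral_radius (cmat n a) * h i \<le> matop n a h i"
    by (rule spectral_radius_subinvariant[of n a]) (use n a in auto)
  have "spectral_radius (cmat n a) / k \<le> spectral_radius (cmat n b)"
  proof (rule subinvariant_le_spectral_radius[where h = h and ?i0.0 = i0])
    fix i assume i: "i < n"
    have "spectral_radius (cmat n a) * h i \<le> matop n a h i" using h(4) i .
    also have "\<dots> \<le> (\<Sum>j<n. k * b i j * h j)"
      unfolding matop_def using le i h(1) by (intro sum_mono mult_right_mono) auto
    also have "\<dots> = k * matop n b h i" by (simp add: matop_def sum_distrib_left mult.assoc)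
    finally show "spectral_radius (cmat n a) / k * h i \<le> matop n b h i"
      using k by (simp add: field_simps)
  qed (use n b h in auto)
  then show ?thesis using k by (simp add: field_simps)
qed

text \<open>The two bounds control the logarithmic slope of \<open>g\<close>, so that \<open>g\<close> is continuous and, as long as
  it is positive, strictly decreasing to 0.\<close>

lemma unique_level_one:
  fixes g :: "real \<Rightarrow> real"
  assumes r: "0 < r" and R: "0 < R" "R < 1"
    and g0: "1 \<le> g 0" and nonneg: "\<And>s. 0 \<le> s \<Longrightarrow> 0 \<le> g s"
    and lower: "\<And>s s'. 0 \<le> s \<Longrightarrow> s \<le> s' \<Longrightarrow> r powr (s' - s) * g s \<le> g s'"
    and upper: "\<And>s s'. 0 \<le> s \<Longrightarrow> s \<le> s' \<Longrightarrow> g s' \<le> R powr (s' - s) * g s"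
  shows "\<exists>\<alpha>\<ge>0. g \<alpha> = 1 \<and> (\<forall>\<beta>\<ge>0. g \<beta> = 1 \<longrightarrow> \<beta> = \<alpha>) \<and> (\<forall>\<beta>>\<alpha>. g \<beta> < 1) \<and> (\<forall>\<beta>\<ge>0. \<beta> \<le> \<alpha> \<longrightarrow> 1 \<le> g \<beta>)"
proof -
  have powR: "R powr x \<le> 1" "R powr x < 1 \<longleftrightarrow> 0 < x" if "0 \<le> x" for x
  proof -
    show "R powr x \<le> 1" using that R powr_mono'[of 0 x R] by simp
    have "R powr x < 1" if "0 < x" using powr_less_mono'[of R 0 x] that R by simp
    then show "R powr x < 1 \<longleftrightarrow> 0 < x" using that R by (cases "x = 0") auto
  qed
  have dec: "g s' \<le> g s" if "0 \<le> s" "s \<le> s'" for s s'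
  proof -
    have "g s' \<le> R powr (s' - s) * g s" using upper that .
    also have "\<dots> \<le> 1 * g s" using powR nonneg that by (intro mult_right_mono) auto
    finally show ?thesis by simp
  qed
  have sdec: "g s' < g s" if "0 \<le> s" "s < s'" "0 < g s" for s s'
  proof -
    have "g s' \<le> R powr (s' - s) * g s" using upper that by simp
    also have "\<dots> < 1 * g s" using powR that by (intro mult_strict_right_mono) auto
    finally show ?thesis by simp
  qed
  \<comment> \<open>This limit yields a point \<open>real k\<close> with
    \<open>g (real k) < 1\<close>, the right end for the intermediate value theorem.\<close>
  have "(\<lambda>k. R ^ k * g 0) \<longlonglongrightarrow> 0"
    by (rule tendsto_mult_left_zero) (use R in \<open>auto intro: LIMSEQ_power_zero\<close>)
  then have "\<forall>\<^sub>F k in sequentially. R ^ k * g 0 < 1"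
    by (rule order_tendstoD) simp
  then obtain k where "R powr (real k) * g 0 < 1"
    using R by (auto simp: eventually_sequentially powr_realpow)
  then have gk: "g (real k) < 1" using upper[of 0 "real k"] by simp
  have cont: "continuous_on {0..real k} g"
    unfolding continuous_on_def
  proof
    fix x assume x: "x \<in> {0..real k}"
    \<comment> \<open>To the right of \<open>x\<close> the power of \<open>r\<close> bounds from
      below and that of \<open>R\<close> from above; to the left the roles are exchanged. Minimum
      and maximum serve both sides at once.\<close>
    define lo where "lo = (\<lambda>y. min (r powr (y - x) * g x) (R powr (y - x) * g x))"
    define hi where "hi = (\<lambda>y. max (r powr (y - x) * g x) (R powr (y - x) * g x))"
    have lim: "((\<lambda>y. q powr (y - x) * g x) \<longlongrightarrow> g x) (at x within {0..real k})" if "0 < q" for q :: real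
    proof -
      have "continuous_on UNIV (\<lambda>y. q powr (y - x) * g x)"
        using that by (intro continuous_intros) auto
      then have "((\<lambda>y. q powr (y - x) * g x) \<longlongrightarrow> q powr (x - x) * g x) (at x within {0..real k})"
        by (meson continuous_on_def continuous_on_subset UNIV_I subset_UNIV tendsto_within_subset)
      then show ?thesis using that by simp
    qed
    have est: "lo y \<le> g y \<and> g y \<le> hi y" if y: "y \<in> {0..real k}" for y
    proof (cases "x \<le> y")
      case True
      then show ?thesis using lower[of x y] upper[of x y] x unfolding lo_def hi_def by auto
    next
      case False
      have cancel: "q powr (y - x) * (q powr (x - y) * z) = z" if "0 < q" for q z :: real
        using that by (simp add: mult.assoc[symmetric] powr_add[symmetric])
      have "r powr (y - x) * (r powr (x - y) * g y) \<le> r powr (y - x) * g x"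
        "R powr (y - x) * g x \<le> R powr (y - x) * (R powr (x - y) * g y)"
        using lower[of y x] upper[of y x] y False by (auto intro!: mult_left_mono)
      then have "g y \<le> r powr (y - x) * g x" "R powr (y - x) * g x \<le> g y"
        unfolding cancel[OF r] cancel[OF R(1)] .
      then show ?thesis unfolding lo_def hi_def by auto
    qed
    show "(g \<longlongrightarrow> g x) (at x within {0..real k})"
    proof (rule tendsto_sandwich)
      show "(lo \<longlongrightarrow> g x) (at x within {0..real k})"
        using tendsto_min[OF lim[OF r] lim[OF R(1)]] by (simp add: lo_def)
      show "(hi \<longlongrightarrow> g x) (at x within {0..real k})"
        using tendsto_max[OF lim[OF r] lim[OF R(1)]] by (simp add: hi_def)
    qed (use est in \<open>auto simp: eventually_at_filter\<close>)
  qed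
  obtain \<alpha> where \<alpha>: "0 \<le> \<alpha>" "g \<alpha> = 1"
    using IVT2'[of g "real k" 1 0] gk g0 cont by auto
  have "g \<beta> < 1" if "\<beta> > \<alpha>" for \<beta> using sdec[of \<alpha> \<beta>] \<alpha> that by simp
  moreover have "1 < g \<beta>" if "0 \<le> \<beta>" "\<beta> < \<alpha>" for \<beta>
    using sdec[of \<beta> \<alpha>] dec[of \<beta> \<alpha>] \<alpha> that by simp
  ultimately have main: "\<And>\<beta>. \<beta> > \<alpha> \<Longrightarrow> g \<beta> < 1" "\<And>\<beta>. 0 \<le> \<beta> \<Longrightarrow> \<beta> < \<alpha> \<Longrightarrow> 1 < g \<beta>" by blast+
  have "\<beta> = \<alpha>" if "0 \<le> \<beta>" "g \<beta> = 1" for \<beta>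
    using main(1)[of \<beta>] main(2)[of \<beta>] that by linarith
  moreover have "1 \<le> g \<beta>" if "0 \<le> \<beta>" "\<beta> \<le> \<alpha>" for \<beta>
    using main(2)[of \<beta>] that \<alpha> by (cases "\<beta> = \<alpha>") auto
  ultimately show ?thesis using \<alpha> main(1) by blast
qed

section \<open>Locally Euclidean metric spaces\<close>

text \<open>If \<open>y\<close> were missed, it would keep a distance \<open>e\<close> from the
  compact image. By isometry any two members of the orbit of \<open>y\<close> are then at least
  \<open>e\<close> apart, which contradicts compactness. This supplies surjectivity where no linear
  structure of the map is known.\<close>

lemma isometric_compact_self_map_surj:
  fixes F :: "'b::metric_space \<Rightarrow> 'b"
  assumes S: "compact S" "F ` S \<subseteq> S"
    and iso: "\<And>x y. x \<in> S \<Longrightarrow> y \<in> S \<Longrightarrow> dist (F x) (F y) = dist x y"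
  shows "F ` S = S"
proof (rule ccontr)
  assume "F ` S \<noteq> S"
  then obtain y where y: "y \<in> S" "y \<notin> F ` S" using S(2) by blast
  have "continuous_on S F"
    unfolding continuous_on_iff using iso by metis
  then have "closed (F ` S)" using S(1) by (intro compact_imp_closed compact_continuous_image)
  then have "open (- (F ` S))" by (rule open_Compl)
  then obtain e where e: "e > 0" "ball y e \<subseteq> - (F ` S)"
    using y(2) unfolding open_contains_ball by blast
  have far: "e \<le> dist y z" if "z \<in> F ` S" for z
    using e(2) that by force
  define s where "s k = (F ^^ k) y" for k
  have s: "s k \<in> S" for k unfolding s_def by (induction k) (use y(1) S(2) in auto)
  have shift: "dist (s (k + m)) (s (k + n)) = dist (s m) (s n)" for k m n
  proof (induction k)
    case (Suc k)
    have "dist (s (Suc k + m)) (s (Suc k + n)) = dist (F (s (k + m))) (F (s (k + n)))"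
      by (simp add: s_def)
    also have "\<dots> = dist (s m) (s n)" using iso[OF s s] Suc by simp
    finally show ?case .
  qed simp
  have sep: "e \<le> dist (s m) (s n)" if "m < n" for m n
  proof -
    have "dist (s m) (s n) = dist (s 0) (s (n - m))" using shift[of m 0 "n - m"] that by simp
    moreover have "n - m = Suc (n - m - 1)" using that by simp
    then have "s (n - m) = F (s (n - m - 1))" by (metis funpow.simps(2) o_apply s_def)
    then have "s (n - m) \<in> F ` S" using s by blast
    ultimately show ?thesis using far[of "s (n - m)"] by (simp add: s_def)
  qed
  obtain l r where lr: "strict_mono (r :: nat \<Rightarrow> nat)" "(s \<circ> r) \<longlonglongrightarrow> l"
    using S(1) s unfolding compact_eq_seq_compact_metric seq_compact_def by blast
  have "Cauchy (s \<circ> r)" using lr(2) LIMSEQ_imp_Cauchy by blast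
  then obtain N where "\<And>m n. m \<ge> N \<Longrightarrow> n \<ge> N \<Longrightarrow> dist ((s \<circ> r) m) ((s \<circ> r) n) < e"
    using e(1) unfolding Cauchy_def by metis
  then have "dist (s (r N)) (s (r (Suc N))) < e" by simp
  moreover have "r N < r (Suc N)" using lr(1) by (simp add: strict_mono_def)
  ultimately show False using sep by fastforce
qed

context Metric_space
begin

text \<open>Besides preserving distances, \<open>\<phi>\<close> has to fill the whole Euclidean
  ball: this makes smaller balls with moved centres Euclidean again and allows similitudes to be
  shown surjective. Nothing is said of \<open>\<phi>\<close> outside the ball.\<close>

definition eucl :: "'a \<Rightarrow> real \<Rightarrow> ('a \<Rightarrow> 'b::euclidean_space) \<Rightarrow> bool" where
  "eucl p R \<phi> \<longleftrightarrow> p \<in> M \<and> 0 < R \<and>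
     (\<forall>x\<in>mball p R. \<forall>y\<in>mball p R. dist (\<phi> x) (\<phi> y) = d x y) \<and> \<phi> ` mball p R = ball (\<phi> p) R"

lemma eucl_dist: "eucl p R \<phi> \<Longrightarrow> x \<in> mball p R \<Longrightarrow> y \<in> mball p R \<Longrightarrow> dist (\<phi> x) (\<phi> y) = d x y"
  unfolding eucl_def by blast

lemma eucl_shrink:
  fixes \<phi> :: "'a \<Rightarrow> 'b::euclidean_space"
  assumes e: "eucl p R \<phi>" and q: "q \<in> M" "d p q + R' \<le> R" "0 < R'"
  shows "eucl q R' \<phi>"
proof -
  have p: "p \<in> M" using e by (simp add: eucl_def)
  have sub: "mball q R' \<subseteq> mball p R"
    using mball_subset[of q p R' R] p q by (simp add: commute)
  have qin: "q \<in> mball p R" using q p by simp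
  have "\<phi> ` mball q R' = ball (\<phi> q) R'"
  proof (intro equalityI subsetI)
    fix z assume "z \<in> \<phi> ` mball q R'"
    then obtain x where x: "x \<in> mball q R'" "z = \<phi> x" by blast
    then show "z \<in> ball (\<phi> q) R'" using eucl_dist[OF e qin, of x] sub by auto
  next
    fix z assume z: "z \<in> ball (\<phi> q) R'"
    have "dist (\<phi> p) z < R"
      using dist_triangle[of "\<phi> p" z "\<phi> q"] z q eucl_dist[OF e _ qin, of p] p e
      by (auto simp: eucl_def)
    then have "z \<in> \<phi> ` mball p R" using e unfolding eucl_def by auto
    then obtain x where x: "x \<in> mball p R" "z = \<phi> x" by blast
    then show "z \<in> \<phi> ` mball q R'" using eucl_dist[OF e qin, of x] z q by auto
  qed
  moreover have "\<forall>x\<in>mball q R'. \<forall>y\<in>mball q R'. dist (\<phi> x) (\<phi> y) = d x y"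
    using eucl_dist[OF e] sub by blast
  ultimately show ?thesis unfolding eucl_def using q by blast
qed

text \<open>A Lebesgue number argument. The radius also serves centres \<open>q\<close> off
  \<open>K\<close>, because the balls to be examined later are centred at images of base points,
  which need not lie in the attractor.\<close>

lemma uniform_eucl:
  assumes K: "compactin mtopology K"
    and flat: "\<And>p. p \<in> M \<Longrightarrow> \<exists>R. \<exists>\<phi>::'a \<Rightarrow> 'b::euclidean_space. eucl p R \<phi>"
  shows "\<exists>R0>0. \<forall>z\<in>K. \<forall>q\<in>M. d z q < R0 \<longrightarrow> (\<exists>\<phi>::'a \<Rightarrow> 'b. eucl q R0 \<phi>)"
proof -
  have KM: "K \<subseteq> M" using K compactin_subset_topspace by fastforce
  have "\<exists>R. \<forall>p\<in>M. \<exists>\<phi>::'a \<Rightarrow> 'b. eucl p (R p) \<phi>"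
    using flat by (intro bchoice) blast
  then obtain R where R: "\<And>p. p \<in> M \<Longrightarrow> \<exists>\<phi>::'a \<Rightarrow> 'b. eucl p (R p) \<phi>" by blast
  have Rpos: "0 < R p" if "p \<in> M" for p using R[OF that] by (auto simp: eucl_def)
  \<comment> \<open>A quarter of the radius is spent on each of the steps from \<open>p\<close> to
    \<open>z\<close> and from \<open>z\<close> to \<open>q\<close> and on the ball around
    \<open>q\<close>, so that everything stays within \<open>R p\<close>.\<close>
  let ?\<U> = "(\<lambda>p. mball p (R p / 4)) ` K"
  have "\<exists>\<F>. finite \<F> \<and> \<F> \<subseteq> ?\<U> \<and> K \<subseteq> \<Union>\<F>"
  proof (rule compactinD[OF K])
    show "K \<subseteq> \<Union>?\<U>" using KM Rpos by force
  qed auto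
  then obtain \<F> where \<F>: "finite \<F>" "\<F> \<subseteq> ?\<U>" "K \<subseteq> \<Union>\<F>" by blast
  obtain I where I: "finite I" "I \<subseteq> K" "\<F> = (\<lambda>p. mball p (R p / 4)) ` I"
    using finite_subset_image[OF \<F>(1,2)] by blast
  define R0 where "R0 = Min (insert 1 ((\<lambda>p. R p / 4) ` I))"
  have R0: "R0 \<le> R p / 4" if "p \<in> I" for p
    unfolding R0_def using I(1) that by (intro Min_le) auto
  have "R0 > 0" unfolding R0_def using I Rpos KM by (subst Min_gr_iff) (auto dest!: subsetD)
  moreover have "\<exists>\<phi>::'a \<Rightarrow> 'b. eucl q R0 \<phi>" if z: "z \<in> K" and q: "q \<in> M" "d z q < R0" for z q
  proof -
    obtain p where p: "p \<in> I" "z \<in> mball p (R p / 4)" using \<F>(3) I(3) z by blast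
    obtain \<phi> :: "'a \<Rightarrow> 'b" where \<phi>: "eucl p (R p) \<phi>" using R p I KM by blast
    have "d p q \<le> d p z + d z q" using p q by (intro triangle) auto
    then have "eucl q R0 \<phi>"
      using R0[OF p(1)] p(2) q \<open>R0 > 0\<close> by (intro eucl_shrink[OF \<phi>]) auto
    then show ?thesis by blast
  qed
  ultimately show ?thesis by blast
qed

text \<open>Read in the two Euclidean charts and divided by \<open>c\<close>, \<open>g\<close>
  becomes an isometry of a closed ball that fixes the origin; such a map is onto by
  compactness.\<close>

lemma similitude_ball_image:
  fixes \<phi> :: "'a \<Rightarrow> 'b::euclidean_space" and \<psi> :: "'a \<Rightarrow> 'b"
  assumes p: "eucl p R \<phi>" and q: "eucl q (c * R) \<psi>" and c: "0 < c"
    and g: "g ` mball p R \<subseteq> M" "g p = q"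
    and sim: "\<And>x y. x \<in> mball p R \<Longrightarrow> y \<in> mball p R \<Longrightarrow> d (g x) (g y) = c * d x y"
  shows "mball q (c * R) \<subseteq> g ` mball p R"
proof
  fix y assume y: "y \<in> mball q (c * R)"
  have M: "p \<in> M" "q \<in> M" "0 < R" using p q by (auto simp: eucl_def)
  \<comment> \<open>\<open>y\<close> is put on the boundary of the rescaled ball. The closed ball of
    this radius is compact and still inside the open ball where the charts apply.\<close>
  define R' where "R' = d q y / c"
  have R': "0 \<le> R'" "R' < R" using y c by (auto simp: R'_def field_simps)
  define \<phi>i where "\<phi>i = inv_into (mball p R) \<phi>"
  have \<phi>i: "\<phi>i (\<phi> p + v) \<in> mball p R" "\<phi> (\<phi>i (\<phi> p + v)) = \<phi> p + v" if "v \<in> cball 0 R'" for v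
  proof -
    have "\<phi> p + v \<in> \<phi> ` mball p R" using that R' p by (auto simp: eucl_def dist_norm)
    then show "\<phi>i (\<phi> p + v) \<in> mball p R" "\<phi> (\<phi>i (\<phi> p + v)) = \<phi> p + v"
      unfolding \<phi>i_def by (rule inv_into_into, rule f_inv_into_f)
  qed
  have gq: "g x \<in> mball q (c * R)" if "x \<in> mball p R" for x
  proof -
    have "d q (g x) = c * d p x" using sim[of p x] that g(2) M by auto
    then show ?thesis using that g(1) M c by auto
  qed
  define F where "F v = (\<psi> (g (\<phi>i (\<phi> p + v))) - \<psi> q) /\<^sub>R c" for v
  have dF: "dist (F v) (F w) = dist v w" if "v \<in> cball 0 R'" "w \<in> cball 0 R'" for v w
  proof -
    let ?x = "\<phi>i (\<phi> p + v)" and ?y = "\<phi>i (\<phi> p + w)"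
    have "F v - F w = (\<psi> (g ?x) - \<psi> (g ?y)) /\<^sub>R c"
      by (simp add: F_def scaleR_diff_right)
    then have "dist (F v) (F w) = dist (\<psi> (g ?x)) (\<psi> (g ?y)) / c"
      using c by (simp add: dist_norm divide_inverse mult.commute)
    also have "\<dots> = d (g ?x) (g ?y) / c"
      using eucl_dist[OF q gq[OF \<phi>i(1)[OF that(1)]] gq[OF \<phi>i(1)[OF that(2)]]] by simp
    also have "\<dots> = d ?x ?y" using sim[OF \<phi>i(1)[OF that(1)] \<phi>i(1)[OF that(2)]] c by simp
    also have "\<dots> = dist (\<phi> ?x) (\<phi> ?y)"
      using eucl_dist[OF p \<phi>i(1)[OF that(1)] \<phi>i(1)[OF that(2)]] by simp
    finally show ?thesis using \<phi>i that by simp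
  qed
  have "\<phi>i (\<phi> p) = p"
  proof -
    have "dist (\<phi> (\<phi>i (\<phi> p))) (\<phi> p) = d (\<phi>i (\<phi> p)) p"
      using eucl_dist[OF p \<phi>i(1)[of 0], of p] M R' by simp
    then show ?thesis using \<phi>i[of 0] M R' by simp
  qed
  then have F0: "F 0 = 0" by (simp add: F_def g(2))
  have "F ` cball 0 R' = cball 0 R'"
  proof (rule isometric_compact_self_map_surj)
    show "F ` cball 0 R' \<subseteq> cball 0 R'" using dF[of 0] F0 R' by fastforce
  qed (use dF in auto)
  moreover have "dist (\<psi> q) (\<psi> y) = d q y" using eucl_dist[OF q, of q y] y M c by simp
  then have "(\<psi> y - \<psi> q) /\<^sub>R c \<in> cball 0 R'"
    using c by (simp add: R'_def dist_norm norm_minus_commute divide_inverse mult.commute)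
  ultimately obtain v where v: "v \<in> cball 0 R'" "(\<psi> y - \<psi> q) /\<^sub>R c = F v" by blast
  then have "\<psi> y = \<psi> (g (\<phi>i (\<phi> p + v)))" using c by (simp add: F_def)
  then have "d y (g (\<phi>i (\<phi> p + v))) = 0"
    using eucl_dist[OF q y gq[OF \<phi>i(1)[OF v(1)]]] by simp
  then have "y = g (\<phi>i (\<phi> p + v))" using y gq[OF \<phi>i(1)[OF v(1)]] by simp
  then show "y \<in> g ` mball p R" using \<phi>i(1)[OF v(1)] by blast
qed

text \<open>Division by \<open>r\<close> reduces all scales to one: a fixed finite cover of
  \<open>cball 0 \<Lambda>\<close> by balls of radius \<open>c / 2\<close> works, and each of its
  members contains the image of at most one point of \<open>S\<close>. Hence \<open>Q\<close>
  depends on neither \<open>r\<close> nor \<open>z\<close> nor \<open>S\<close>.\<close>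

lemma packing_bound:
  assumes c: "0 < c"
  obtains Q :: nat where "\<And>r z S (\<phi>::'a \<Rightarrow> 'b::euclidean_space). 0 < r \<Longrightarrow> eucl z (\<Lambda> * r) \<phi> \<Longrightarrow> S \<subseteq> mball z (\<Lambda> * r) \<Longrightarrow>
    (\<And>x y. x \<in> S \<Longrightarrow> y \<in> S \<Longrightarrow> x \<noteq> y \<Longrightarrow> c * r \<le> d x y) \<Longrightarrow> finite S \<and> card S \<le> Q"
proof -
  have cov: "cball (0::'b) \<Lambda> \<subseteq> \<Union>((\<lambda>t. ball t (c / 2)) ` UNIV)"
  proof
    fix x :: 'b
    have "x \<in> ball x (c / 2)" using c by simp
    then show "x \<in> \<Union>((\<lambda>t. ball t (c / 2)) ` UNIV)" by blast
  qed
  obtain \<D> where \<D>: "\<D> \<subseteq> (\<lambda>t. ball t (c / 2)) ` (UNIV::'b set)" "finite \<D>" "cball (0::'b) \<Lambda> \<subseteq> \<Union>\<D>"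
    by (rule compactE[OF compact_cball cov]) blast+
  have "finite S \<and> card S \<le> card \<D>"
    if r: "0 < r" and e: "eucl z (\<Lambda> * r) \<phi>" and S: "S \<subseteq> mball z (\<Lambda> * r)"
      and sep: "\<And>x y. x \<in> S \<Longrightarrow> y \<in> S \<Longrightarrow> x \<noteq> y \<Longrightarrow> c * r \<le> d x y"
    for r z S and \<phi> :: "'a \<Rightarrow> 'b"
  proof -
    define P where "P x = (\<phi> x - \<phi> z) /\<^sub>R r" for x
    have zM: "z \<in> mball z (\<Lambda> * r)" using e by (auto simp: eucl_def)
    have dP: "dist (P x) (P y) = d x y / r" if "x \<in> mball z (\<Lambda> * r)" "y \<in> mball z (\<Lambda> * r)" for x y
    proof -
      have "P x - P y = (\<phi> x - \<phi> y) /\<^sub>R r" by (simp add: P_def scaleR_diff_right)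
      then have "dist (P x) (P y) = dist (\<phi> x) (\<phi> y) / r"
        using r by (simp add: dist_norm divide_inverse mult.commute)
      then show ?thesis using eucl_dist[OF e that] by simp
    qed
    have "P z = 0" by (simp add: P_def)
    have "P x \<in> cball 0 \<Lambda>" if "x \<in> S" for x
    proof -
      have x: "x \<in> mball z (\<Lambda> * r)" using that S by blast
      have "norm (P x) = d z x / r" using dP[OF zM x] \<open>P z = 0\<close> by simp
      also have "\<dots> \<le> \<Lambda>" using x r by (simp add: pos_divide_le_eq)
      finally show ?thesis by simp
    qed
    then have "\<forall>x\<in>S. \<exists>D\<in>\<D>. P x \<in> D" using \<D>(3) by blast
    then obtain D where D: "\<And>x. x \<in> S \<Longrightarrow> D x \<in> \<D> \<and> P x \<in> D x" by metis
    have "inj_on D S"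
    proof
      fix x y assume xy: "x \<in> S" "y \<in> S" "D x = D y"
      obtain t where t: "D x = ball t (c / 2)" using D[OF xy(1)] \<D>(1) by blast
      have "P x \<in> ball t (c / 2)" "P y \<in> ball t (c / 2)"
        using D[OF xy(1)] D[OF xy(2)] unfolding xy(3)[symmetric] t by blast+
      then have "dist t (P x) < c / 2" "dist t (P y) < c / 2" by simp_all
      moreover have "dist (P x) (P y) \<le> dist t (P x) + dist t (P y)" by (rule dist_triangle3)
      ultimately have "dist (P x) (P y) < c" by linarith
      moreover have "dist (P x) (P y) = d x y / r" by (rule dP) (use xy S in blast)+
      ultimately have "d x y < c * r" using r by (simp add: pos_divide_less_eq)
      then show "x = y" using sep[OF xy(1,2)] by linarith
    qed
    moreover have "D ` S \<subseteq> \<D>" using D by blast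
    ultimately show ?thesis using \<D>(2) card_inj_on_le[of D S \<D>] inj_on_finite[of D S \<D>] by simp
  qed
  then show ?thesis by (rule that)
qed

end

section \<open>Covers and Hausdorff measure\<close>

text \<open>The cover is padded to a sequence by empty sets, whose weight is 0 by convention for
  every exponent.\<close>

lemma hausdorff_premeasure_le_finite_sum:
  assumes "finite I" "F \<subseteq> (\<Union>x\<in>I. C x)"
    and C: "\<And>x. x \<in> I \<Longrightarrow> C x \<subseteq> M" "\<And>x y z. x \<in> I \<Longrightarrow> y \<in> C x \<Longrightarrow> z \<in> C x \<Longrightarrow> d y z \<le> \<delta>"
  shows "hausdorff_premeasure M d \<delta> s F \<le> (\<Sum>x\<in>I. hweight d s (C x))"
proof -
  obtain g where g: "bij_betw g {0..<card I} I"
    using ex_bij_betw_nat_finite[OF assms(1)] by blast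
  define C' where "C' k = (if k < card I then C (g k) else {})" for k
  have gI: "g k \<in> I" if "k < card I" for k using g that by (auto simp: bij_betw_def)
  have "F \<subseteq> (\<Union>k. C' k)"
  proof
    fix y assume "y \<in> F"
    then obtain x where "x \<in> I" "y \<in> C x" using assms(2) by blast
    moreover obtain k where "k < card I" "x = g k"
      using g \<open>x \<in> I\<close> by (force simp: bij_betw_def)
    ultimately show "y \<in> (\<Union>k. C' k)" by (auto simp: C'_def)
  qed
  moreover have "C' k \<subseteq> M \<and> (\<forall>x\<in>C' k. \<forall>y\<in>C' k. d x y \<le> \<delta>)" for k
    using C(1)[OF gI] C(2)[OF gI] by (auto simp: C'_def)
  ultimately have "hausdorff_premeasure M d \<delta> s F \<le> (\<Sum>k. hweight d s (C' k))"
    unfolding hausdorff_premeasure_def by (intro Inf_lower) blast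
  also have "\<dots> = (\<Sum>k\<in>{0..<card I}. hweight d s (C' k))"
    by (rule suminf_finite) (auto simp: C'_def hweight_def)
  also have "\<dots> = (\<Sum>k\<in>{0..<card I}. hweight d s (C (g k)))"
    by (intro sum.cong) (auto simp: C'_def)
  also have "\<dots> = (\<Sum>x\<in>I. hweight d s (C x))" by (rule sum.reindex_bij_betw[OF g])
  finally show ?thesis .
qed

text \<open>The exponent is positive because a one-point set has weight 1 at exponent 0, whereas
  \<open>0 powr 0 = 0\<close>.\<close>

lemma (in Metric_space) hweight_le:
  assumes "0 < s" "0 \<le> b" "\<And>x y. x \<in> C \<Longrightarrow> y \<in> C \<Longrightarrow> d x y \<le> b"
  shows "hweight d s C \<le> ennreal (b powr s)"
proof (cases "C = {}")
  case False
  then obtain x0 where x0: "x0 \<in> C" by blast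
  have "(SUP (x, y) \<in> C \<times> C. d x y) \<le> b" using False assms(3) by (intro cSUP_least) auto
  moreover have "0 \<le> (SUP (x, y) \<in> C \<times> C. d x y)"
  proof (rule cSUP_upper2[where x = "(x0, x0)"])
    show "bdd_above ((\<lambda>(x, y). d x y) ` (C \<times> C))"
      using assms(3) by (intro bdd_aboveI[where M = b]) auto
  qed (use x0 in auto)
  ultimately show ?thesis
    using False assms by (auto simp: hweight_def intro!: ennreal_leI powr_mono2)
qed (simp add: hweight_def)

text \<open>The strict inequality for the diameter turns a cover by arbitrary sets into one by open balls.\<close>

lemma (in Metric_space) hweight_enlarge:
  assumes "0 \<le> s" "C \<noteq> {}" "C \<subseteq> M" "\<And>x y. x \<in> C \<Longrightarrow> y \<in> C \<Longrightarrow> d x y \<le> \<delta>" "\<delta> < r0" "0 < \<eta>"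
  obtains x r where "x \<in> C" "0 < r" "r < r0" "C \<subseteq> mball x r" "ennreal (r powr s) \<le> hweight d s C + ennreal \<eta>"
proof -
  obtain x where x: "x \<in> C" using assms(2) by blast
  define D where "D = (SUP (x, y) \<in> C \<times> C. d x y)"
  have bdd: "bdd_above ((\<lambda>(x, y). d x y) ` (C \<times> C))"
    using assms(4) by (intro bdd_aboveI[where M = \<delta>]) auto
  have dD: "d y z \<le> D" if "y \<in> C" "z \<in> C" for y z
    unfolding D_def using that by (intro cSUP_upper2[OF bdd, where x = "(y, z)"]) auto
  have "D \<le> \<delta>" unfolding D_def using assms(2,4) by (intro cSUP_least) auto
  have "0 \<le> D" using dD[OF x x] x assms(3) by (auto simp: subset_iff)
  \<comment> \<open>A radius above the diameter \<open>D\<close> is sought whose power exceeds the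
    weight by at most \<open>\<eta>\<close>. At exponent 0 every admissible radius will do;
    otherwise right continuity at \<open>D\<close> is used, which covers \<open>D = 0\<close> as
    well since \<open>s > 0\<close>.\<close>
  obtain r where r: "D < r" "r < r0" "ennreal (r powr s) \<le> hweight d s C + ennreal \<eta>"
  proof (cases "s = 0")
    case True
    obtain r where "D < r" "r < r0" using \<open>D \<le> \<delta>\<close> assms(5) dense[of D r0] by auto
    then show ?thesis using that[of r] True assms(2) \<open>0 \<le> D\<close> by (simp add: hweight_def)
  next
    case False
    have "((\<lambda>r. r powr s) \<longlongrightarrow> D powr s) (at_right D)"
      by (rule tendsto_powr'[OF tendsto_ident_at tendsto_const])
        (use False assms(1) \<open>0 \<le> D\<close> in \<open>auto simp: eventually_at_filter\<close>)
    then have "\<forall>\<^sub>F r in at_right D. r powr s < D powr s + \<eta>"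
      by (rule order_tendstoD) (use assms in simp)
    moreover have "\<forall>\<^sub>F r in at_right D. r < r0"
      using \<open>D \<le> \<delta>\<close> assms(5) by (intro eventually_at_right_real[THEN eventually_mono]) auto
    moreover have "\<forall>\<^sub>F r in at_right D. D < r"
      by (simp add: eventually_at_filter)
    ultimately have "\<forall>\<^sub>F r in at_right D. r powr s < D powr s + \<eta> \<and> r < r0 \<and> D < r"
      by eventually_elim auto
    then obtain r where r: "r powr s < D powr s + \<eta>" "r < r0" "D < r"
      using eventually_happens'[OF trivial_limit_at_right_real] by blast
    have "hweight d s C + ennreal \<eta> = ennreal (D powr s + \<eta>)"
      using assms False by (simp add: hweight_def D_def ennreal_plus)
    then show ?thesis using that[of r] r by (simp add: ennreal_leI)
  qed
  show ?thesis
  proof (rule that[OF x _ r(2) _ r(3)])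
    show "C \<subseteq> mball x r" using dD[OF x] r(1) assms(3) x by fastforce
  qed (use r(1) \<open>0 \<le> D\<close> in simp)
qed

section \<open>Words in a graph of similitudes\<close>

text \<open>Only the metric data of the system survive here, detached from the manifold. An edge
  maps the set of its head into the set of its tail, so the leftmost letter of a word is the map
  applied last and its tail carries the image.\<close>

locale similitude_graph = Metric_space M d for M :: "'a set" and d +
  fixes G :: "(nat, 'e) pre_digraph" and X :: "nat \<Rightarrow> 'a set" and f :: "'e \<Rightarrow> 'a \<Rightarrow> 'a" and \<rho> :: "'e \<Rightarrow> real"
  assumes finite_arcs: "finite (arcs G)" and finite_verts: "finite (verts G)"
    and arcs_wf: "e \<in> arcs G \<Longrightarrow> tail G e \<in> verts G" "e \<in> arcs G \<Longrightarrow> head G e \<in> verts G"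
    and X_subset: "j \<in> verts G \<Longrightarrow> X j \<subseteq> M"
    and maps_into: "e \<in> arcs G \<Longrightarrow> f e ` X (head G e) \<subseteq> X (tail G e)"
    and ratio_range: "e \<in> arcs G \<Longrightarrow> 0 < \<rho> e" "e \<in> arcs G \<Longrightarrow> \<rho> e < 1"
    and similitude: "e \<in> arcs G \<Longrightarrow> x \<in> X (head G e) \<Longrightarrow> y \<in> X (head G e) \<Longrightarrow> d (f e x) (f e y) = \<rho> e * d x y"
begin

fun wpath :: "nat \<Rightarrow> 'e list \<Rightarrow> bool" where
  "wpath i [] \<longleftrightarrow> True"
| "wpath i (e # es) \<longleftrightarrow> e \<in> arcs G \<and> tail G e = i \<and> wpath (head G e) es"

fun endv :: "nat \<Rightarrow> 'e list \<Rightarrow> nat" where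
  "endv i [] = i"
| "endv i (e # es) = endv (head G e) es"

definition words :: "nat \<Rightarrow> nat \<Rightarrow> 'e list set" where
  "words i q = {es. wpath i es \<and> length es = q}"

definition ratio :: "'e list \<Rightarrow> real" where
  "ratio es = prod_list (map \<rho> es)"

definition out :: "nat \<Rightarrow> 'e set" where
  "out i = {e \<in> arcs G. tail G e = i}"

text \<open>For \<open>c e = \<rho> e powr s\<close> this is the incidence matrix acting on
  functions of the vertices; other weights \<open>c\<close> occur in the lower bound.\<close>

definition transfer :: "('e \<Rightarrow> real) \<Rightarrow> (nat \<Rightarrow> real) \<Rightarrow> nat \<Rightarrow> real" where
  "transfer c h i = (\<Sum>e\<in>out i. c e * h (head G e))"

definition wt :: "('e \<Rightarrow> real) \<Rightarrow> 'e list \<Rightarrow> real" where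
  "wt c es = prod_list (map c es)"

lemma ratio_simps [simp]: "ratio [] = 1" "ratio (e # es) = \<rho> e * ratio es"
  "ratio (es @ fs) = ratio es * ratio fs"
  by (auto simp: ratio_def)

lemma wt_simps [simp]: "wt c [] = 1" "wt c (e # es) = c e * wt c es" "wt c (es @ fs) = wt c es * wt c fs"
  by (auto simp: wt_def)

lemma path_append [simp]: "wpath i (es @ fs) \<longleftrightarrow> wpath i es \<and> wpath (endv i es) fs"
  by (induction es arbitrary: i) auto

lemma endv_append [simp]: "endv i (es @ fs) = endv (endv i es) fs"
  by (induction es arbitrary: i) auto

lemma endv_verts: "i \<in> verts G \<Longrightarrow> wpath i es \<Longrightarrow> endv i es \<in> verts G"
  by (induction es arbitrary: i) (use arcs_wf in auto)

lemma awalk_iff: "pre_digraph.awalk G i es j \<longleftrightarrow> i \<in> verts G \<and> wpath i es \<and> endv i es = j"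
proof -
  have "set es \<subseteq> arcs G \<and> pre_digraph.cas G i es j \<longleftrightarrow> wpath i es \<and> endv i es = j"
    by (induction es arbitrary: i) (auto simp: pre_digraph.cas.simps)
  then show ?thesis by (simp add: pre_digraph.awalk_def)
qed

lemma ratio_pos: "wpath i es \<Longrightarrow> 0 < ratio es"
  by (induction es arbitrary: i) (use ratio_range in auto)

lemma foldr_in: "wpath i es \<Longrightarrow> x \<in> X (endv i es) \<Longrightarrow> foldr f es x \<in> X i"
  by (induction es arbitrary: i) (use maps_into in fastforce)+

lemma foldr_dist:
  "wpath i es \<Longrightarrow> x \<in> X (endv i es) \<Longrightarrow> y \<in> X (endv i es) \<Longrightarrow>
    d (foldr f es x) (foldr f es y) = ratio es * d x y"
proof (induction es arbitrary: i)
  case (Cons e es)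
  then have "d (f e (foldr f es x)) (f e (foldr f es y)) = \<rho> e * d (foldr f es x) (foldr f es y)"
    using foldr_in[of "head G e" es] by (intro similitude) auto
  then show ?case using Cons.IH[of "head G e"] Cons.prems by simp
qed simp

lemma finite_words [simp]: "finite (words i q)"
proof (rule finite_subset)
  have "wpath i es \<Longrightarrow> set es \<subseteq> arcs G" for es
    by (induction es arbitrary: i) auto
  then show "words i q \<subseteq> {es. set es \<subseteq> arcs G \<and> length es = q}" by (auto simp: words_def)
qed (rule finite_lists_length_eq[OF finite_arcs])

lemma finite_out [simp]: "finite (out i)"
  using finite_arcs by (simp add: out_def)

lemma words_0 [simp]: "words i 0 = {[]}"
  by (auto simp: words_def)

lemma words_Suc: "words i (Suc q) = (\<Union>e\<in>out i. (#) e ` words (head G e) q)"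
  by (auto simp: words_def out_def length_Suc_conv)

lemma sum_words_Suc: "(\<Sum>es\<in>words i (Suc q). g es) = (\<Sum>e\<in>out i. \<Sum>es\<in>words (head G e) q. g (e # es))"
proof -
  have "(\<Sum>es\<in>words i (Suc q). g es) = (\<Sum>e\<in>out i. \<Sum>es\<in>(#) e ` words (head G e) q. g es)"
    unfolding words_Suc by (rule sum.UNION_disjoint) auto
  also have "\<dots> = (\<Sum>e\<in>out i. \<Sum>es\<in>words (head G e) q. g (e # es))"
    by (rule sum.cong[OF refl]) (subst sum.reindex, auto)
  finally show ?thesis .
qed

lemma funpow_transfer: "(transfer c ^^ q) h i = (\<Sum>es\<in>words i q. wt c es * h (endv i es))"
proof (induction q arbitrary: i)
  case (Suc q)
  then show ?case
    by (simp add: sum_words_Suc transfer_def sum_distrib_left mult.assoc)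
qed simp

lemma ratio_words_bound:
  obtains R where "0 < R" "R < 1" "\<And>e. e \<in> arcs G \<Longrightarrow> \<rho> e \<le> R" "\<And>i q es. es \<in> words i q \<Longrightarrow> ratio es \<le> R ^ q"
proof -
  \<comment> \<open>The value \<open>1/2\<close> keeps the maximum defined and positive if there are
    no edges.\<close>
  define R where "R = Max (insert (1/2) (\<rho> ` arcs G))"
  have R: "\<rho> e \<le> R" if "e \<in> arcs G" for e
    unfolding R_def using that finite_arcs by (intro Max_ge) auto
  have "1/2 \<le> R" unfolding R_def using finite_arcs by (intro Max_ge) auto
  moreover have "R < 1" unfolding R_def using finite_arcs ratio_range by (subst Max_less_iff) auto
  moreover have "ratio es \<le> R ^ q" if "es \<in> words i q" for i q es
    using that
  proof (induction q arbitrary: i es)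
    case (Suc q)
    then obtain e es' where *: "es = e # es'" "e \<in> out i" "es' \<in> words (head G e) q"
      by (auto simp: words_Suc)
    then show ?case using Suc.IH[OF *(3)] R[of e] ratio_range[of e] ratio_pos[of "head G e" es'] \<open>1/2 \<le> R\<close>
      by (auto simp: out_def words_def intro!: mult_mono)
  qed simp
  ultimately show ?thesis using R by (intro that[of R]) auto
qed

lemma min_ratio:
  obtains r where "0 < r" "r < 1" "\<And>e. e \<in> arcs G \<Longrightarrow> r \<le> \<rho> e"
proof -
  define r where "r = Min (insert (1/2) (\<rho> ` arcs G))"
  have "r \<le> \<rho> e" if "e \<in> arcs G" for e
    unfolding r_def using that finite_arcs by (intro Min_le) auto
  moreover have "0 < r" unfolding r_def using finite_arcs ratio_range by (subst Min_gr_iff) auto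
  moreover have "r \<le> 1/2" unfolding r_def using finite_arcs by (intro Min_le) auto
  ultimately show ?thesis by (intro that[of r]) auto
qed

lemma wt_powr: "wpath i es \<Longrightarrow> wt (\<lambda>e. \<rho> e powr s) es = ratio es powr s"
proof (induction es arbitrary: i)
  case (Cons e es)
  then show ?case using ratio_range[of e] ratio_pos[of "head G e" es] by (auto simp: powr_mult)
qed (simp)

section \<open>The upper bound\<close>

definition level :: "(nat \<Rightarrow> 'a set) \<Rightarrow> nat \<Rightarrow> 'a set" where
  "level W q = (\<Union>i\<in>verts G. \<Union>es\<in>words i q. foldr f es ` W (endv i es))"

lemma hausdorff_measure_zero:
  assumes W: "\<And>j. j \<in> verts G \<Longrightarrow> W j \<subseteq> X j"
    and D: "\<And>j x y. j \<in> verts G \<Longrightarrow> x \<in> W j \<Longrightarrow> y \<in> W j \<Longrightarrow> d x y \<le> D" "0 < D"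
    and K: "\<And>q. K \<subseteq> level W q" and s: "0 < s"
    and lim: "\<And>i. i \<in> verts G \<Longrightarrow> (\<lambda>q. (transfer (\<lambda>e. \<rho> e powr s) ^^ q) (\<lambda>_. 1) i) \<longlonglongrightarrow> 0"
  shows "hausdorff_measure M d s K = 0"
proof -
  \<comment> \<open>By \<open>funpow_transfer\<close> this is the sum of
    \<open>ratio es powr s\<close> over all words of length \<open>q\<close>, from all starting
    vertices.\<close>
  define T where "T q = (\<Sum>i\<in>verts G. (transfer (\<lambda>e. \<rho> e powr s) ^^ q) (\<lambda>_. 1) i)" for q
  have T0: "(\<lambda>q. D powr s * T q) \<longlonglongrightarrow> 0"
    unfolding T_def by (intro tendsto_mult_right_zero tendsto_null_sum lim)
  obtain R where R: "0 < R" "R < 1" "\<And>i q es. es \<in> words i q \<Longrightarrow> ratio es \<le> R ^ q"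
    using ratio_words_bound by metis
  have "hausdorff_premeasure M d \<delta> s K = 0" if \<delta>: "0 < \<delta>" for \<delta>
  proof -
    have small: "hausdorff_premeasure M d \<delta> s K \<le> ennreal \<epsilon>" if \<epsilon>: "0 < \<epsilon>" for \<epsilon>
    proof -
      have "(\<lambda>q. D * R ^ q) \<longlonglongrightarrow> 0" using R by (auto intro!: tendsto_mult_right_zero LIMSEQ_power_zero)
      then have "\<forall>\<^sub>F q in sequentially. D * R ^ q < \<delta>" using \<delta> by (rule order_tendstoD)
      moreover have "\<forall>\<^sub>F q in sequentially. D powr s * T q < \<epsilon>" using T0 \<epsilon> by (rule order_tendstoD)
      ultimately have "\<forall>\<^sub>F q in sequentially. D * R ^ q < \<delta> \<and> D powr s * T q < \<epsilon>"
        by eventually_elim auto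
      then obtain q where q: "D * R ^ q < \<delta>" "D powr s * T q < \<epsilon>"
        by (auto simp: eventually_sequentially)
      \<comment> \<open>The starting vertex is part of the index, since for \<open>q = 0\<close> the
        empty word belongs to every vertex and stands for different sets.\<close>
      define I where "I = (SIGMA i:verts G. words i q)"
      define C where "C = (\<lambda>(i, es). foldr f es ` W (endv i es))"
      have diam: "d y z \<le> ratio es * D"
        if "i \<in> verts G" "es \<in> words i q" and C: "y \<in> C (i, es)" "z \<in> C (i, es)" for i es y z
      proof -
        have p: "wpath i es" "endv i es \<in> verts G" using that endv_verts by (auto simp: words_def)
        obtain y' z' where yz: "y = foldr f es y'" "z = foldr f es z'" "y' \<in> W (endv i es)" "z' \<in> W (endv i es)"
          using C unfolding C_def prod.case by blast
        have "d y z = ratio es * d y' z'"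
          unfolding yz(1,2) using W[OF p(2)] yz by (intro foldr_dist[OF p(1)]) auto
        then show ?thesis using D(1)[OF p(2) yz(3,4)] ratio_pos[OF p(1)] by (simp add: mult_left_mono)
      qed
      have "hausdorff_premeasure M d \<delta> s K \<le> (\<Sum>x\<in>I. hweight d s (C x))"
      proof (rule hausdorff_premeasure_le_finite_sum)
        show "finite I" unfolding I_def using finite_verts by auto
        show "K \<subseteq> (\<Union>x\<in>I. C x)" 
        proof
          fix y assume "y \<in> K"
          then obtain i es where "i \<in> verts G" "es \<in> words i q" "y \<in> foldr f es ` W (endv i es)"
            using K[of q] unfolding level_def by blast
          then show "y \<in> (\<Union>x\<in>I. C x)" by (intro UN_I[of "(i, es)"]) (auto simp: I_def C_def)
        qed
        show "C x \<subseteq> M" if "x \<in> I" for x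
        proof -
          obtain i es where x: "x = (i, es)" "i \<in> verts G" "wpath i es" using \<open>x \<in> I\<close> by (auto simp: I_def words_def)
          then have "C x \<subseteq> X i" using W[OF endv_verts[OF x(2,3)]] foldr_in[OF x(3)] by (auto simp: C_def)
          then show ?thesis using X_subset x(2) by blast
        qed
        show "d y z \<le> \<delta>" if "x \<in> I" "y \<in> C x" "z \<in> C x" for x y z
        proof -
          obtain i es where x: "x = (i, es)" "i \<in> verts G" "es \<in> words i q" using \<open>x \<in> I\<close> by (auto simp: I_def)
          have "d y z \<le> ratio es * D" using that x by (intro diam) auto
          also have "\<dots> \<le> R ^ q * D" using R(3)[OF x(3)] D(2) by (simp add: mult_right_mono)
          finally show ?thesis using q(1) by (simp add: mult.commute)
        qed
      qed
      also have "\<dots> \<le> (\<Sum>x\<in>I. ennreal ((ratio (snd x) * D) powr s))"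
      proof (rule sum_mono)
        fix x assume "x \<in> I"
        then obtain i es where x: "x = (i, es)" "i \<in> verts G" "es \<in> words i q" by (auto simp: I_def)
        then show "hweight d s (C x) \<le> ennreal ((ratio (snd x) * D) powr s)"
          using ratio_pos[of i es] D(2) diam s by (intro hweight_le) (auto simp: words_def)
      qed
      also have "\<dots> = ennreal (\<Sum>x\<in>I. (ratio (snd x) * D) powr s)" by simp
      also have "(\<Sum>x\<in>I. (ratio (snd x) * D) powr s) = (\<Sum>i\<in>verts G. \<Sum>es\<in>words i q. (ratio es * D) powr s)"
        unfolding I_def using finite_verts by (subst sum.Sigma) (auto simp: case_prod_unfold)
      also have "\<dots> = (\<Sum>i\<in>verts G. \<Sum>es\<in>words i q. D powr s * wt (\<lambda>e. \<rho> e powr s) es)"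
      proof (intro sum.cong refl)
        fix i es assume "es \<in> words i q"
        then have p: "wpath i es" by (simp add: words_def)
        then show "(ratio es * D) powr s = D powr s * wt (\<lambda>e. \<rho> e powr s) es"
          using ratio_pos[OF p] D(2) by (simp add: wt_powr[OF p] powr_mult)
      qed
      also have "\<dots> = D powr s * T q" by (simp add: T_def funpow_transfer sum_distrib_left)
      finally show ?thesis using q(2) by (meson ennreal_leI less_imp_le order_trans)
    qed
    have "hausdorff_premeasure M d \<delta> s K \<le> 0"
      by (rule ennreal_le_epsilon) (use small in auto)
    then show ?thesis by simp
  qed
  then show ?thesis unfolding hausdorff_measure_def by (subst SUP_cong[OF refl, of _ _ "\<lambda>_. 0"]) auto
qed

end

section \<open>The lower bound\<close>

context similitude_graph
begin

text \<open>A common first letter is removed by injectivity of the similitude; at the first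
  difference the images belong to different edges with the same tail, which the open set condition
  separates. If one word were a prefix of the other, the images would be nested.\<close>

lemma images_incomparable_disjoint:
  assumes U: "\<And>j. j \<in> verts G \<Longrightarrow> U j \<subseteq> X j"
    and inv: "\<And>e. e \<in> arcs G \<Longrightarrow> f e ` U (head G e) \<subseteq> U (tail G e)"
    and dis: "\<And>e e'. e \<in> arcs G \<Longrightarrow> e' \<in> arcs G \<Longrightarrow> tail G e = tail G e' \<Longrightarrow> e \<noteq> e' \<Longrightarrow>
      f e ` U (head G e) \<inter> f e' ` U (head G e') = {}"
  shows "i \<in> verts G \<Longrightarrow> wpath i v \<Longrightarrow> wpath i w \<Longrightarrow> \<not> prefix v w \<Longrightarrow> \<not> prefix w v \<Longrightarrow>
    foldr f v ` U (endv i v) \<inter> foldr f w ` U (endv i w) = {}"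
proof (induction v arbitrary: i w)
  case (Cons e v)
  then obtain e' w' where w: "w = e' # w'" by (cases w) auto
  have img: "foldr f v ` U (endv i v) \<subseteq> U i" if "wpath i v" for i v
    using that by (induction v arbitrary: i) (use inv in fastforce)+
  have e: "e \<in> arcs G" "tail G e = i" "wpath (head G e) v" using Cons.prems by auto
  have e': "e' \<in> arcs G" "tail G e' = i" "wpath (head G e') w'" using Cons.prems w by auto
  show ?case
  proof (cases "e = e'")
    case False
    then have "f e ` U (head G e) \<inter> f e' ` U (head G e') = {}" using dis e e' by simp
    then show ?thesis using img[OF e(3)] img[OF e'(3)] w by fastforce
  next
    case True
    have h: "head G e \<in> verts G" using arcs_wf(2) e(1) .
    have "inj_on (f e) (X (head G e))"
    proof
      fix x y assume xy: "x \<in> X (head G e)" "y \<in> X (head G e)" "f e x = f e y"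
      then have M: "x \<in> M" "y \<in> M" using X_subset[OF h] by auto
      have "f e x \<in> M" using maps_into[OF e(1)] X_subset[OF arcs_wf(1)[OF e(1)]] xy(1) by blast
      then have "\<rho> e * d x y = 0" using similitude[OF e(1) xy(1,2)] xy(3) by simp
      then show "x = y" using ratio_range[OF e(1)] M by simp
    qed
    moreover have "foldr f v ` U (endv (head G e) v) \<subseteq> X (head G e)"
      "foldr f w' ` U (endv (head G e) w') \<subseteq> X (head G e)"
      using img[OF e(3)] img[OF e'(3)] U[OF h] True by auto
    moreover have "foldr f v ` U (endv (head G e) v) \<inter> foldr f w' ` U (endv (head G e) w') = {}"
      using Cons.prems w True e e' h by (intro Cons.IH) auto
    ultimately have "f e ` (foldr f v ` U (endv (head G e) v)) \<inter> f e ` (foldr f w' ` U (endv (head G e) w')) = {}"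
      by (simp add: inj_on_image_Int[symmetric])
    then show ?thesis using w True by (simp add: image_image)
  qed
qed simp

lemma level_memI: "i \<in> verts G \<Longrightarrow> wpath i es \<Longrightarrow> x \<in> W (endv i es) \<Longrightarrow> foldr f es x \<in> level W (length es)"
  unfolding level_def words_def by blast

text \<open>A single point \<open>z\<close> has to be close to the images of the base points under
  all prefixes of \<open>w\<close> at once, because the prefix to be used is chosen only after
  \<open>z\<close> has been located in a ball of the cover. A point of the image of \<open>W\<close>
  under a finite word is known to lie only in the levels up to its length, so \<open>z\<close> is
  found by compactness along ever longer extensions of \<open>w\<close>.\<close>

lemma prefix_point:
  assumes W: "\<And>j. j \<in> verts G \<Longrightarrow> W j \<subseteq> X j" "\<And>j. j \<in> verts G \<Longrightarrow> W j \<noteq> {}"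
    and comp: "\<And>q. compactin mtopology (level W q)" and dec: "\<And>q. level W (Suc q) \<subseteq> level W q"
    and u: "\<And>j. j \<in> verts G \<Longrightarrow> u j \<in> X j"
    and B: "\<And>j y. j \<in> verts G \<Longrightarrow> y \<in> level W 0 \<Longrightarrow> d y (u j) \<le> B"
    and i: "i \<in> verts G" and w: "wpath i w" and ext: "\<And>q. words (endv i w) q \<noteq> {}"
  shows "\<exists>z\<in>(\<Inter>q. level W q). \<forall>v. prefix v w \<longrightarrow> d z (foldr f v (u (endv i v))) \<le> B * ratio v"
proof -
  have dec0: "level W (m + k) \<subseteq> level W m" for m k
    by (induction k) (use dec in auto)
  define A where "A q = level W (length w + q) \<inter> (\<Inter>v\<in>set (prefixes w). mcball (foldr f v (u (endv i v))) (B * ratio v))" for q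
  have pre: "wpath i v \<and> endv i v \<in> verts G \<and> foldr f v (u (endv i v)) \<in> X i" if "prefix v w" for v
  proof -
    have "wpath i v" using that w by (auto simp: prefix_def)
    then show ?thesis using endv_verts[OF i] foldr_in u by blast
  qed
  have ne: "A q \<noteq> {}" for q
  proof -
    obtain es where es: "wpath (endv i w) es" "length es = q" using ext[of q] by (auto simp: words_def)
    have we: "wpath i (w @ es)" using w es by simp
    define j where "j = endv i (w @ es)"
    have j: "j \<in> verts G" unfolding j_def by (rule endv_verts[OF i we])
    obtain x where x: "x \<in> W j" using W(2)[OF j] by blast
    define y where "y = foldr f (w @ es) x"
    have "y \<in> level W (length w + q)"
      using level_memI[of i "w @ es" x W] i we es x by (simp add: y_def j_def)
    moreover have "d (foldr f v (u (endv i v))) y \<le> B * ratio v \<and> foldr f v (u (endv i v)) \<in> M \<and> y \<in> M"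
      if v: "prefix v w" for v
    proof -
      obtain r where r: "w = v @ r" using v by (auto simp: prefix_def)
      let ?k = "endv i v" and ?x = "foldr f (r @ es) x"
      have k: "?k \<in> verts G" "wpath i v" using pre v by auto
      have rp: "wpath ?k (r @ es)" "endv ?k (r @ es) = j" using we r by (auto simp: j_def)
      have xX: "?x \<in> X ?k" using foldr_in[OF rp(1)] rp(2) W(1)[OF j] x by auto
      \<comment> \<open>What remains after removing \<open>v\<close> is itself a point of a level,
        hence of level 0, where distances to base points are at most \<open>B\<close>; applying the
        maps of \<open>v\<close> scales this by \<open>ratio v\<close>.\<close>
      have "?x \<in> level W (length (r @ es))"
        using level_memI[of ?k "r @ es" x W] k rp x by simp
      then have "?x \<in> level W 0" using dec0[of 0] by auto
      then have le: "d ?x (u ?k) \<le> B" using B k by blast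
      have yx: "y = foldr f v ?x" by (simp add: y_def r)
      have "d y (foldr f v (u ?k)) = ratio v * d ?x (u ?k)"
        unfolding yx using xX u[OF k(1)] by (intro foldr_dist[OF k(2)])
      also have "\<dots> \<le> ratio v * B" using le ratio_pos[OF k(2)] by simp
      finally have "d (foldr f v (u ?k)) y \<le> B * ratio v" by (simp add: commute mult.commute)
      moreover have "y \<in> X i" unfolding yx using foldr_in[OF k(2) xX] .
      ultimately show ?thesis using pre[OF v] X_subset[OF i] by blast
    qed
    ultimately have "y \<in> A q" unfolding A_def by auto
    then show ?thesis by blast
  qed
  have clo: "closedin mtopology (A q)" for q
  proof -
    have "closedin mtopology (level W (length w + q))"
      using comp Hausdorff_space_mtopology compactin_imp_closedin by blast
    moreover have "closedin mtopology (\<Inter>v\<in>set (prefixes w). mcball (foldr f v (u (endv i v))) (B * ratio v))"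
      by (intro closedin_Inter) (auto simp: set_prefixes_eq)
    ultimately show ?thesis unfolding A_def by blast
  qed
  have "(\<Inter>q. A q) \<noteq> {}"
  proof (rule compact_space_imp_nest)
    show "compact_space (subtopology mtopology (level W 0))"
      by (rule compact_space_subtopology[OF comp])
    have sub: "A q \<subseteq> level W 0" for q unfolding A_def using dec0[of 0] by auto
    then show "closedin (subtopology mtopology (level W 0)) (A q)" for q
      using clo by (metis closedin_subset_topspace)
    show "decseq A" unfolding A_def decseq_def
    proof (intro allI impI)
      fix m n :: nat assume "m \<le> n"
      then show "level W (length w + n) \<inter> (\<Inter>v\<in>set (prefixes w). mcball (foldr f v (u (endv i v))) (B * ratio v))
        \<subseteq> level W (length w + m) \<inter> (\<Inter>v\<in>set (prefixes w). mcball (foldr f v (u (endv i v))) (B * ratio v))"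
        using dec0[of "length w + m" "n - m"] by auto
    qed
  qed (rule ne)
  then obtain z where z: "\<And>q. z \<in> A q" by blast
  have "z \<in> level W q" for q
  proof -
    have "z \<in> level W (q + length w)" using z[of q] by (simp add: A_def add.commute)
    then show ?thesis using dec0 by blast
  qed
  moreover have "d z (foldr f v (u (endv i v))) \<le> B * ratio v" if "prefix v w" for v
    using z[of 0] that by (auto simp: A_def commute)
  ultimately show ?thesis by blast
qed

text \<open>The cut set at scale \<open>r\<close>: the ratio drops to \<open>r\<close> or below for
  the first time at the end of \<open>v\<close>, which makes all images of comparable size.\<close>

definition stopping :: "nat \<Rightarrow> real \<Rightarrow> 'e list \<Rightarrow> bool" where
  "stopping i r v \<longleftrightarrow> wpath i v \<and> ratio v \<le> r \<and> (\<forall>v'. strict_prefix v' v \<longrightarrow> r < ratio v')"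

lemma stopping_prefix_exists:
  assumes "wpath i w" "ratio w \<le> r"
  obtains v where "prefix v w" "stopping i r v"
proof -
  define k where "k = (LEAST k. ratio (take k w) \<le> r)"
  have k: "ratio (take k w) \<le> r"
    unfolding k_def by (rule LeastI[of _ "length w"]) (use assms in simp)
  have "r < ratio v'" if "strict_prefix v' (take k w)" for v'
  proof -
    have len: "length v' < k" using prefix_length_less[OF that] by simp
    have "v' = take (length v') (take k w)"
      using that by (metis append_eq_conv_conj prefix_def strict_prefix_def)
    then have "v' = take (length v') w" using len by (metis min.absorb3 take_take min.commute)
    then show ?thesis using not_less_Least[of "length v'" "\<lambda>k. ratio (take k w) \<le> r"] len
      by (metis k_def not_le)
  qed
  moreover have "wpath i (take k w)" using assms(1) by (metis append_take_drop_id path_append)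
  ultimately show ?thesis using k by (intro that[of "take k w"]) (auto simp: stopping_def take_is_prefix)
qed

lemma stopping_incomparable:
  "stopping i r v \<Longrightarrow> stopping i r w \<Longrightarrow> prefix v w \<Longrightarrow> v = w"
  unfolding stopping_def strict_prefix_def by (meson not_le)

lemma stopping_ratio_lower:
  assumes "stopping i r v" "0 < r" "r < 1" and m: "0 < m" "m < 1" "\<And>e. e \<in> arcs G \<Longrightarrow> m \<le> \<rho> e"
  shows "m * r \<le> ratio v"
proof -
  \<comment> \<open>The empty word has ratio 1 and is excluded by \<open>r < 1\<close>, so there is
    a last letter, and before it the ratio still exceeded \<open>r\<close>.\<close>
  have "v \<noteq> []" using assms(1,3) by (auto simp: stopping_def)
  then obtain v' e where v: "v = v' @ [e]" by (cases v rule: rev_cases) auto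
  have "strict_prefix v' v" by (simp add: v strict_prefix_def)
  then have "r < ratio v'" "e \<in> arcs G" "wpath i v'" using assms(1) v by (auto simp: stopping_def)
  then have "m * r \<le> \<rho> e * ratio v'" using m(3)[of e] ratio_range[of e] assms(2)
    by (intro mult_mono) auto
  then show ?thesis by (simp add: v mult.commute)
qed

lemma transfer_cong: "(\<And>j. j \<in> verts G \<Longrightarrow> g j = h j) \<Longrightarrow> transfer c g i = transfer c h i"
  unfolding transfer_def using arcs_wf(2) by (intro sum.cong) (auto simp: out_def)

text \<open>\<open>wt c v * h (endv i v)\<close> is the mass of the cylinder of \<open>v\<close>.
  Invariance of \<open>h\<close> lets mass pass to longer words without loss; this is the
  consistency condition of a measure on infinite paths.\<close>

lemma sum_words_prefix:
  assumes h: "\<And>i. i \<in> verts G \<Longrightarrow> transfer c h i = h i"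
    and i: "i \<in> verts G" and v: "wpath i v" "length v \<le> n"
  shows "(\<Sum>w\<in>{w \<in> words i n. prefix v w}. wt c w * h (endv i w)) = wt c v * h (endv i v)"
proof -
  have inv: "(transfer c ^^ q) h i = h i" if "i \<in> verts G" for q i
    using that
  proof (induction q arbitrary: i)
    case (Suc q)
    have "transfer c ((transfer c ^^ q) h) i = transfer c h i"
      using Suc.IH by (rule transfer_cong)
    then show ?case using h Suc.prems by simp
  qed simp
  have set: "{w \<in> words i n. prefix v w} = (@) v ` words (endv i v) (n - length v)"
    using v by (auto simp: words_def prefix_def)
  have "(\<Sum>w\<in>{w \<in> words i n. prefix v w}. wt c w * h (endv i w))
      = (\<Sum>w\<in>words (endv i v) (n - length v). wt c v * (wt c w * h (endv (endv i v) w)))"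
    unfolding set by (subst sum.reindex) (auto simp: inj_on_def mult.assoc)
  also have "\<dots> = wt c v * (transfer c ^^ (n - length v)) h (endv i v)"
    by (simp add: funpow_transfer sum_distrib_left)
  finally show ?thesis using inv endv_verts[OF i v(1)] by simp
qed

lemma wt_le_ratio_powr:
  assumes "\<And>e. e \<in> arcs G \<Longrightarrow> 0 \<le> c e \<and> c e \<le> \<rho> e powr s"
  shows "wpath i v \<Longrightarrow> 0 \<le> wt c v \<and> wt c v \<le> ratio v powr s"
proof -
  assume "wpath i v"
  then have "0 \<le> wt c v \<and> wt c v \<le> wt (\<lambda>e. \<rho> e powr s) v"
    by (induction v arbitrary: i) (use assms in \<open>auto intro!: mult_mono\<close>)
  then show ?thesis using wt_powr[OF \<open>wpath i v\<close>] by simp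
qed

end

text \<open>The parameter \<open>ty\<close> fixes the Euclidean model space, whose type occurs
  otherwise only in the flatness assumption and is not determined by the metric data.\<close>

locale gosc_graph = similitude_graph M d G X f \<rho>
  for M :: "'a set" and d and G :: "(nat, 'e) pre_digraph" and X f \<rho> +
  fixes U W :: "nat \<Rightarrow> 'a set" and ty :: "'b::euclidean_space itself"
  assumes flat: "\<And>p. p \<in> M \<Longrightarrow> \<exists>R. \<exists>\<phi>::'a \<Rightarrow> 'b. eucl p R \<phi>"
    and U_open: "\<And>j. j \<in> verts G \<Longrightarrow> openin mtopology (U j)"
    and U_nonempty: "\<And>j. j \<in> verts G \<Longrightarrow> U j \<noteq> {}"
    and U_X: "\<And>j. j \<in> verts G \<Longrightarrow> U j \<subseteq> X j"
    and U_inv: "\<And>e. e \<in> arcs G \<Longrightarrow> f e ` U (head G e) \<subseteq> U (tail G e)"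
    and U_disjoint: "\<And>e e'. e \<in> arcs G \<Longrightarrow> e' \<in> arcs G \<Longrightarrow> tail G e = tail G e' \<Longrightarrow> e \<noteq> e' \<Longrightarrow>
      f e ` U (head G e) \<inter> f e' ` U (head G e') = {}"
    and W_X: "\<And>j. j \<in> verts G \<Longrightarrow> W j \<subseteq> X j" and W_nonempty: "\<And>j. j \<in> verts G \<Longrightarrow> W j \<noteq> {}"
    and level_compact: "\<And>q. compactin mtopology (level W q)"
    and level_dec: "\<And>q. level W (Suc q) \<subseteq> level W q"
begin

definition limit_set :: "'a set" where
  "limit_set = (\<Inter>q. level W q)"

lemma limit_set_compact: "compactin mtopology limit_set"
proof -
  have "closedin mtopology (level W q)" for q
    using level_compact Hausdorff_space_mtopology compactin_imp_closedin by blast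
  then have "closedin mtopology limit_set" unfolding limit_set_def by (intro closedin_Inter) auto
  then show ?thesis by (rule closed_compactin[OF level_compact[of 0], rotated]) (auto simp: limit_set_def)
qed

text \<open>Flat balls of one common radius inside the \<open>U j\<close>: their images under
  stopping words are the balls to be packed.\<close>

lemma base_points:
  obtains u r1 where "0 < r1" "\<And>j. j \<in> verts G \<Longrightarrow> u j \<in> U j \<and> mball (u j) r1 \<subseteq> U j \<and> (\<exists>\<phi>::'a \<Rightarrow> 'b. eucl (u j) r1 \<phi>)"
proof -
  have "\<exists>x r. x \<in> U j \<and> 0 < r \<and> mball x r \<subseteq> U j \<and> (\<exists>\<phi>::'a \<Rightarrow> 'b. eucl x r \<phi>)" if j: "j \<in> verts G" for j
  proof -
    obtain x where x: "x \<in> U j" using U_nonempty[OF j] by blast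
    then obtain r where r: "0 < r" "mball x r \<subseteq> U j" "U j \<subseteq> M" using U_open[OF j] by (auto simp: openin_mtopology)
    then obtain R and \<phi> :: "'a \<Rightarrow> 'b" where R: "eucl x R \<phi>" using flat x by blast
    have "0 < R" "x \<in> M" using R by (auto simp: eucl_def)
    then have "eucl x (min r R) \<phi>" using r(1) by (intro eucl_shrink[OF R]) auto
    moreover have "mball x (min r R) \<subseteq> U j" using r(2) by auto
    ultimately show ?thesis using x r(1) \<open>0 < R\<close> by (intro exI[of _ x] exI[of _ "min r R"]) auto
  qed
  then have "\<exists>u r. \<forall>j\<in>verts G. u j \<in> U j \<and> 0 < r j \<and> mball (u j) (r j) \<subseteq> U j \<and> (\<exists>\<phi>::'a \<Rightarrow> 'b. eucl (u j) (r j) \<phi>)"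
    by metis
  then obtain u r where ur: "\<And>j. j \<in> verts G \<Longrightarrow> u j \<in> U j \<and> 0 < r j \<and> mball (u j) (r j) \<subseteq> U j \<and> (\<exists>\<phi>::'a \<Rightarrow> 'b. eucl (u j) (r j) \<phi>)"
    by blast
  define r1 where "r1 = Min (insert 1 (r ` verts G))"
  have r1: "0 < r1" unfolding r1_def using finite_verts ur by (subst Min_gr_iff) auto
  have le: "r1 \<le> r j" if "j \<in> verts G" for j
    unfolding r1_def using finite_verts that by (intro Min_le) auto
  show ?thesis
  proof (rule that[OF r1])
    fix j assume j: "j \<in> verts G"
    obtain \<phi> :: "'a \<Rightarrow> 'b" where \<phi>: "eucl (u j) (r j) \<phi>" using ur[OF j] by blast
    have "eucl (u j) r1 \<phi>" using \<phi> r1 le[OF j] by (intro eucl_shrink[OF \<phi>]) (auto simp: eucl_def)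
    then show "u j \<in> U j \<and> mball (u j) r1 \<subseteq> U j \<and> (\<exists>\<phi>::'a \<Rightarrow> 'b. eucl (u j) r1 \<phi>)"
      using ur[OF j] mball_subset_concentric[OF le[OF j], of "u j"] by blast
  qed
qed

end

lemma sum_UN_le:
  fixes g :: "'a \<Rightarrow> real"
  assumes "finite I" "\<And>i. i \<in> I \<Longrightarrow> finite (A i)" "\<And>x. 0 \<le> g x"
  shows "sum g (\<Union>i\<in>I. A i) \<le> (\<Sum>i\<in>I. sum g (A i))"
  using assms(1,2)
proof (induction I rule: finite_induct)
  case (insert j I)
  have "sum g (A j \<union> (\<Union>i\<in>I. A i)) + sum g (A j \<inter> (\<Union>i\<in>I. A i)) = sum g (A j) + sum g (\<Union>i\<in>I. A i)"
    using insert by (intro sum.union_inter) auto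
  moreover have "0 \<le> sum g (A j \<inter> (\<Union>i\<in>I. A i))" using assms(3) by (simp add: sum_nonneg)
  ultimately show ?case using insert by simp
qed simp

context gosc_graph
begin

text \<open>The images \<open>f\<^sub>v(U)\<close> of the stopping words are disjoint and contain balls of radius comparable to
  \<open>r\<close>, so only boundedly many of them come close to a given ball of radius \<open>r\<close>.\<close>

lemma stopping_count:
  assumes r1: "0 < r1"
    and u: "\<And>j. j \<in> verts G \<Longrightarrow> u j \<in> U j \<and> mball (u j) r1 \<subseteq> U j \<and> (\<exists>\<phi>::'a \<Rightarrow> 'b. eucl (u j) r1 \<phi>)"
    and B: "0 \<le> B"
  obtains r0 Q where "0 < r0" "r0 < 1"
    "\<And>i r x. i \<in> verts G \<Longrightarrow> 0 < r \<Longrightarrow> r < r0 \<Longrightarrow>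
      finite {v. stopping i r v \<and> (\<exists>z\<in>limit_set. z \<in> mball x r \<and> d z (foldr f v (u (endv i v))) \<le> B * ratio v)} \<and>
      card {v. stopping i r v \<and> (\<exists>z\<in>limit_set. z \<in> mball x r \<and> d z (foldr f v (u (endv i v))) \<le> B * ratio v)} \<le> Q"
proof -
  have LM: "limit_set \<subseteq> M" using limit_set_compact compactin_subset_topspace by fastforce
  obtain R0 where R0: "0 < R0" "\<And>z q. z \<in> limit_set \<Longrightarrow> q \<in> M \<Longrightarrow> d z q < R0 \<Longrightarrow> \<exists>\<phi>::'a \<Rightarrow> 'b. eucl q R0 \<phi>"
    using uniform_eucl[OF limit_set_compact flat] by blast
  obtain m where m: "0 < m" "m < 1" "\<And>e. e \<in> arcs G \<Longrightarrow> m \<le> \<rho> e" using min_ratio by blast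
  \<comment> \<open>From a limit point in the given ball, the image point \<open>P v\<close> of a
    counted word is reached within \<open>r + r + B * r\<close>; one more \<open>r\<close> is
    slack.\<close>
  define \<Lambda> where "\<Lambda> = B + 3"
  have c: "0 < m * r1" using m r1 by simp
  obtain Q where Q: "\<And>r z S (\<phi>::'a \<Rightarrow> 'b). 0 < r \<Longrightarrow> eucl z (\<Lambda> * r) \<phi> \<Longrightarrow> S \<subseteq> mball z (\<Lambda> * r) \<Longrightarrow>
    (\<And>x y. x \<in> S \<Longrightarrow> y \<in> S \<Longrightarrow> x \<noteq> y \<Longrightarrow> m * r1 * r \<le> d x y) \<Longrightarrow> finite S \<and> card S \<le> Q"
    by (rule packing_bound[OF c]) blast
  \<comment> \<open>Scales below \<open>r0\<close> keep both the packing ball of radius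
    \<open>\<Lambda> * r\<close> and the image balls of radius at most \<open>r1 * r\<close> within
    the uniform flat radius. The bound \<open>1/2\<close> gives \<open>r < 1\<close>, so that
    stopping words are nonempty.\<close>
  define r0 where "r0 = min (1/2) (R0 / (\<Lambda> + r1))"
  have pos: "0 < \<Lambda> + r1" using B r1 by (simp add: \<Lambda>_def)
  have r0: "0 < r0" "r0 < 1" using R0(1) pos by (auto simp: r0_def)
  have small: "\<Lambda> * r < R0" "r1 * r < R0" if "0 < r" "r < r0" for r
  proof -
    have "(\<Lambda> + r1) * r < R0" using that pos by (simp add: r0_def field_simps)
    moreover have "0 \<le> \<Lambda> * r" "0 \<le> r1 * r" using that r1 B by (auto simp: \<Lambda>_def)
    ultimately show "\<Lambda> * r < R0" "r1 * r < R0" by (simp_all add: algebra_simps)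
  qed
  show ?thesis
  proof (rule that[OF r0])
    fix i r x assume i: "i \<in> verts G" and r: "0 < r" "r < r0"
    define P where "P v = foldr f v (u (endv i v))" for v
    define T where "T = {v. stopping i r v \<and> (\<exists>z\<in>limit_set. z \<in> mball x r \<and> d z (P v) \<le> B * ratio v)}"
    have wp: "wpath i v" "ratio v \<le> r" "endv i v \<in> verts G" "0 < ratio v" "P v \<in> M" if "v \<in> T" for v
    proof -
      show p: "wpath i v" "ratio v \<le> r" using that by (auto simp: T_def stopping_def)
      show e: "endv i v \<in> verts G" using endv_verts[OF i p(1)] .
      show "0 < ratio v" using ratio_pos[OF p(1)] .
      show "P v \<in> M" unfolding P_def using foldr_in[OF p(1)] u[OF e] U_X[OF e] X_subset[OF i] by blast
    qed
    have Br: "B * ratio v \<le> B * r" if "v \<in> T" for v using wp[OF that] B by (simp add: mult_left_mono)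
    have ball: "mball (P v) (ratio v * r1) \<subseteq> foldr f v ` U (endv i v)" if v: "v \<in> T" for v
    proof -
      let ?j = "endv i v"
      note w = wp[OF v]
      obtain \<phi> :: "'a \<Rightarrow> 'b" where \<phi>: "eucl (u ?j) r1 \<phi>" using u[OF w(3)] by blast
      obtain z where z: "z \<in> limit_set" "d z (P v) \<le> B * ratio v" using v by (auto simp: T_def)
      \<comment> \<open>\<open>P v\<close> itself may lie outside the limit set; its closeness to
        \<open>z\<close> gives it a flat ball of radius \<open>R0\<close>.\<close>
      have "d z (P v) < R0" using z(2) Br[OF v] small[OF r] r by (simp add: \<Lambda>_def algebra_simps)
      then obtain \<psi> :: "'a \<Rightarrow> 'b" where \<psi>: "eucl (P v) R0 \<psi>" using R0(2)[OF z(1) w(5)] by blast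
      have "ratio v * r1 \<le> r1 * r" using w(2) r1 by simp
      then have "ratio v * r1 \<le> R0" using small(2)[OF r] by simp
      then have "eucl (P v) (ratio v * r1) \<psi>"
        using w r1 by (intro eucl_shrink[OF \<psi>]) auto
      moreover have bX: "mball (u ?j) r1 \<subseteq> X ?j" using u[OF w(3)] U_X[OF w(3)] by blast
      ultimately have "mball (P v) (ratio v * r1) \<subseteq> foldr f v ` mball (u ?j) r1"
      proof (intro similitude_ball_image[OF \<phi>])
        show "foldr f v ` mball (u ?j) r1 \<subseteq> M" using foldr_in[OF w(1)] bX X_subset[OF i] by blast
        show "foldr f v (u ?j) = P v" by (simp add: P_def)
        show "d (foldr f v x) (foldr f v y) = ratio v * d x y" if "x \<in> mball (u ?j) r1" "y \<in> mball (u ?j) r1" for x y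
          using foldr_dist[OF w(1)] bX that by blast
      qed (use w in auto)
      then show ?thesis using u[OF w(3)] by blast
    qed
    \<comment> \<open>Were the two points closer, \<open>P w\<close> would fall into the ball around
      \<open>P v\<close> and so into the images of both words, which are disjoint as neither
      stopping word is a prefix of the other.\<close>
    have sep: "m * r1 * r \<le> d (P v) (P w)" if v: "v \<in> T" "w \<in> T" "v \<noteq> w" for v w
    proof (rule ccontr)
      assume "\<not> ?thesis"
      moreover have "m * r \<le> ratio v"
        using stopping_ratio_lower[of i r v m] v(1) r r0 m by (auto simp: T_def)
      then have "m * r * r1 \<le> ratio v * r1" using r1 by simp
      ultimately have "d (P v) (P w) < ratio v * r1" by (simp add: mult_ac)
      then have "P w \<in> foldr f v ` U (endv i v)" using ball[OF v(1)] wp(5) v by auto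
      moreover have "P w \<in> foldr f w ` U (endv i w)" unfolding P_def using u wp(3)[OF v(2)] by blast
      moreover have "foldr f v ` U (endv i v) \<inter> foldr f w ` U (endv i w) = {}"
        using v stopping_incomparable[of i r]
        by (intro images_incomparable_disjoint U_X U_inv U_disjoint i wp) (auto simp: T_def)
      ultimately show False by blast
    qed
    have mr: "0 < m * r1 * r" using m r1 r by simp
    have inj: "inj_on P T"
    proof
      fix v w assume vw: "v \<in> T" "w \<in> T" "P v = P w"
      show "v = w"
      proof (rule ccontr)
        assume "v \<noteq> w"
        then show False using sep[OF vw(1,2)] vw(3) wp(5)[OF vw(2)] mr by simp
      qed
    qed
    have "finite T \<and> card T \<le> Q"
    proof (cases "T = {}")
      case False
      then obtain v0 where v0: "v0 \<in> T" by blast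
      \<comment> \<open>The packing is centred at a limit point \<open>z0\<close> in
        \<open>mball x r\<close>, as the flat radius \<open>R0\<close> is known there and not at
        \<open>x\<close>.\<close>
      then obtain z0 where z0: "z0 \<in> limit_set" "z0 \<in> mball x r" by (auto simp: T_def)
      then obtain \<phi> :: "'a \<Rightarrow> 'b" where \<phi>: "eucl z0 R0 \<phi>" using R0 LM by force
      have "0 < \<Lambda> * r" using B r by (simp add: \<Lambda>_def)
      then have e: "eucl z0 (\<Lambda> * r) \<phi>" using small[OF r] z0 by (intro eucl_shrink[OF \<phi>]) auto
      have "finite (P ` T) \<and> card (P ` T) \<le> Q"
      proof (rule Q[OF r(1) e])
        show "P ` T \<subseteq> mball z0 (\<Lambda> * r)"
        proof
          fix y assume "y \<in> P ` T"
          then obtain v where v: "v \<in> T" "y = P v" by blast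
          then obtain z where z: "z \<in> mball x r" "d z (P v) \<le> B * ratio v" by (auto simp: T_def)
          have "d z0 (P v) \<le> d z0 x + d x (P v)" using z0 wp(5)[OF v(1)] by (intro triangle) auto
          also have "d x (P v) \<le> d x z + d z (P v)" using z wp(5)[OF v(1)] by (intro triangle) auto
          finally have "d z0 (P v) < r + (r + B * r)"
            using z0 z Br[OF v(1)] commute[of z0 x] by simp
          also have "\<dots> \<le> \<Lambda> * r" using r by (simp add: \<Lambda>_def algebra_simps)
          finally show "y \<in> mball z0 (\<Lambda> * r)" using v z0 wp(5)[OF v(1)] by simp
        qed
        show "m * r1 * r \<le> d y y'" if yy: "y \<in> P ` T" "y' \<in> P ` T" "y \<noteq> y'" for y y'
        proof -
          obtain v w where "v \<in> T" "w \<in> T" "y = P v" "y' = P w" using yy by blast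
          then show ?thesis using sep yy(3) by blast
        qed
      qed
      then show ?thesis using inj by (simp add: card_image finite_image_iff)
    qed simp
    then show "finite {v. stopping i r v \<and> (\<exists>z\<in>limit_set. z \<in> mball x r \<and> d z (foldr f v (u (endv i v))) \<le> B * ratio v)} \<and>
      card {v. stopping i r v \<and> (\<exists>z\<in>limit_set. z \<in> mball x r \<and> d z (foldr f v (u (endv i v))) \<le> B * ratio v)} \<le> Q"
      unfolding T_def P_def .
  qed
qed

text \<open>The mass \<open>h i0\<close> is spread over words so long that their ratio is below
  every radius. A word carrying mass has a limit point near all its prefixes; this point lies in
  some ball \<open>k\<close> of the cover, and the prefix stopped at \<open>r k\<close> is one of at
  most \<open>Q\<close> words, each of mass at most \<open>H * r k powr s\<close>.\<close>

lemma finite_cover_estimate: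
  assumes h: "\<And>i. 0 \<le> h i" "\<And>i. i \<in> verts G \<Longrightarrow> transfer c h i = h i" "\<And>i. i \<in> verts G \<Longrightarrow> h i \<le> H"
    and c: "\<And>e. e \<in> arcs G \<Longrightarrow> 0 \<le> c e \<and> c e \<le> \<rho> e powr s" and s: "0 \<le> s" and i0: "i0 \<in> verts G"
  obtains r0 Q where "0 < r0" "\<And>I x r. finite I \<Longrightarrow> limit_set \<subseteq> (\<Union>k\<in>I. mball (x k) (r k)) \<Longrightarrow>
    (\<And>k. k \<in> I \<Longrightarrow> 0 < r k \<and> r k < r0) \<Longrightarrow> h i0 \<le> real Q * H * (\<Sum>k\<in>I. r k powr s)"
proof -
  obtain u r1 where r1: "0 < r1" and u: "\<And>j. j \<in> verts G \<Longrightarrow> u j \<in> U j \<and> mball (u j) r1 \<subseteq> U j \<and> (\<exists>\<phi>::'a \<Rightarrow> 'b. eucl (u j) r1 \<phi>)"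
    by (rule base_points) blast
  have uX: "u j \<in> X j" if "j \<in> verts G" for j using u[OF that] U_X[OF that] by blast
  have "mbounded (level W 0 \<union> u ` verts G)"
  proof -
    have "u ` verts G \<subseteq> M" using X_subset uX by blast
    then have "compactin mtopology (u ` verts G)"
      using finite_verts by (intro finite_imp_compactin) auto
    then show ?thesis using level_compact compactin_imp_mbounded by (simp add: mbounded_Un)
  qed
  then obtain B where B0: "0 < B" "\<forall>x\<in>level W 0 \<union> u ` verts G. \<forall>y\<in>level W 0 \<union> u ` verts G. d x y \<le> B"
    unfolding mbounded_alt_pos by blast
  then have B: "0 \<le> B" "\<And>j y. j \<in> verts G \<Longrightarrow> y \<in> level W 0 \<Longrightarrow> d y (u j) \<le> B" by auto
  define T where "T x r = {v. stopping i0 r v \<and> (\<exists>z\<in>limit_set. z \<in> mball x r \<and> d z (foldr f v (u (endv i0 v))) \<le> B * ratio v)}" for x r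
  obtain r0 Q where r0: "0 < r0" "r0 < 1" and Q: "\<And>r x. 0 < r \<Longrightarrow> r < r0 \<Longrightarrow> finite (T x r) \<and> card (T x r) \<le> Q"
    unfolding T_def by (rule stopping_count[OF r1 u B(1)]) (use i0 in blast)+
  obtain R where R: "0 < R" "R < 1" "\<And>i q es. es \<in> words i q \<Longrightarrow> ratio es \<le> R ^ q"
    using ratio_words_bound by metis
  have sum_all: "(\<Sum>w\<in>words i n. wt c w * h (endv i w)) = h i" if "i \<in> verts G" for i n
    using sum_words_prefix[OF h(2) that, of "[]" n] by simp
  have ext: "words i q \<noteq> {}" if "i \<in> verts G" "0 < h i" for i q
    using sum_all[OF that(1), of q] that(2) by auto
  have main: "h i0 \<le> real Q * H * (\<Sum>k\<in>I. r k powr s)"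
    if I: "finite I" "limit_set \<subseteq> (\<Union>k\<in>I. mball (x k) (r k))" "\<And>k. k \<in> I \<Longrightarrow> 0 < r k \<and> r k < r0"
    for I :: "'k set" and x r
  proof -
    have "\<forall>k\<in>I. \<forall>\<^sub>F n in sequentially. R ^ n < r k"
      using R I(3) by (auto intro!: order_tendstoD(2)[OF LIMSEQ_power_zero])
    then have "\<forall>\<^sub>F n in sequentially. \<forall>k\<in>I. R ^ n < r k" using I(1) by (simp add: eventually_ball_finite)
    then obtain n where n: "\<And>k. k \<in> I \<Longrightarrow> R ^ n < r k" by (auto simp: eventually_sequentially)
    \<comment> \<open>\<open>wt\<close> is known to be nonnegative only on paths; the value 0
      elsewhere makes \<open>g\<close> nonnegative everywhere, as \<open>sum_UN_le\<close>
      requires.\<close>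
    define g where "g w = (if w \<in> words i0 n then wt c w * h (endv i0 w) else 0)" for w
    have g0: "0 \<le> g w" for w
      using wt_le_ratio_powr[of c s i0 w] c h(1) by (auto simp: g_def words_def)
    have H0: "0 \<le> H" using h(1)[of i0] h(3)[OF i0] by simp
    define A where "A k = (\<Union>v\<in>T (x k) (r k). {w \<in> words i0 n. prefix v w})" for k
    have cover: "w \<in> (\<Union>k\<in>I. A k)" if w: "w \<in> words i0 n" "g w \<noteq> 0" for w
    proof -
      have wp: "wpath i0 w" using w by (simp add: words_def)
      \<comment> \<open>Nonzero mass forces \<open>h\<close> to be positive at the end of
        \<open>w\<close>. This value is a sum over the words of any given length starting there, so
        such words exist.\<close>
      have "0 < h (endv i0 w)" using w h(1)[of "endv i0 w"] by (auto simp: g_def less_le)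
      then have e: "words (endv i0 w) q \<noteq> {}" for q using ext endv_verts[OF i0 wp] by blast
      obtain z where z: "z \<in> limit_set" "\<And>v. prefix v w \<Longrightarrow> d z (foldr f v (u (endv i0 v))) \<le> B * ratio v"
        using prefix_point[OF W_X W_nonempty level_compact level_dec uX B(2) i0 wp e]
        unfolding limit_set_def by blast
      then obtain k where k: "k \<in> I" "z \<in> mball (x k) (r k)" using I(2) by blast
      have "ratio w \<le> r k" using R(3)[OF w(1)] n[OF k(1)] by simp
      then obtain v where v: "prefix v w" "stopping i0 (r k) v" using stopping_prefix_exists[OF wp] by blast
      then have "v \<in> T (x k) (r k)" unfolding T_def using z k by blast
      then show ?thesis unfolding A_def using k(1) v(1) w(1) by blast
    qed
    have finA: "finite (A k)" for k
      by (rule finite_subset[of _ "words i0 n"]) (auto simp: A_def)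
    have "h i0 = (\<Sum>w\<in>words i0 n. g w)" using sum_all[OF i0, of n] by (simp add: g_def)
    also have "\<dots> = (\<Sum>w\<in>{w \<in> words i0 n. g w \<noteq> 0}. g w)"
      by (rule sum.mono_neutral_right) auto
    also have "\<dots> \<le> (\<Sum>w\<in>(\<Union>k\<in>I. A k). g w)"
      using cover g0 I(1) finA by (intro sum_mono2) auto
    also have "\<dots> \<le> (\<Sum>k\<in>I. \<Sum>w\<in>A k. g w)"
      using I(1) finA g0 by (intro sum_UN_le) auto
    also have "\<dots> \<le> (\<Sum>k\<in>I. real Q * H * r k powr s)"
    proof (rule sum_mono)
      fix k assume k: "k \<in> I"
      have fT: "finite (T (x k) (r k))" "card (T (x k) (r k)) \<le> Q" using Q I(3)[OF k] by auto
      have "(\<Sum>w\<in>A k. g w) \<le> (\<Sum>v\<in>T (x k) (r k). \<Sum>w\<in>{w \<in> words i0 n. prefix v w}. g w)"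
        unfolding A_def using fT(1) g0 by (intro sum_UN_le) auto
      also have "\<dots> \<le> (\<Sum>v\<in>T (x k) (r k). r k powr s * H)"
      proof (rule sum_mono)
        fix v assume "v \<in> T (x k) (r k)"
        then have v: "wpath i0 v" "ratio v \<le> r k" by (auto simp: T_def stopping_def)
        have wv: "0 \<le> wt c v" "wt c v \<le> ratio v powr s" using wt_le_ratio_powr[OF c v(1)] by auto
        have bound: "wt c v * h (endv i0 v) \<le> r k powr s * H"
        proof (rule mult_mono)
          have "ratio v powr s \<le> r k powr s" using v(2) ratio_pos[OF v(1)] s by (intro powr_mono2) auto
          then show "wt c v \<le> r k powr s" using wv by simp
        qed (use h endv_verts[OF i0 v(1)] in auto)
        show "(\<Sum>w\<in>{w \<in> words i0 n. prefix v w}. g w) \<le> r k powr s * H"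
        proof (cases "length v \<le> n")
          case True
          have "(\<Sum>w\<in>{w \<in> words i0 n. prefix v w}. g w) = (\<Sum>w\<in>{w \<in> words i0 n. prefix v w}. wt c w * h (endv i0 w))"
            by (intro sum.cong) (auto simp: g_def)
          then show ?thesis using sum_words_prefix[OF h(2) i0 v(1) True] bound by simp
        next
          case False
          then have "{w \<in> words i0 n. prefix v w} = {}" by (auto simp: words_def dest!: prefix_length_le)
          then show ?thesis using H0 by (metis mult_nonneg_nonneg powr_ge_zero sum.empty)
        qed
      qed
      also have "\<dots> = real (card (T (x k) (r k))) * (r k powr s * H)" by simp
      also have "\<dots> \<le> real Q * (r k powr s * H)" using fT(2) H0 by (intro mult_right_mono) auto
      finally show "(\<Sum>w\<in>A k. g w) \<le> real Q * H * r k powr s" by (simp add: mult_ac)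
    qed
    finally show ?thesis by (simp add: sum_distrib_left)
  qed
  show ?thesis by (rule that[OF r0(1)]) (rule main)
qed

text \<open>An arbitrary cover of small total weight is replaced by open balls of almost the same
  weight; compactness leaves finitely many, and their total contradicts the estimate for finite
  covers.\<close>

lemma hausdorff_measure_limit_set_nonzero:
  assumes h: "\<And>i. 0 \<le> h i" "\<And>i. i \<in> verts G \<Longrightarrow> transfer c h i = h i"
    and c: "\<And>e. e \<in> arcs G \<Longrightarrow> 0 \<le> c e \<and> c e \<le> \<rho> e powr s" and s: "0 \<le> s"
    and i0: "i0 \<in> verts G" "0 < h i0"
  shows "hausdorff_measure M d s limit_set \<noteq> 0"
proof
  assume zero: "hausdorff_measure M d s limit_set = 0"
  define H where "H = Max (h ` verts G)"
  have H: "h i \<le> H" if "i \<in> verts G" for i unfolding H_def using finite_verts that by (intro Max_ge) auto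
  have "0 < H" using H[OF i0(1)] i0(2) by simp
  obtain r0 Q where r0: "0 < r0" and est: "\<And>(I::nat set) x r. finite I \<Longrightarrow> limit_set \<subseteq> (\<Union>k\<in>I. mball (x k) (r k)) \<Longrightarrow>
    (\<And>k. k \<in> I \<Longrightarrow> 0 < r k \<and> r k < r0) \<Longrightarrow> h i0 \<le> real Q * H * (\<Sum>k\<in>I. r k powr s)"
    by (rule finite_cover_estimate[OF h H c s i0(1)]) blast+
  \<comment> \<open>The balls will have total weight at most \<open>2 * \<epsilon>\<close>, which
    the factor \<open>(real Q + 1) * H\<close> turns into \<open>h i0 / 2\<close>. The summand 1
    allows for \<open>Q = 0\<close>.\<close>
  define \<epsilon> where "\<epsilon> = h i0 / (4 * (real Q + 1) * H)"
  have \<epsilon>: "0 < \<epsilon>" using i0(2) \<open>0 < H\<close> by (simp add: \<epsilon>_def)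
  \<comment> \<open>Scale \<open>r0 / 2\<close> leaves room to enlarge the covering sets to balls of
    radius below \<open>r0\<close>.\<close>
  have "hausdorff_premeasure M d (r0 / 2) s limit_set \<le> hausdorff_measure M d s limit_set"
    unfolding hausdorff_measure_def using r0 by (intro SUP_upper) auto
  then have "hausdorff_premeasure M d (r0 / 2) s limit_set < ennreal \<epsilon>" using zero \<epsilon> by simp
  then obtain C where C: "(\<Sum>i. hweight d s (C i)) < ennreal \<epsilon>" "limit_set \<subseteq> (\<Union>i. C i)"
    "\<And>i. C i \<subseteq> M" "\<And>i x y. x \<in> C i \<Longrightarrow> y \<in> C i \<Longrightarrow> d x y \<le> r0 / 2"
    unfolding hausdorff_premeasure_def Inf_less_iff by blast
  define \<eta> where "\<eta> i = \<epsilon> * (1 / 2) ^ Suc i" for i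
  have \<eta>: "0 < \<eta> i" for i using \<epsilon> by (simp add: \<eta>_def)
  have "\<forall>i\<in>{i. C i \<noteq> {}}. \<exists>xr. 0 < snd xr \<and> snd xr < r0 \<and> C i \<subseteq> mball (fst xr) (snd xr) \<and>
      ennreal (snd xr powr s) \<le> hweight d s (C i) + ennreal (\<eta> i)"
  proof
    fix i assume "i \<in> {i. C i \<noteq> {}}"
    then have ne: "C i \<noteq> {}" by simp
    obtain x r where "0 < r" "r < r0" "C i \<subseteq> mball x r" "ennreal (r powr s) \<le> hweight d s (C i) + ennreal (\<eta> i)"
      by (rule hweight_enlarge[OF s ne, where \<delta> = "r0 / 2" and ?r0.0 = r0 and \<eta> = "\<eta> i"])
        (use C(3,4) r0 \<eta> in auto)
    then show "\<exists>xr. 0 < snd xr \<and> snd xr < r0 \<and> C i \<subseteq> mball (fst xr) (snd xr) \<and>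
      ennreal (snd xr powr s) \<le> hweight d s (C i) + ennreal (\<eta> i)" by (intro exI[of _ "(x, r)"]) auto
  qed
  then have "\<exists>xr. \<forall>i\<in>{i. C i \<noteq> {}}. 0 < snd (xr i) \<and> snd (xr i) < r0 \<and> C i \<subseteq> mball (fst (xr i)) (snd (xr i)) \<and>
      ennreal (snd (xr i) powr s) \<le> hweight d s (C i) + ennreal (\<eta> i)"
    by (rule bchoice)
  then obtain xr where xr: "\<And>i. C i \<noteq> {} \<Longrightarrow> 0 < snd (xr i) \<and> snd (xr i) < r0 \<and> C i \<subseteq> mball (fst (xr i)) (snd (xr i)) \<and>
      ennreal (snd (xr i) powr s) \<le> hweight d s (C i) + ennreal (\<eta> i)"
    by blast
  define x where "x i = fst (xr i)" for i
  define r where "r i = snd (xr i)" for i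
  let ?\<U> = "(\<lambda>i. mball (x i) (r i)) ` {i. C i \<noteq> {}}"
  have "\<exists>\<F>. finite \<F> \<and> \<F> \<subseteq> ?\<U> \<and> limit_set \<subseteq> \<Union>\<F>"
  proof (rule compactinD[OF limit_set_compact])
    show "limit_set \<subseteq> \<Union>?\<U>"
    proof
      fix y assume "y \<in> limit_set"
      then obtain i where "y \<in> C i" using C(2) by blast
      then show "y \<in> \<Union>?\<U>" using xr[of i] unfolding x_def r_def by blast
    qed
  qed auto
  then obtain \<F> where \<F>: "finite \<F>" "\<F> \<subseteq> ?\<U>" "limit_set \<subseteq> \<Union>\<F>" by blast
  obtain I where I: "finite I" "I \<subseteq> {i. C i \<noteq> {}}" "\<F> = (\<lambda>i. mball (x i) (r i)) ` I"
    using finite_subset_image[OF \<F>(1,2)] by blast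
  have "h i0 \<le> real Q * H * (\<Sum>k\<in>I. r k powr s)"
  proof (rule est[OF I(1)])
    show "limit_set \<subseteq> (\<Union>k\<in>I. mball (x k) (r k))" using \<F>(3) I(3) by simp
    show "0 < r k \<and> r k < r0" if "k \<in> I" for k
      using xr[of k] that I(2) by (auto simp: r_def)
  qed
  moreover have "(\<Sum>k\<in>I. r k powr s) \<le> \<epsilon> + \<epsilon>"
  proof -
    have sums: "\<eta> sums \<epsilon>" unfolding \<eta>_def using sums_mult[OF power_half_series, of \<epsilon>] by simp
    have "ennreal (\<Sum>k\<in>I. r k powr s) = (\<Sum>k\<in>I. ennreal (r k powr s))" by simp
    also have "\<dots> \<le> (\<Sum>k\<in>I. hweight d s (C k) + ennreal (\<eta> k))"
    proof (rule sum_mono)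
      fix k assume "k \<in> I"
      then show "ennreal (r k powr s) \<le> hweight d s (C k) + ennreal (\<eta> k)"
        using xr[of k] I(2) unfolding r_def by blast
    qed
    also have "\<dots> = (\<Sum>k\<in>I. hweight d s (C k)) + ennreal (\<Sum>k\<in>I. \<eta> k)"
      using \<eta> by (simp add: sum.distrib less_imp_le)
    also have "\<dots> \<le> ennreal \<epsilon> + ennreal \<epsilon>"
    proof (rule add_mono)
      have "(\<Sum>k\<in>I. hweight d s (C k)) \<le> (\<Sum>i. hweight d s (C i))"
        using I(1) by (intro sum_le_suminf) auto
      then show "(\<Sum>k\<in>I. hweight d s (C k)) \<le> ennreal \<epsilon>" using C(1) by simp
      have "sum \<eta> I \<le> suminf \<eta>"
        using sums I(1) \<eta> by (intro sum_le_suminf) (auto simp: sums_iff less_imp_le)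
      then show "ennreal (\<Sum>k\<in>I. \<eta> k) \<le> ennreal \<epsilon>" using sums by (auto simp: sums_iff intro!: ennreal_leI)
    qed
    also have "\<dots> = ennreal (\<epsilon> + \<epsilon>)" using \<epsilon> by (intro ennreal_plus[symmetric]) auto
    finally show ?thesis using \<epsilon> by (simp add: ennreal_le_iff)
  qed
  ultimately have "h i0 \<le> real Q * H * (\<epsilon> + \<epsilon>)"
    using \<open>0 < H\<close> mult_left_mono[of "\<Sum>k\<in>I. r k powr s" "\<epsilon> + \<epsilon>" "real Q * H"] by simp
  also have "\<dots> < (real Q + 1) * H * (\<epsilon> + \<epsilon>)"
    using \<open>0 < H\<close> \<epsilon> by simp
  also have "\<dots> = h i0 / 2"
  proof -
    have "q * (h i0 / (4 * q) + h i0 / (4 * q)) = h i0 / 2" if "q \<noteq> 0" for q :: real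
      using that by (simp add: field_simps)
    moreover have "\<epsilon> = h i0 / (4 * ((real Q + 1) * H))"
      unfolding \<epsilon>_def by (simp only: mult.assoc)
    moreover have "(real Q + 1) * H \<noteq> 0" using \<open>0 < H\<close> by auto
    ultimately show ?thesis by metis
  qed
  finally show False using i0(2) by simp
qed

end

section \<open>Charts\<close>

context
  fixes T :: "'a topology" and c :: "('a, 'n::finite) chart"
  assumes chart: "is_chart T c"
begin

lemma chart_homeomorphic: "homeomorphic_map (subtopology T (fst c)) (top_of_set (snd c ` fst c)) (snd c)"
  and chart_openin: "openin T (fst c)" and chart_open_image: "open (snd c ` fst c)"
  using chart by (auto simp: is_chart_def)

lemma chart_topspace: "topspace (subtopology T (fst c)) = fst c"
  using chart_openin openin_subset by fastforce

lemma chart_inj: "inj_on (snd c) (fst c)"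
  using homeomorphic_imp_injective_map[OF chart_homeomorphic] chart_topspace by simp

lemma chart_inv: "x \<in> fst c \<Longrightarrow> inv_into (fst c) (snd c) (snd c x) = x"
  using chart_inj by simp

lemma chart_open_map:
  assumes "openin T S" "S \<subseteq> fst c"
  shows "open (snd c ` S)"
proof -
  have "openin (subtopology T (fst c)) S"
    using assms chart_openin by (simp add: openin_open_subtopology)
  then have "openin (top_of_set (snd c ` fst c)) (snd c ` S)"
    using homeomorphic_imp_open_map[OF chart_homeomorphic] by (simp add: open_map_def)
  then show ?thesis using chart_open_image openin_open_trans by blast
qed

lemma chart_openin_preimage:
  assumes "open V"
  shows "openin T {x \<in> fst c. snd c x \<in> V}"
proof -
  have "openin (top_of_set (snd c ` fst c)) (snd c ` fst c \<inter> V)" using assms by blast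
  then have "openin (subtopology T (fst c)) {x \<in> topspace (subtopology T (fst c)). snd c x \<in> snd c ` fst c \<inter> V}"
    by (rule openin_continuous_map_preimage[OF homeomorphic_imp_continuous_map[OF chart_homeomorphic]])
  also have "{x \<in> topspace (subtopology T (fst c)). snd c x \<in> snd c ` fst c \<inter> V} = {x \<in> fst c. snd c x \<in> V}"
    unfolding chart_topspace by auto
  finally show ?thesis using chart_openin openin_trans_full by blast
qed

lemma chart_inv_continuous:
  "continuous_map (top_of_set (snd c ` fst c)) (subtopology T (fst c)) (inv_into (fst c) (snd c))"
proof -
  obtain g where g: "homeomorphic_maps (subtopology T (fst c)) (top_of_set (snd c ` fst c)) (snd c) g"
    using chart_homeomorphic homeomorphic_map_maps by blast
  have "continuous_map (top_of_set (snd c ` fst c)) (subtopology T (fst c)) g"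
    using g by (simp add: homeomorphic_maps_def)
  moreover have "g y = inv_into (fst c) (snd c) y" if "y \<in> topspace (top_of_set (snd c ` fst c))" for y
    using that g chart_inv unfolding homeomorphic_maps_def chart_topspace by auto
  ultimately show ?thesis by (rule continuous_map_eq)
qed

text \<open>Closed coordinate balls thus become compact, hence closed in the Hausdorff space; they
  serve to trap curves.\<close>

lemma chart_compactin_preimage:
  assumes "compact C" "C \<subseteq> snd c ` fst c"
  shows "compactin T {x \<in> fst c. snd c x \<in> C}"
proof -
  have "compactin (top_of_set (snd c ` fst c)) C"
    using assms by (simp add: compactin_subtopology)
  then have "compactin (subtopology T (fst c)) (inv_into (fst c) (snd c) ` C)"
    using chart_inv_continuous by (rule image_compactin)
  moreover have "inv_into (fst c) (snd c) ` C = {x \<in> fst c. snd c x \<in> C}"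
  proof (intro equalityI subsetI)
    fix x assume "x \<in> inv_into (fst c) (snd c) ` C"
    then obtain y where "y \<in> C" "x = inv_into (fst c) (snd c) y" by blast
    then show "x \<in> {x \<in> fst c. snd c x \<in> C}"
      using assms(2) by (auto simp: subset_iff inv_into_into f_inv_into_f)
  next
    fix x assume "x \<in> {x \<in> fst c. snd c x \<in> C}"
    then show "x \<in> inv_into (fst c) (snd c) ` C" using chart_inv[of x] by (metis (mono_tags) image_eqI mem_Collect_eq)
  qed
  ultimately show ?thesis by (simp add: compactin_subtopology)
qed

text \<open>The definition of curve length speaks of coordinates alone; continuity in the manifold
  is recovered because the coordinate map is a homeomorphism on its domain.\<close>

lemma chart_curve_continuous:
  assumes "continuous_on I (snd c \<circ> \<gamma>)" "\<gamma> ` I \<subseteq> fst c"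
  shows "continuous_map (top_of_set I) T \<gamma>"
proof -
  have "continuous_map (top_of_set I) (top_of_set (snd c ` fst c)) (snd c \<circ> \<gamma>)"
    using assms by (auto simp: continuous_map_in_subtopology)
  then have "continuous_map (top_of_set I) (subtopology T (fst c)) (inv_into (fst c) (snd c) \<circ> (snd c \<circ> \<gamma>))"
    using chart_inv_continuous by (rule continuous_map_compose)
  then have "continuous_map (top_of_set I) T (inv_into (fst c) (snd c) \<circ> (snd c \<circ> \<gamma>))"
    by (rule continuous_map_into_fulltopology)
  moreover have "(inv_into (fst c) (snd c) \<circ> (snd c \<circ> \<gamma>)) t = \<gamma> t" if "t \<in> topspace (top_of_set I)" for t
    using that assms(2) chart_inv by auto
  ultimately show ?thesis by (rule continuous_map_eq)
qed

end

lemma open_overlap: "is_chart T c \<Longrightarrow> is_chart T c' \<Longrightarrow> open (overlap c c')"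
  unfolding overlap_def by (intro chart_open_map) (auto intro: chart_openin openin_Int)

lemma transition_chart: "is_chart T c \<Longrightarrow> x \<in> fst c \<Longrightarrow> transition c c' (snd c x) = snd c' x"
  by (simp add: transition_def chart_inv)

lemma smooth_transition:
  assumes "smooth_on (overlap c c') (transition c c')"
  shows "x \<in> overlap c c' \<Longrightarrow> (transition c c' has_derivative jacobian c c' x) (at x)"
    and "continuous_on (overlap c c') (\<lambda>x. jacobian c c' x v)"
proof -
  have "Ck_on (Suc 0) (overlap c c') (transition c c')" using assms by (simp add: smooth_on_def)
  then have *: "\<forall>x\<in>overlap c c'. transition c c' differentiable (at x)"
    "\<forall>v. continuous_on (overlap c c') (\<lambda>x. jacobian c c' x v)" by simp_all
  show "x \<in> overlap c c' \<Longrightarrow> (transition c c' has_derivative jacobian c c' x) (at x)"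
    using *(1) frechet_derivative_works by blast
  show "continuous_on (overlap c c') (\<lambda>x. jacobian c c' x v)" using *(2) by blast
qed

text \<open>Going to the other chart and back is the identity near \<open>x\<close>; the chain rule
  gives the claim.\<close>

lemma jacobian_inverse:
  assumes c: "is_chart T c" "is_chart T c'" and sm: "smooth_compatible c c'" and x: "x \<in> overlap c c'"
  shows "jacobian c' c (transition c c' x) (jacobian c c' x v) = v"
proof -
  obtain p where p: "p \<in> fst c" "p \<in> fst c'" "x = snd c p" using x by (auto simp: overlap_def)
  have x': "transition c c' x \<in> overlap c' c"
    using p transition_chart[OF c(1) p(1)] by (auto simp: overlap_def)
  have "(transition c c' has_derivative jacobian c c' x) (at x)"
    using sm x by (intro smooth_transition(1)) (simp_all add: smooth_compatible_def)
  moreover have "(transition c' c has_derivative jacobian c' c (transition c c' x)) (at (transition c c' x))"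
    using sm x' by (intro smooth_transition(1)) (simp_all add: smooth_compatible_def)
  ultimately have comp: "(transition c' c \<circ> transition c c' has_derivative
      jacobian c' c (transition c c' x) \<circ> jacobian c c' x) (at x)"
    by (rule diff_chain_at)
  have id: "(transition c' c \<circ> transition c c') y = y" if y: "y \<in> overlap c c'" for y
  proof -
    obtain q where "q \<in> fst c" "q \<in> fst c'" "y = snd c q" using y unfolding overlap_def by blast
    then show ?thesis using transition_chart[OF c(1), of q] transition_chart[OF c(2), of q] by simp
  qed
  have "((\<lambda>y. y) has_derivative jacobian c' c (transition c c' x) \<circ> jacobian c c' x) (at x)"
    by (rule has_derivative_transform_within_open[OF comp open_overlap[OF c] x id])
  then have "jacobian c' c (transition c c' x) \<circ> jacobian c c' x = (\<lambda>y. y)"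
    using has_derivative_ident has_derivative_unique by blast
  then show ?thesis by (metis o_apply)
qed

section \<open>Curves in a Riemannian manifold\<close>

definition piece_data ::
  "('a, 'n::finite) riemannian \<Rightarrow> ('a, 'n) chart \<Rightarrow> (real \<Rightarrow> 'a) \<Rightarrow> (real \<Rightarrow> real ^ 'n) \<Rightarrow> real \<Rightarrow> real \<Rightarrow> bool" where
  "piece_data M c \<gamma> w b b' \<longleftrightarrow> b < b' \<and> c \<in> atlas M \<and> \<gamma> ` {b..b'} \<subseteq> fst c \<and>
     (\<forall>t\<in>{b..b'}. ((snd c \<circ> \<gamma>) has_vector_derivative w t) (at t within {b..b'})) \<and> continuous_on {b..b'} w"

definition speed ::
  "('a, 'n::finite) riemannian \<Rightarrow> ('a, 'n) chart \<Rightarrow> (real \<Rightarrow> 'a) \<Rightarrow> (real \<Rightarrow> real ^ 'n) \<Rightarrow> real \<Rightarrow> real" where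
  "speed M c \<gamma> w t = sqrt (mtensor M c (snd c (\<gamma> t)) (w t) (w t))"

definition piece :: "('a, 'n::finite) riemannian \<Rightarrow> 'a \<Rightarrow> 'a \<Rightarrow> real \<Rightarrow> bool" where
  "piece M x y l \<longleftrightarrow> (\<exists>c \<gamma> w b b'. piece_data M c \<gamma> w b b' \<and> \<gamma> b = x \<and> \<gamma> b' = y \<and> l = integral {b..b'} (speed M c \<gamma> w))"

text \<open>Forgetting the parametrisation makes concatenation and reversal of curves trivial.\<close>

inductive chain :: "('a, 'n::finite) riemannian \<Rightarrow> 'a \<Rightarrow> 'a \<Rightarrow> real \<Rightarrow> bool" for M x where
  chain_refl: "x \<in> points M \<Longrightarrow> chain M x x 0"
| chain_step: "chain M x y L \<Longrightarrow> piece M y z l \<Longrightarrow> chain M x z (L + l)"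

lemma curve_length_piece:
  "curve_length M \<gamma> a b L \<Longrightarrow> piece_data M c \<gamma> w b b' \<Longrightarrow>
    curve_length M \<gamma> a b' (L + integral {b..b'} (speed M c \<gamma> w))"
  unfolding piece_data_def speed_def by (rule curve_length.piece) auto

lemma curve_length_imp_chain: "curve_length M \<gamma> a b L \<Longrightarrow> chain M (\<gamma> a) (\<gamma> b) L"
proof (induction rule: curve_length.induct)
  case (piece b L b' c w)
  then have "piece_data M c \<gamma> w b b'" by (simp add: piece_data_def)
  then have "Submission.piece M (\<gamma> b) (\<gamma> b') (integral {b..b'} (speed M c \<gamma> w))"
    unfolding piece_def by blast
  from chain_step[OF piece.IH this] show ?case unfolding speed_def .
qed (rule chain_refl)

lemma curve_length_le: "curve_length M \<gamma> a b L \<Longrightarrow> a \<le> b"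
  by (induction rule: curve_length.induct) auto

lemma piece_data_cong:
  assumes "piece_data M c \<gamma> w b b'" "\<And>t. t \<in> {b..b'} \<Longrightarrow> \<gamma>' t = \<gamma> t"
  shows "piece_data M c \<gamma>' w b b'" "integral {b..b'} (speed M c \<gamma>' w) = integral {b..b'} (speed M c \<gamma> w)"
proof -
  have "((snd c \<circ> \<gamma>') has_vector_derivative w t) (at t within {b..b'})" if "t \<in> {b..b'}" for t
    using assms that unfolding piece_data_def
    by (intro has_vector_derivative_transform[of t "{b..b'}" "snd c \<circ> \<gamma>'" "snd c \<circ> \<gamma>"]) auto
  then show "piece_data M c \<gamma>' w b b'" using assms unfolding piece_data_def by auto
  show "integral {b..b'} (speed M c \<gamma>' w) = integral {b..b'} (speed M c \<gamma> w)"
    by (intro integral_cong) (simp add: speed_def assms(2))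
qed

text \<open>Concatenation redefines a curve after its end, so the length must depend only on the
  values up to \<open>b\<close>.\<close>

lemma curve_length_cong:
  "curve_length M \<gamma> a b L \<Longrightarrow> (\<And>t. a \<le> t \<Longrightarrow> t \<le> b \<Longrightarrow> \<gamma>' t = \<gamma> t) \<Longrightarrow> curve_length M \<gamma>' a b L"
proof (induction rule: curve_length.induct)
  case point
  then show ?case by (metis curve_length.point order_refl)
next
  case (piece b L b' c w)
  have ab: "a \<le> b" using curve_length_le[OF piece.hyps(1)] .
  have "piece_data M c \<gamma> w b b'" using piece.hyps by (simp add: piece_data_def)
  from piece_data_cong[OF this, of \<gamma>'] have
    "piece_data M c \<gamma>' w b b'" "integral {b..b'} (speed M c \<gamma>' w) = integral {b..b'} (speed M c \<gamma> w)"
    using piece.prems ab by auto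
  moreover have "curve_length M \<gamma>' a b L" using piece.prems piece.hyps by (intro piece.IH) auto
  ultimately show ?case using curve_length_piece[of M \<gamma>' a b L c w b'] unfolding speed_def by simp
qed

locale flat_manifold =
  fixes M :: "('a, 'n::finite) riemannian"
  assumes riem: "riemannian_manifold M" and flat: "locally_euclidean M"
begin

lemma smooth: "smooth_manifold M"
  using riem by (simp add: riemannian_manifold_def)

lemma Hausdorff: "Hausdorff_space (mtop M)" and connected: "connected_space (mtop M)"
  and atlas_cover: "\<Union> (fst ` atlas M) = points M"
  and atlas_chart: "c \<in> atlas M \<Longrightarrow> is_chart (mtop M) c"
  using smooth by (auto simp: smooth_manifold_def)

lemma mtensor_bilinear: "c \<in> atlas M \<Longrightarrow> p \<in> fst c \<Longrightarrow> bilinear (mtensor M c (snd c p))"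
  using riem by (auto simp: riemannian_manifold_def)

lemma mtensor_nonneg: "c \<in> atlas M \<Longrightarrow> p \<in> fst c \<Longrightarrow> 0 \<le> mtensor M c (snd c p) u u"
  using riem mtensor_bilinear[of c p] bilinear_lzero[of "mtensor M c (snd c p)" u]
  by (cases "u = 0") (fastforce simp: riemannian_manifold_def less_imp_le)+

lemma mtensor_continuous: "c \<in> atlas M \<Longrightarrow> continuous_on (snd c ` fst c) (\<lambda>x. mtensor M c x u v)"
proof -
  assume "c \<in> atlas M"
  then have "smooth_on (snd c ` fst c) (\<lambda>x. mtensor M c x u v)"
    using riem by (simp add: riemannian_manifold_def)
  then have "Ck_on 0 (snd c ` fst c) (\<lambda>x. mtensor M c x u v)" unfolding smooth_on_def by blast
  then show ?thesis by simp
qed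

text \<open>Smoothness of the metric is given for fixed arguments \<open>u\<close> and
  \<open>v\<close>; the expansion in a basis carries continuity over to moving velocity
  vectors.\<close>

lemma mtensor_expand:
  assumes "c \<in> atlas M" "p \<in> fst c"
  shows "mtensor M c (snd c p) u v = (\<Sum>i\<in>Basis. \<Sum>j\<in>Basis. (u \<bullet> i) * (v \<bullet> j) * mtensor M c (snd c p) i j)"
proof -
  let ?g = "mtensor M c (snd c p)"
  note b = mtensor_bilinear[OF assms]
  have "?g u v = ?g (\<Sum>i\<in>Basis. (u \<bullet> i) *\<^sub>R i) (\<Sum>j\<in>Basis. (v \<bullet> j) *\<^sub>R j)"
    by (simp add: euclidean_representation)
  also have "\<dots> = (\<Sum>(i, j)\<in>Basis \<times> Basis. ?g ((u \<bullet> i) *\<^sub>R i) ((v \<bullet> j) *\<^sub>R j))"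
    by (rule bilinear_sum[OF b])
  also have "\<dots> = (\<Sum>i\<in>Basis. \<Sum>j\<in>Basis. ?g ((u \<bullet> i) *\<^sub>R i) ((v \<bullet> j) *\<^sub>R j))"
    by (simp add: sum.cartesian_product)
  also have "\<dots> = (\<Sum>i\<in>Basis. \<Sum>j\<in>Basis. (u \<bullet> i) * (v \<bullet> j) * ?g i j)"
    by (simp add: bilinear_lmul[OF b] bilinear_rmul[OF b] mult_ac)
  finally show ?thesis .
qed

lemma piece_data_continuous:
  assumes "piece_data M c \<gamma> w b b'"
  shows "continuous_on {b..b'} (snd c \<circ> \<gamma>)"
  using assms unfolding piece_data_def
  by (intro continuous_on_vector_derivative[of "{b..b'}" _ w]) auto

lemma speed_continuous:
  assumes pd: "piece_data M c \<gamma> w b b'"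
  shows "continuous_on {b..b'} (speed M c \<gamma> w)"
proof -
  have c: "c \<in> atlas M" "\<gamma> ` {b..b'} \<subseteq> fst c" "continuous_on {b..b'} w" using pd by (auto simp: piece_data_def)
  have "continuous_on {b..b'} (\<lambda>t. mtensor M c ((snd c \<circ> \<gamma>) t) i j)" for i j
    using c(2) by (intro continuous_on_compose2[OF mtensor_continuous[OF c(1)] piece_data_continuous[OF pd]]) auto
  then have "continuous_on {b..b'} (\<lambda>t. sqrt (\<Sum>i\<in>Basis. \<Sum>j\<in>Basis. (w t \<bullet> i) * (w t \<bullet> j) * mtensor M c (snd c (\<gamma> t)) i j))"
    using c(3) by (intro continuous_intros) auto
  moreover have "speed M c \<gamma> w t = sqrt (\<Sum>i\<in>Basis. \<Sum>j\<in>Basis. (w t \<bullet> i) * (w t \<bullet> j) * mtensor M c (snd c (\<gamma> t)) i j)"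
    if "t \<in> {b..b'}" for t
  proof -
    have "\<gamma> t \<in> fst c" using c(2) that by blast
    from mtensor_expand[OF c(1) this] show ?thesis unfolding speed_def by (rule arg_cong)
  qed
  ultimately show ?thesis using continuous_on_cong by (metis (no_types, lifting))
qed

lemma speed_integrable: "piece_data M c \<gamma> w b b' \<Longrightarrow> speed M c \<gamma> w integrable_on {b..b'}"
  by (rule integrable_continuous_interval[OF speed_continuous])

lemma speed_nonneg: "piece_data M c \<gamma> w b b' \<Longrightarrow> t \<in> {b..b'} \<Longrightarrow> 0 \<le> speed M c \<gamma> w t"
  unfolding speed_def piece_data_def using mtensor_nonneg[of c "\<gamma> t" "w t"] by (simp add: image_subset_iff)

lemma piece_nonneg: "piece M x y l \<Longrightarrow> 0 \<le> l"
  unfolding piece_def using speed_integrable speed_nonneg by (auto intro!: integral_nonneg)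

lemma piece_points: "piece M x y l \<Longrightarrow> x \<in> points M \<and> y \<in> points M"
proof -
  assume "piece M x y l"
  then obtain c \<gamma> w b b' where pd: "piece_data M c \<gamma> w b b'" "\<gamma> b = x" "\<gamma> b' = y" by (auto simp: piece_def)
  then have "\<gamma> b \<in> fst c" "\<gamma> b' \<in> fst c" "c \<in> atlas M" by (auto simp: piece_data_def)
  then show ?thesis using pd atlas_cover by blast
qed

lemma chain_nonneg: "chain M x y L \<Longrightarrow> 0 \<le> L"
  by (induction rule: chain.induct) (use piece_nonneg in fastforce)+

lemma chain_points: "chain M x y L \<Longrightarrow> x \<in> points M \<and> y \<in> points M"
  by (induction rule: chain.induct) (use piece_points in auto)

text \<open>The factor \<open>u\<close> may be negative, so one computation gives both rescaling and
  reversal. Speeds are multiplied by the absolute value of \<open>u\<close>, which cancels the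
  Jacobian of the substitution.\<close>

lemma piece_data_affine:
  assumes pd: "piece_data M c \<gamma> w b b'" and u: "u \<noteq> 0" and im: "(\<lambda>t. u * t + v) ` {a..a'} = {b..b'}" and a: "a < a'"
  shows "piece_data M c (\<lambda>t. \<gamma> (u * t + v)) (\<lambda>t. u *\<^sub>R w (u * t + v)) a a'"
    and "integral {a..a'} (speed M c (\<lambda>t. \<gamma> (u * t + v)) (\<lambda>t. u *\<^sub>R w (u * t + v))) = integral {b..b'} (speed M c \<gamma> w)"
proof -
  have in_b: "u * t + v \<in> {b..b'}" if "t \<in> {a..a'}" for t using that im by blast
  have c: "c \<in> atlas M" "\<gamma> ` {b..b'} \<subseteq> fst c" "continuous_on {b..b'} w"
    "\<And>t. t \<in> {b..b'} \<Longrightarrow> ((snd c \<circ> \<gamma>) has_vector_derivative w t) (at t within {b..b'})"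
    using pd by (auto simp: piece_data_def)
  have "((snd c \<circ> \<gamma> \<circ> (\<lambda>t. u * t + v)) has_vector_derivative u *\<^sub>R w (u * t + v)) (at t within {a..a'})"
    if t: "t \<in> {a..a'}" for t
  proof (rule vector_diff_chain_within)
    show "((\<lambda>t. u * t + v) has_vector_derivative u) (at t within {a..a'})"
      by (auto intro!: derivative_eq_intros)
    show "(snd c \<circ> \<gamma> has_vector_derivative w (u * t + v)) (at (u * t + v) within (\<lambda>t. u * t + v) ` {a..a'})"
      unfolding im using c(4) in_b t by blast
  qed
  moreover have "continuous_on {a..a'} (\<lambda>t. u *\<^sub>R w (u * t + v))"
    using in_b by (intro continuous_intros continuous_on_compose2[OF c(3)]) auto
  ultimately show "piece_data M c (\<lambda>t. \<gamma> (u * t + v)) (\<lambda>t. u *\<^sub>R w (u * t + v)) a a'"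
    unfolding piece_data_def using a c(1,2) in_b by (auto simp: comp_def)
  have "((\<lambda>t. speed M c \<gamma> w (u *\<^sub>R t + v)) has_integral
      (1 / (\<bar>u\<bar> ^ DIM(real))) *\<^sub>R integral {b..b'} (speed M c \<gamma> w)) ((\<lambda>x. (1 / u) *\<^sub>R x + -((1 / u) *\<^sub>R v)) ` cbox b b')"
    using integrable_integral[OF speed_integrable[OF pd]] u by (intro has_integral_affinity) auto
  moreover have "(\<lambda>x. (1 / u) *\<^sub>R x + -((1 / u) *\<^sub>R v)) ` cbox b b' = {a..a'}"
  proof -
    have "(\<lambda>x. (1 / u) *\<^sub>R x + -((1 / u) *\<^sub>R v)) ` (\<lambda>t. u * t + v) ` {a..a'} = {a..a'}"
      using u by (simp add: image_image field_simps)
    then show ?thesis unfolding im by simp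
  qed
  ultimately have "((\<lambda>t. speed M c \<gamma> w (u * t + v)) has_integral (1 / \<bar>u\<bar>) * integral {b..b'} (speed M c \<gamma> w)) {a..a'}"
    by simp
  from has_integral_mult_right[OF this, of "\<bar>u\<bar>"]
  have scaled: "((\<lambda>t. \<bar>u\<bar> * speed M c \<gamma> w (u * t + v)) has_integral integral {b..b'} (speed M c \<gamma> w)) {a..a'}"
    using u by simp
  have eq: "speed M c (\<lambda>t. \<gamma> (u * t + v)) (\<lambda>t. u *\<^sub>R w (u * t + v)) t = \<bar>u\<bar> * speed M c \<gamma> w (u * t + v)"
    if "t \<in> {a..a'}" for t
  proof -
    have "bilinear (mtensor M c (snd c (\<gamma> (u * t + v))))"
      using mtensor_bilinear[OF c(1)] c(2) in_b[OF that] by blast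
    then show ?thesis unfolding speed_def
      by (simp add: bilinear_lmul bilinear_rmul real_sqrt_mult mult.assoc[symmetric])
  qed
  have "(speed M c (\<lambda>t. \<gamma> (u * t + v)) (\<lambda>t. u *\<^sub>R w (u * t + v)) has_integral integral {b..b'} (speed M c \<gamma> w)) {a..a'}"
    by (rule has_integral_eq[OF eq[symmetric] scaled])
  then show "integral {a..a'} (speed M c (\<lambda>t. \<gamma> (u * t + v)) (\<lambda>t. u *\<^sub>R w (u * t + v))) = integral {b..b'} (speed M c \<gamma> w)"
    by (rule integral_unique)
qed

lemma affine_image:
  fixes a a' b b' :: real
  assumes "a < a'" "b < b'"
  shows "(\<lambda>t. (b' - b) / (a' - a) * t + (b - (b' - b) / (a' - a) * a)) ` {a..a'} = {b..b'}"
proof -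
  have "q * a' + (b - q * a) = q * (a' - a) + b" for q :: real
    by (simp add: algebra_simps)
  then have "(b' - b) / (a' - a) * a' + (b - (b' - b) / (a' - a) * a) = (b' - b) / (a' - a) * (a' - a) + b" .
  also have "\<dots> = b'" using assms by simp
  finally show ?thesis using assms by (subst image_affinity_atLeastAtMost) simp
qed

lemma piece_reparam:
  assumes "piece M x y l" "a < a'"
  obtains c \<gamma> w where "piece_data M c \<gamma> w a a'" "\<gamma> a = x" "\<gamma> a' = y" "integral {a..a'} (speed M c \<gamma> w) = l"
proof -
  obtain c \<gamma> w b b' where pd: "piece_data M c \<gamma> w b b'" "\<gamma> b = x" "\<gamma> b' = y" "l = integral {b..b'} (speed M c \<gamma> w)"
    using assms(1) by (auto simp: piece_def)
  have b: "b < b'" using pd(1) by (simp add: piece_data_def)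
  define u where "u = (b' - b) / (a' - a)"
  define v where "v = b - u * a"
  have im: "(\<lambda>t. u * t + v) ` {a..a'} = {b..b'}" unfolding u_def v_def by (rule affine_image[OF assms(2) b])
  have u: "u \<noteq> 0" using assms(2) b by (simp add: u_def)
  have "u * a' + v = u * (a' - a) + b" by (simp add: v_def algebra_simps)
  also have "\<dots> = b'" using assms(2) by (simp add: u_def)
  finally show ?thesis
    using piece_data_affine[OF pd(1) u im assms(2)] pd(2-4)
    by (intro that[of c "\<lambda>t. \<gamma> (u * t + v)" "\<lambda>t. u *\<^sub>R w (u * t + v)"]) (auto simp: v_def)
qed

lemma piece_sym: "piece M x y l \<Longrightarrow> piece M y x l"
proof -
  assume "piece M x y l"
  then obtain c \<gamma> w b b' where pd: "piece_data M c \<gamma> w b b'" "\<gamma> b = x" "\<gamma> b' = y" "l = integral {b..b'} (speed M c \<gamma> w)"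
    by (auto simp: piece_def)
  have "(\<lambda>t. - 1 * t + 0) = (uminus :: real \<Rightarrow> real)" by auto
  then have "(\<lambda>t. - 1 * t + 0) ` {- b'..- b} = {b..b'}"
    using image_uminus_atLeastAtMost[of "- b'" "- b"] by simp
  moreover have "- b' < - b" using pd(1) by (simp add: piece_data_def)
  ultimately have "piece_data M c (\<lambda>t. \<gamma> (- 1 * t + 0)) (\<lambda>t. - 1 *\<^sub>R w (- 1 * t + 0)) (- b') (- b)"
    "integral {- b'..- b} (speed M c (\<lambda>t. \<gamma> (- 1 * t + 0)) (\<lambda>t. - 1 *\<^sub>R w (- 1 * t + 0))) = l"
    using piece_data_affine[OF pd(1), of "- 1" 0 "- b'" "- b"] pd(4) by auto
  then show ?thesis unfolding piece_def
    by (intro exI[of _ c] exI[of _ "\<lambda>t. \<gamma> (- 1 * t + 0)"] exI[of _ "\<lambda>t. - 1 *\<^sub>R w (- 1 * t + 0)"] exI[of _ "- b'"] exI[of _ "- b"])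
      (use pd in auto)
qed

lemma chain_trans: "chain M y z L' \<Longrightarrow> chain M x y L \<Longrightarrow> chain M x z (L + L')"
proof (induction rule: chain.induct)
  case (chain_step z L' z' l)
  then show ?case using chain.chain_step[of M x z "L + L'" z' l] by (simp add: add.assoc)
qed simp

lemma piece_chain: "piece M x y l \<Longrightarrow> chain M x y l"
  using chain.chain_step[OF chain_refl, of x M y l] piece_points by simp

lemma chain_sym: "chain M x y L \<Longrightarrow> chain M y x L"
proof (induction rule: chain.induct)
  case (chain_step y L z l)
  then show ?case using chain_trans[OF chain_step.IH piece_chain[OF piece_sym[OF chain_step.hyps(2)]]]
    by (simp add: add.commute)
qed (rule chain.chain_refl)

lemma constant_piece: "x \<in> points M \<Longrightarrow> b < b' \<Longrightarrow> \<exists>c. piece_data M c (\<lambda>_. x) (\<lambda>_. 0) b b' \<and> integral {b..b'} (speed M c (\<lambda>_. x) (\<lambda>_. 0)) = 0"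
proof -
  assume x: "x \<in> points M" and b: "b < b'"
  obtain c where c: "c \<in> atlas M" "x \<in> fst c" using x atlas_cover by blast
  have "piece_data M c (\<lambda>_. x) (\<lambda>_. 0) b b'"
    using b c unfolding piece_data_def by (auto simp: comp_def)
  moreover have "speed M c (\<lambda>_. x) (\<lambda>_. 0) = (\<lambda>_. 0)"
    using bilinear_lzero[OF mtensor_bilinear[OF c]] by (intro ext) (simp add: speed_def)
  then have "integral {b..b'} (speed M c (\<lambda>_. x) (\<lambda>_. 0)) = 0" by simp
  ultimately show ?thesis by blast
qed

text \<open>Each further piece is reparametrised to half of the parameter interval left before 1, so
  there is always room for another; resting at \<open>y\<close> then fills the remainder.\<close>

lemma chain_imp_curve:
  assumes "chain M x y L"
  shows "\<exists>\<gamma>. \<gamma> 0 = x \<and> \<gamma> 1 = y \<and> curve_length M \<gamma> 0 1 L"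
proof -
  have append: "\<exists>\<gamma>'. \<gamma>' 0 = x \<and> \<gamma>' b' = z \<and> curve_length M \<gamma>' 0 b' (L + l)"
    if "curve_length M \<gamma> 0 b L" "\<gamma> 0 = x" "\<gamma> b = y" "b < b'" "piece_data M c \<delta> w b b'" "\<delta> b = y" "\<delta> b' = z"
      "integral {b..b'} (speed M c \<delta> w) = l" for \<gamma> b b' c \<delta> w y z L l
  proof -
    define \<gamma>' where "\<gamma>' t = (if t \<le> b then \<gamma> t else \<delta> t)" for t
    have b0: "0 \<le> b" using curve_length_le[OF that(1)] .
    have "curve_length M \<gamma>' 0 b L"
      by (rule curve_length_cong[OF that(1)]) (simp add: \<gamma>'_def)
    moreover have "\<gamma>' t = \<delta> t" if "t \<in> {b..b'}" for t
      using that \<open>\<gamma> b = y\<close> \<open>\<delta> b = y\<close> by (auto simp: \<gamma>'_def)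
    note piece_data_cong[OF that(5) this]
    ultimately have "curve_length M \<gamma>' 0 b' (L + l)"
      using curve_length_piece[of M \<gamma>' 0 b L c w b'] that(8) by simp
    then show ?thesis using that b0 by (intro exI[of _ \<gamma>']) (auto simp: \<gamma>'_def)
  qed
  have "\<exists>\<gamma> b. 0 \<le> b \<and> b < 1 \<and> \<gamma> 0 = x \<and> \<gamma> b = y \<and> curve_length M \<gamma> 0 b L"
    using assms
  proof (induction rule: chain.induct)
    case chain_refl
    then show ?case by (intro exI[of _ "\<lambda>_. x"] exI[of _ 0]) (auto intro: curve_length.point)
  next
    case (chain_step y L z l)
    then obtain \<gamma> b where g: "0 \<le> b" "b < 1" "\<gamma> 0 = x" "\<gamma> b = y" "curve_length M \<gamma> 0 b L" by blast
    define b' where "b' = (b + 1) / 2"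
    have b': "b < b'" "b' < 1" using g by (auto simp: b'_def)
    obtain c \<delta> w where "piece_data M c \<delta> w b b'" "\<delta> b = y" "\<delta> b' = z" "integral {b..b'} (speed M c \<delta> w) = l"
      by (rule piece_reparam[OF chain_step.hyps(2) b'(1)])
    from append[OF g(5,3,4) b'(1) this]
    obtain \<gamma>' where "\<gamma>' 0 = x" "\<gamma>' b' = z" "curve_length M \<gamma>' 0 b' (L + l)" by blast
    then show ?case using b' g(1) by (intro exI[of _ \<gamma>'] exI[of _ b']) auto
  qed
  then obtain \<gamma> b where g: "0 \<le> b" "b < 1" "\<gamma> 0 = x" "\<gamma> b = y" "curve_length M \<gamma> 0 b L" by blast
  obtain c where "piece_data M c (\<lambda>_. y) (\<lambda>_. 0) b 1" "integral {b..1} (speed M c (\<lambda>_. y) (\<lambda>_. 0)) = 0"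
    using constant_piece[of y b 1] g(2) chain_points[OF assms] by blast
  from append[OF g(5,3,4,2) this(1) refl refl this(2)] show ?thesis by simp
qed

lemma riem_dist_eq: "riem_dist M x y = Inf {L. chain M x y L}"
proof -
  have "{L. \<exists>\<gamma>. \<gamma> 0 = x \<and> \<gamma> 1 = y \<and> curve_length M \<gamma> 0 1 L} = {L. chain M x y L}"
    using chain_imp_curve curve_length_imp_chain by fastforce
  then show ?thesis by (simp add: riem_dist_def)
qed

end

section \<open>Flat charts: Riemannian length against Euclidean distance\<close>

context flat_manifold
begin

text \<open>A flat chart belongs to the maximal atlas and need not be in \<open>atlas M\<close>,
  while curve pieces are measured in charts of \<open>atlas M\<close>. Lengths therefore pass
  through the transition maps.\<close>

definition flat_chart :: "('a, 'n) chart \<Rightarrow> bool" where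
  "flat_chart h \<longleftrightarrow> smooth_chart M h \<and>
     (\<forall>c\<in>atlas M. \<forall>x\<in>overlap c h. \<forall>u v. mtensor M c x u v = inner (jacobian c h x u) (jacobian c h x v))"

lemma flat_chart_exists: "p \<in> points M \<Longrightarrow> \<exists>h. flat_chart h \<and> p \<in> fst h"
  using flat unfolding locally_euclidean_def flat_chart_def by blast

lemma flat_chart_chart: "flat_chart h \<Longrightarrow> is_chart (mtop M) h"
  by (simp add: flat_chart_def smooth_chart_def)

lemma flat_chart_compatible:
  assumes "flat_chart h" "c \<in> atlas M"
  shows "smooth_on (overlap c h) (transition c h)" "smooth_on (overlap h c) (transition h c)" "smooth_compatible h c"
  using assms by (auto simp: flat_chart_def smooth_chart_def smooth_compatible_def)

lemma flat_chart_points: "flat_chart h \<Longrightarrow> fst h \<subseteq> points M"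
  using chart_openin[OF flat_chart_chart] openin_subset by blast

lemma flat_chart_speed:
  assumes h: "flat_chart h" and c: "c \<in> atlas M" and p: "p \<in> fst c" "p \<in> fst h"
  shows "sqrt (mtensor M c (snd c p) v v) = norm (jacobian c h (snd c p) v)"
proof -
  have "snd c p \<in> overlap c h" using p by (auto simp: overlap_def)
  then have "mtensor M c (snd c p) v v = inner (jacobian c h (snd c p) v) (jacobian c h (snd c p) v)"
    using h c unfolding flat_chart_def by blast
  then show ?thesis by (simp add: norm_eq_sqrt_inner)
qed

text \<open>In flat coordinates the speed is the Euclidean norm of the velocity, so displacement is
  at most length. Only an initial part up to \<open>t\<close> is assumed to run in the chart, since
  confinement of the whole piece is deduced from this estimate.\<close>

lemma piece_length_lower:
  assumes h: "flat_chart h" and pd: "piece_data M c \<gamma> w b b'" and t: "t \<in> {b..b'}" "\<gamma> ` {b..t} \<subseteq> fst h"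
  shows "dist (snd h (\<gamma> b)) (snd h (\<gamma> t)) \<le> integral {b..b'} (speed M c \<gamma> w)"
proof -
  have c: "c \<in> atlas M" "\<gamma> ` {b..b'} \<subseteq> fst c"
    and der: "\<And>s. s \<in> {b..b'} \<Longrightarrow> ((snd c \<circ> \<gamma>) has_vector_derivative w s) (at s within {b..b'})"
    using pd by (auto simp: piece_data_def)
  have sub: "{b..t} \<subseteq> {b..b'}" using t by auto
  define w' where "w' s = jacobian c h (snd c (\<gamma> s)) (w s)" for s
  have der': "((snd h \<circ> \<gamma>) has_vector_derivative w' s) (at s within {b..t})" if s: "s \<in> {b..t}" for s
  proof -
    have ov: "snd c (\<gamma> s) \<in> overlap c h" using s sub c(2) t(2) unfolding overlap_def by blast
    have "((snd c \<circ> \<gamma>) has_derivative (\<lambda>x. x *\<^sub>R w s)) (at s within {b..t})"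
      using has_vector_derivative_within_subset[OF der sub] s sub unfolding has_vector_derivative_def by blast
    moreover have "(transition c h has_derivative jacobian c h (snd c (\<gamma> s))) (at ((snd c \<circ> \<gamma>) s) within (snd c \<circ> \<gamma>) ` {b..t})"
      using smooth_transition(1)[OF flat_chart_compatible(1)[OF h c(1)] ov] has_derivative_at_withinI by (simp, blast)
    ultimately have "(transition c h \<circ> (snd c \<circ> \<gamma>) has_derivative
        jacobian c h (snd c (\<gamma> s)) \<circ> (\<lambda>x. x *\<^sub>R w s)) (at s within {b..t})"
      by (rule diff_chain_within)
    moreover have "jacobian c h (snd c (\<gamma> s)) \<circ> (\<lambda>x. x *\<^sub>R w s) = (\<lambda>x. x *\<^sub>R w' s)"
    proof -
      have "linear (jacobian c h (snd c (\<gamma> s)))"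
        using smooth_transition(1)[OF flat_chart_compatible(1)[OF h c(1)] ov] has_derivative_linear by blast
      then show ?thesis by (auto simp: w'_def linear_scale)
    qed
    ultimately have "(transition c h \<circ> (snd c \<circ> \<gamma>) has_vector_derivative w' s) (at s within {b..t})"
      by (simp add: has_vector_derivative_def)
    then show ?thesis
    proof (rule has_vector_derivative_transform[OF s, rotated])
      fix r assume "r \<in> {b..t}"
      then have "\<gamma> r \<in> fst c" using sub c(2) by blast
      then show "(snd h \<circ> \<gamma>) r = (transition c h \<circ> (snd c \<circ> \<gamma>)) r"
        using transition_chart[OF atlas_chart[OF c(1)]] by simp
    qed
  qed
  \<comment> \<open>The fundamental theorem for the gauge integral supplies the integrability of
    \<open>w'\<close> along with the value of the integral.\<close>
  have int: "(w' has_integral ((snd h \<circ> \<gamma>) t - (snd h \<circ> \<gamma>) b)) {b..t}"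
  proof (rule fundamental_theorem_of_calculus)
    show "b \<le> t" using t(1) by simp
  qed (rule der')
  have sp: "norm (w' s) = speed M c \<gamma> w s" if "s \<in> {b..t}" for s
    using flat_chart_speed[OF h c(1), of "\<gamma> s" "w s"] that sub c(2) t(2)
    unfolding speed_def w'_def by (simp add: image_subset_iff)
  have si: "speed M c \<gamma> w integrable_on {b..t}"
    using integrable_on_subinterval[OF speed_integrable[OF pd] sub] .
  have "norm (integral {b..t} w') \<le> integral {b..t} (speed M c \<gamma> w)"
    using int si sp by (intro integral_norm_bound_integral) (auto simp: integrable_on_def)
  also have "\<dots> \<le> integral {b..b'} (speed M c \<gamma> w)"
    by (rule integral_subset_le[OF sub si speed_integrable[OF pd]]) (use speed_nonneg[OF pd] in auto)
  also have "integral {b..t} w' = snd h (\<gamma> t) - snd h (\<gamma> b)"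
    using integral_unique[OF int] by simp
  finally show ?thesis by (simp add: dist_norm norm_minus_commute)
qed

text \<open>First exit argument: as long as the curve stays in the open coordinate ball
  \<open>V\<close>, the length bound keeps it in the compact set \<open>C\<close> inside
  \<open>V\<close>; at a first exit time it would still lie in \<open>C\<close> by
  continuity.\<close>

lemma piece_stays:
  assumes h: "flat_chart h" and x: "x \<in> fst h" "ball (snd h x) \<rho> \<subseteq> snd h ` fst h"
    and y: "y \<in> fst h" "dist (snd h x) (snd h y) \<le> L" and p: "piece M y z l" and L: "L + l < \<rho>"
  shows "z \<in> fst h \<and> dist (snd h x) (snd h z) \<le> L + l"
proof -
  obtain c \<gamma> w b b' where pd: "piece_data M c \<gamma> w b b'" and g: "\<gamma> b = y" "\<gamma> b' = z" and l: "l = integral {b..b'} (speed M c \<gamma> w)"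
    using p by (auto simp: piece_def)
  have b: "b < b'" "c \<in> atlas M" "\<gamma> ` {b..b'} \<subseteq> fst c" using pd by (auto simp: piece_data_def)
  have l0: "0 \<le> l" using piece_nonneg[OF p] .
  define V where "V = {p \<in> fst h. snd h p \<in> ball (snd h x) \<rho>}"
  define C where "C = {p \<in> fst h. snd h p \<in> cball (snd h x) (L + l)}"
  have CV: "C \<subseteq> V" using L by (auto simp: C_def V_def)
  have "openin (mtop M) V" unfolding V_def by (rule chart_openin_preimage[OF flat_chart_chart[OF h]]) simp
  moreover have "cball (snd h x) (L + l) \<subseteq> snd h ` fst h" using x(2) L by (auto simp: subset_iff)
  then have "compactin (mtop M) C" unfolding C_def by (intro chart_compactin_preimage[OF flat_chart_chart[OF h]]) auto
  then have "closedin (mtop M) C" using Hausdorff compactin_imp_closedin by blast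
  moreover have cont: "continuous_map (top_of_set {b..b'}) (mtop M) \<gamma>"
    using chart_curve_continuous[OF atlas_chart[OF b(2)] piece_data_continuous[OF pd] b(3)] .
  ultimately have "openin (top_of_set {b..b'}) {t \<in> topspace (top_of_set {b..b'}). \<gamma> t \<in> V}"
    "closedin (top_of_set {b..b'}) {t \<in> topspace (top_of_set {b..b'}). \<gamma> t \<in> C}"
    using openin_continuous_map_preimage closedin_continuous_map_preimage by blast+
  then have op: "openin (top_of_set {b..b'}) {t \<in> {b..b'}. \<gamma> t \<in> V}" and cl: "closed {t \<in> {b..b'}. \<gamma> t \<in> C}"
    using closedin_closed_trans[OF _ closed_atLeastAtMost] by auto
  have inC: "\<gamma> t \<in> C" if t: "t \<in> {b..b'}" "\<gamma> ` {b..t} \<subseteq> V" for t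
  proof -
    have sub: "\<gamma> ` {b..t} \<subseteq> fst h" using t(2) by (auto simp: V_def)
    have "dist (snd h x) (snd h (\<gamma> t)) \<le> dist (snd h x) (snd h y) + dist (snd h y) (snd h (\<gamma> t))"
      by (rule dist_triangle)
    also have "\<dots> \<le> L + l" using y(2) piece_length_lower[OF h pd t(1) sub] g(1) l by simp
    moreover have "\<gamma> t \<in> fst h" using sub t(1) by auto
    ultimately show ?thesis by (simp add: C_def)
  qed
  have all: "\<gamma> t \<in> V" if "t \<in> {b..b'}" for t
  proof (rule ccontr)
    assume no: "\<gamma> t \<notin> V"
    define Bad where "Bad = {t \<in> {b..b'}. \<gamma> t \<notin> V}"
    have "{b..b'} - {t \<in> {b..b'}. \<gamma> t \<in> V} = Bad" by (auto simp: Bad_def)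
    then have "closedin (top_of_set {b..b'}) Bad" using op by (metis closedin_diff closedin_topspace topspace_euclidean_subtopology)
    then have "closed Bad" by (rule closedin_closed_trans) simp
    moreover have ne: "Bad \<noteq> {}" using that no by (auto simp: Bad_def)
    moreover have bb: "bdd_below Bad" by (rule bdd_belowI[of _ b]) (auto simp: Bad_def)
    ultimately have inf: "Inf Bad \<in> Bad" by (intro closed_contains_Inf)
    define s where "s = Inf Bad"
    have s: "s \<in> {b..b'}" "\<gamma> s \<notin> V" using inf by (auto simp: Bad_def s_def)
    have good: "\<gamma> r \<in> V" if "r \<in> {b..b'}" "r < s" for r
      using that cInf_lower[OF _ bb, of r] by (auto simp: Bad_def s_def)
    have "\<gamma> b \<in> V"
      using y L l0 g(1) by (simp add: V_def)
    then have "b < s" using s by (cases "s = b") auto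
    have "{b..<s} \<subseteq> {t \<in> {b..b'}. \<gamma> t \<in> C}"
    proof
      fix r assume r: "r \<in> {b..<s}"
      then have "r \<in> {b..b'}" using s by auto
      moreover have "\<gamma> ` {b..r} \<subseteq> V" using r s good by auto
      ultimately show "r \<in> {t \<in> {b..b'}. \<gamma> t \<in> C}" using inC by blast
    qed
    then have "closure {b..<s} \<subseteq> {t \<in> {b..b'}. \<gamma> t \<in> C}" using cl by (rule closure_minimal)
    moreover have "s \<in> closure {b..<s}" using \<open>b < s\<close> by simp
    ultimately have "\<gamma> s \<in> C" by blast
    then show False using CV s(2) by blast
  qed
  have "\<gamma> b' \<in> C" using all b by (intro inC) auto
  then show ?thesis using g(2) by (simp add: C_def)
qed

lemma chain_stays:
  assumes h: "flat_chart h" and x: "x \<in> fst h" "ball (snd h x) \<rho> \<subseteq> snd h ` fst h"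
  shows "chain M x y L \<Longrightarrow> L < \<rho> \<Longrightarrow> y \<in> fst h \<and> dist (snd h x) (snd h y) \<le> L"
proof (induction rule: chain.induct)
  case (chain_step y L z l)
  then have "L < \<rho>" using piece_nonneg[OF chain_step.hyps(2)] by simp
  then show ?case using piece_stays[OF h x _ _ chain_step.hyps(2)] chain_step by blast
qed (use x in simp)

text \<open>The preimage of a Euclidean segment has constant speed, but it may cross several charts
  of the atlas, whereas a piece has to lie in one. \<open>Bolzano\<close> does the subdivision:
  chains compose, and near each parameter one chart suffices.\<close>

lemma segment_chain:
  assumes h: "flat_chart h" and xy: "x \<in> fst h" "y \<in> fst h"
    and seg: "closed_segment (snd h x) (snd h y) \<subseteq> snd h ` fst h"
  shows "chain M x y (dist (snd h x) (snd h y))"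
proof -
  note hc = flat_chart_chart[OF h]
  define v where "v = snd h y - snd h x"
  define p where "p t = snd h x + t *\<^sub>R v" for t
  define \<gamma> where "\<gamma> = inv_into (fst h) (snd h) \<circ> p"
  have p: "p t \<in> snd h ` fst h" if "t \<in> {0..1}" for t
  proof -
    have "p t = (1 - t) *\<^sub>R snd h x + t *\<^sub>R snd h y" by (simp add: p_def v_def algebra_simps)
    then have "p t \<in> closed_segment (snd h x) (snd h y)"
      using that unfolding in_segment(1) by (intro exI[of _ t]) auto
    then show ?thesis using seg by blast
  qed
  have g: "\<gamma> t \<in> fst h" "snd h (\<gamma> t) = p t" if "t \<in> {0..1}" for t
    using p[OF that] by (auto simp: \<gamma>_def inv_into_into f_inv_into_f)
  have pder: "(p has_vector_derivative v) (at t within S)" for t S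
    unfolding p_def by (auto intro!: derivative_eq_intros)
  have pcont: "continuous_on S p" for S unfolding p_def by (intro continuous_intros)
  \<comment> \<open>The guards confine the claim to \<open>{0..1}\<close>, as \<open>Bolzano\<close>
    asks for it on all short intervals around a point, including those that leave the unit
    interval.\<close>
  define P where "P s t \<longleftrightarrow> (0 \<le> s \<longrightarrow> t \<le> 1 \<longrightarrow> chain M (\<gamma> s) (\<gamma> t) ((t - s) * norm v))" for s t
  have "P 0 1"
  proof (rule Bolzano)
    show "(0::real) \<le> 1" by simp
  next
    fix a b c assume *: "P a b" "P b c" "a \<le> b" "b \<le> c"
    show "P a c"
      unfolding P_def
    proof (intro impI)
      assume "0 \<le> a" "c \<le> 1"
      then have "chain M (\<gamma> a) (\<gamma> b) ((b - a) * norm v)" "chain M (\<gamma> b) (\<gamma> c) ((c - b) * norm v)"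
        using * unfolding P_def by auto
      then have "chain M (\<gamma> a) (\<gamma> c) ((b - a) * norm v + (c - b) * norm v)" by (rule chain_trans[rotated])
      then show "chain M (\<gamma> a) (\<gamma> c) ((c - a) * norm v)" by (simp add: algebra_simps)
    qed
  next
    fix x0 :: real assume "0 \<le> x0" "x0 \<le> 1"
    then have x0: "x0 \<in> {0..1}" by simp
    have "\<gamma> x0 \<in> points M" using g[OF x0] flat_chart_points[OF h] by blast
    then obtain c where c: "c \<in> atlas M" "\<gamma> x0 \<in> fst c" using atlas_cover by blast
    note cc = atlas_chart[OF c(1)]
    have op: "open (overlap h c)" by (rule open_overlap[OF hc cc])
    have "p x0 \<in> overlap h c" using g[OF x0] c(2) unfolding overlap_def by (metis IntI image_eqI)
    moreover have "open (p -` overlap h c)" using op pcont[of UNIV] by (simp add: open_vimage)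
    ultimately obtain d where d: "0 < d" "ball x0 d \<subseteq> p -` overlap h c"
      unfolding open_contains_ball by blast
    have "chain M (\<gamma> s) (\<gamma> t) ((t - s) * norm v)"
      if st: "s \<le> x0" "x0 \<le> t" "t - s < d" "0 \<le> s" "t \<le> 1" for s t
    proof (cases "s = t")
      case True
      then have "\<gamma> s \<in> points M" using g[of s] st flat_chart_points[OF h] by force
      then show ?thesis using True chain_refl by simp
    next
      case False
      then have lt: "s < t" using st by simp
      have sub: "{s..t} \<subseteq> {0..1}" using st by auto
      have ov: "p r \<in> overlap h c" if "r \<in> {s..t}" for r
        using d(2) st that by (auto simp: dist_real_def subset_iff)
      have gc: "\<gamma> r \<in> fst c" if r: "r \<in> {s..t}" for r
      proof -
        obtain q where q: "q \<in> fst h" "q \<in> fst c" "p r = snd h q" using ov[OF r] unfolding overlap_def by blast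
        then have "\<gamma> r = q" using chart_inv[OF hc] by (simp add: \<gamma>_def)
        then show ?thesis using q by simp
      qed
      define w where "w r = jacobian h c (p r) v" for r
      have tr: "(transition h c has_derivative jacobian h c (p r)) (at (p r))" if "r \<in> {s..t}" for r
        using smooth_transition(1)[OF flat_chart_compatible(2)[OF h c(1)] ov[OF that]] .
      have eq: "snd c \<circ> \<gamma> = transition h c \<circ> p" by (simp add: \<gamma>_def transition_def o_assoc)
      have der: "((snd c \<circ> \<gamma>) has_vector_derivative w r) (at r within {s..t})" if r: "r \<in> {s..t}" for r
      proof -
        have "(transition h c has_derivative jacobian h c (p r)) (at (p r) within p ` {s..t})"
          using tr[OF r] has_derivative_at_withinI by blast
        then have "(transition h c \<circ> p has_derivative jacobian h c (p r) \<circ> (\<lambda>x. x *\<^sub>R v)) (at r within {s..t})"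
          using pder[of r "{s..t}"] unfolding has_vector_derivative_def by (intro diff_chain_within) auto
        moreover have "jacobian h c (p r) \<circ> (\<lambda>x. x *\<^sub>R v) = (\<lambda>x. x *\<^sub>R w r)"
          using has_derivative_linear[OF tr[OF r]] by (auto simp: w_def linear_scale)
        ultimately show ?thesis unfolding eq by (simp add: has_vector_derivative_def)
      qed
      have "continuous_on {s..t} w"
        unfolding w_def using ov
        by (intro continuous_on_compose2[OF smooth_transition(2)[OF flat_chart_compatible(2)[OF h c(1)]] pcont]) auto
      then have pd: "piece_data M c \<gamma> w s t" using lt c(1) gc der by (auto simp: piece_data_def)
      have "speed M c \<gamma> w r = norm v" if r: "r \<in> {s..t}" for r
      proof -
        have cr: "snd c (\<gamma> r) = transition h c (p r)" using eq by (metis o_apply)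
        have "speed M c \<gamma> w r = norm (jacobian c h (transition h c (p r)) (jacobian h c (p r) v))"
          unfolding speed_def using flat_chart_speed[OF h c(1) gc[OF r] g(1), of "w r"] r sub
          by (auto simp: cr w_def)
        then show ?thesis using jacobian_inverse[OF hc cc flat_chart_compatible(3)[OF h c(1)] ov[OF r]] by simp
      qed
      then have "integral {s..t} (speed M c \<gamma> w) = integral {s..t} (\<lambda>_. norm v)" by (intro integral_cong) auto
      also have "\<dots> = (t - s) * norm v" using lt by simp
      finally have "piece M (\<gamma> s) (\<gamma> t) ((t - s) * norm v)" unfolding piece_def using pd by metis
      then show ?thesis by (rule piece_chain)
    qed
    then show "\<exists>d>0. \<forall>a b. a \<le> x0 \<and> x0 \<le> b \<and> b - a < d \<longrightarrow> P a b"
      unfolding P_def using d(1) by blast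
  qed
  moreover have "\<gamma> 0 = x" "\<gamma> 1 = y"
    using chart_inv[OF hc] xy by (simp_all add: \<gamma>_def p_def v_def)
  ultimately show ?thesis by (simp add: P_def v_def dist_norm norm_minus_commute)
qed

lemma chain_open_neighbourhood:
  assumes "y \<in> points M"
  shows "\<exists>V. openin (mtop M) V \<and> y \<in> V \<and> (\<forall>z\<in>V. \<exists>L. chain M y z L)"
proof -
  obtain h where h: "flat_chart h" "y \<in> fst h" using flat_chart_exists[OF assms] by blast
  note hc = flat_chart_chart[OF h(1)]
  obtain r where r: "0 < r" "ball (snd h y) r \<subseteq> snd h ` fst h"
    using chart_open_image[OF hc] h(2) unfolding open_contains_ball by blast
  have "\<exists>L. chain M y z L" if z: "z \<in> fst h" "snd h z \<in> ball (snd h y) r" for z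
  proof -
    have "closed_segment (snd h y) (snd h z) \<subseteq> ball (snd h y) r"
      using z(2) r(1) by (intro closed_segment_subset) auto
    then show ?thesis using segment_chain[OF h(1,2) z(1)] r(2) by blast
  qed
  moreover have "openin (mtop M) {z \<in> fst h. snd h z \<in> ball (snd h y) r}"
    by (rule chart_openin_preimage[OF hc]) simp
  ultimately show ?thesis using h(2) r(1)
    by (intro exI[of _ "{z \<in> fst h. snd h z \<in> ball (snd h y) r}"]) auto
qed

text \<open>Connectedness: the points reachable from \<open>x\<close> form an open and closed set.
  The infimum defining the distance is therefore taken over a nonempty set.\<close>

lemma chain_exists:
  assumes x: "x \<in> points M" and y: "y \<in> points M"
  shows "\<exists>L. chain M x y L"
proof -
  define R where "R = {z \<in> points M. \<exists>L. chain M x z L}"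
  have "openin (mtop M) R"
  proof (subst openin_subopen, intro ballI)
    fix z assume z: "z \<in> R"
    then obtain V where V: "openin (mtop M) V" "z \<in> V" "\<forall>w\<in>V. \<exists>L. chain M z w L"
      using chain_open_neighbourhood unfolding R_def by blast
    have "V \<subseteq> R"
    proof
      fix w assume w: "w \<in> V"
      then show "w \<in> R" using V z chain_trans[of z w _ x] openin_subset[OF V(1)] unfolding R_def by blast
    qed
    then show "\<exists>V. openin (mtop M) V \<and> z \<in> V \<and> V \<subseteq> R" using V by blast
  qed
  moreover have "openin (mtop M) (points M - R)"
  proof (subst openin_subopen, intro ballI)
    fix z assume z: "z \<in> points M - R"
    then obtain V where V: "openin (mtop M) V" "z \<in> V" "\<forall>w\<in>V. \<exists>L. chain M z w L"
      using chain_open_neighbourhood by blast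
    have "V \<subseteq> points M - R"
    proof
      fix w assume w: "w \<in> V"
      then obtain L where L: "chain M w z L" using V(3) chain_sym by blast
      have "w \<notin> R" using z chain_trans[OF L] unfolding R_def by blast
      then show "w \<in> points M - R" using w openin_subset[OF V(1)] by blast
    qed
    then show "\<exists>V. openin (mtop M) V \<and> z \<in> V \<and> V \<subseteq> points M - R" using V by blast
  qed
  then have "closedin (mtop M) R" unfolding closedin_def R_def by blast
  moreover have "x \<in> R" using x chain_refl[OF x] unfolding R_def by blast
  ultimately have "R = points M" using connected unfolding connected_space_clopen_in by blast
  then show ?thesis using y unfolding R_def by blast
qed

text \<open>Outside of \<open>points M\<close> the value of \<open>riem_dist\<close> is an unspecified infimum over the empty set,
  whereas \<open>Metric_space\<close> demands nonnegativity everywhere.\<close>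

definition rdist :: "'a \<Rightarrow> 'a \<Rightarrow> real" where
  "rdist x y = (if x \<in> points M \<and> y \<in> points M then riem_dist M x y else 0)"

lemma rdist_eq: "x \<in> points M \<Longrightarrow> y \<in> points M \<Longrightarrow> rdist x y = Inf {L. chain M x y L}"
  by (simp add: rdist_def riem_dist_eq)

lemma rdist_le_chain: "chain M x y L \<Longrightarrow> rdist x y \<le> L"
  using rdist_eq chain_points chain_nonneg by (auto intro!: cInf_lower bdd_belowI)

lemma rdist_ge:
  assumes "x \<in> points M" "y \<in> points M" "\<And>L. chain M x y L \<Longrightarrow> b \<le> L"
  shows "b \<le> rdist x y"
  unfolding rdist_eq[OF assms(1,2)]
proof (rule cInf_greatest)
  show "{L. chain M x y L} \<noteq> {}" using chain_exists[OF assms(1,2)] by blast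
qed (use assms(3) in blast)

lemma rdist_less_chain:
  assumes "x \<in> points M" "y \<in> points M" "rdist x y < b"
  obtains L where "chain M x y L" "L < b"
proof (rule ccontr)
  assume "\<not> thesis"
  then have "b \<le> rdist x y" using that by (intro rdist_ge assms) (meson not_le)
  then show False using assms(3) by simp
qed

text \<open>A chain shorter than \<open>\<rho>\<close> cannot leave the coordinate ball, so its end
  lies in the chart; letting chain lengths approach the distance gives the estimate.\<close>

lemma flat_chart_rdist_less:
  assumes h: "flat_chart h" and x: "x \<in> fst h" "ball (snd h x) \<rho> \<subseteq> snd h ` fst h"
    and y: "y \<in> points M" "rdist x y < \<rho>"
  shows "y \<in> fst h" "dist (snd h x) (snd h y) \<le> rdist x y"
proof -
  have xp: "x \<in> points M" using x(1) flat_chart_points[OF h] by blast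
  obtain L where "chain M x y L" "L < \<rho>" using rdist_less_chain[OF xp y] .
  then show "y \<in> fst h" using chain_stays[OF h x] by blast
  show "dist (snd h x) (snd h y) \<le> rdist x y"
  proof (rule field_le_epsilon)
    fix e :: real assume e: "0 < e"
    obtain L where "chain M x y L" "L < min \<rho> (rdist x y + e)"
      by (rule rdist_less_chain[OF xp y(1), of "min \<rho> (rdist x y + e)"]) (use y(2) e in auto)
    then show "dist (snd h x) (snd h y) \<le> rdist x y + e" using chain_stays[OF h x, of y L] by simp
  qed
qed

lemma flat_chart_rdist_le:
  assumes h: "flat_chart h" and x: "x \<in> fst h" "y \<in> fst h" and seg: "closed_segment (snd h x) (snd h y) \<subseteq> snd h ` fst h"
  shows "rdist x y \<le> dist (snd h x) (snd h y)"
  by (rule rdist_le_chain[OF segment_chain[OF h x seg]])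

lemma flat_chart_radius:
  assumes "flat_chart h" "x \<in> fst h"
  obtains \<rho> where "0 < \<rho>" "ball (snd h x) \<rho> \<subseteq> snd h ` fst h"
proof -
  have "snd h x \<in> snd h ` fst h" using assms(2) by (rule imageI)
  then have "\<exists>e>0. ball (snd h x) e \<subseteq> snd h ` fst h"
    using chart_open_image[OF flat_chart_chart[OF assms(1)]] by (meson open_contains_ball)
  then show ?thesis using that by blast
qed

lemma rdist_nonneg: "0 \<le> rdist x y"
proof (cases "x \<in> points M \<and> y \<in> points M")
  case True
  then show ?thesis by (intro rdist_ge chain_nonneg) simp_all
next
  case False
  then show ?thesis by (auto simp: rdist_def)
qed

lemma metric: "Metric_space (points M) rdist"
proof
  show "0 \<le> rdist x y" for x y by (rule rdist_nonneg)
  have "{L. chain M x y L} = {L. chain M y x L}" for x y using chain_sym by blast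
  then show "rdist x y = rdist y x" for x y by (simp add: rdist_def riem_dist_eq)
  show "rdist x y = 0 \<longleftrightarrow> x = y" if xy: "x \<in> points M" "y \<in> points M" for x y
  proof
    assume "x = y"
    then have "rdist x y \<le> 0" using chain_refl[OF xy(1)] rdist_le_chain by blast
    moreover have "0 \<le> rdist x y" by (rule rdist_nonneg)
    ultimately show "rdist x y = 0" by simp
  next
    assume z: "rdist x y = 0"
    obtain h where h: "flat_chart h" "x \<in> fst h" using flat_chart_exists xy(1) by blast
    obtain \<rho> where \<rho>: "0 < \<rho>" "ball (snd h x) \<rho> \<subseteq> snd h ` fst h" using flat_chart_radius[OF h] .
    have "y \<in> fst h" "dist (snd h x) (snd h y) \<le> 0"
      using flat_chart_rdist_less[OF h \<rho>(2) xy(2)] z \<rho>(1) by auto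
    then show "x = y" using chart_inj[OF flat_chart_chart[OF h(1)]] h(2) by (simp add: inj_on_def)
  qed
  show "rdist x z \<le> rdist x y + rdist y z" if xyz: "x \<in> points M" "y \<in> points M" "z \<in> points M" for x y z
  proof (rule field_le_epsilon)
    fix e :: real assume e: "0 < e"
    obtain L where L: "chain M x y L" "L < rdist x y + e / 2"
      by (rule rdist_less_chain[OF xyz(1,2), of "rdist x y + e / 2"]) (use e in auto)
    obtain L' where L': "chain M y z L'" "L' < rdist y z + e / 2"
      by (rule rdist_less_chain[OF xyz(2,3), of "rdist y z + e / 2"]) (use e in auto)
    have "rdist x z \<le> L + L'" by (rule rdist_le_chain[OF chain_trans[OF L'(1) L(1)]])
    then show "rdist x z \<le> rdist x y + rdist y z + e" using L(2) L'(2) by simp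
  qed
qed

sublocale Metric_space "points M" rdist
  by (rule metric)

section \<open>Metric topology and local isometries with Euclidean balls\<close>

lemma mball_flat_chart:
  assumes h: "flat_chart h" and p: "p \<in> fst h" "ball (snd h p) \<rho> \<subseteq> snd h ` fst h" and r: "0 < r" "r \<le> \<rho>"
  shows "mball p r = {q \<in> fst h. snd h q \<in> ball (snd h p) r}"
proof (intro equalityI subsetI)
  fix q assume q: "q \<in> mball p r"
  then have "q \<in> points M" "rdist p q < \<rho>" using r by auto
  from flat_chart_rdist_less[OF h p this] show "q \<in> {q \<in> fst h. snd h q \<in> ball (snd h p) r}" using q by auto
next
  fix q assume q: "q \<in> {q \<in> fst h. snd h q \<in> ball (snd h p) r}"
  then have "closed_segment (snd h p) (snd h q) \<subseteq> ball (snd h p) r"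
    using r(1) by (intro closed_segment_subset) auto
  then have "closed_segment (snd h p) (snd h q) \<subseteq> snd h ` fst h" using p(2) r(2) by (force simp: subset_iff)
  then have "rdist p q \<le> dist (snd h p) (snd h q)" using flat_chart_rdist_le[OF h p(1)] q by blast
  then show "q \<in> mball p r" using q p(1) flat_chart_points[OF h] by auto
qed

text \<open>Compactness and openness are assumed in the topology of the manifold, whereas the metric
  arguments use balls of \<open>rdist\<close>; small metric balls are coordinate balls, so the two
  topologies agree.\<close>

lemma mtopology_eq: "mtopology = mtop M"
proof (rule topology_eq[THEN iffD2], intro allI iffI)
  fix S assume S: "openin mtopology S"
  show "openin (mtop M) S"
  proof (subst openin_subopen, intro ballI)
    fix p assume p: "p \<in> S"
    then obtain r where r: "0 < r" "mball p r \<subseteq> S" "p \<in> points M"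
      using S unfolding openin_mtopology by blast
    obtain h where h: "flat_chart h" "p \<in> fst h" using flat_chart_exists r(3) by blast
    obtain \<rho> where \<rho>: "0 < \<rho>" "ball (snd h p) \<rho> \<subseteq> snd h ` fst h" using flat_chart_radius[OF h] .
    have "openin (mtop M) {q \<in> fst h. snd h q \<in> ball (snd h p) (min r \<rho>)}"
      by (rule chart_openin_preimage[OF flat_chart_chart[OF h(1)]]) simp
    moreover have "mball p (min r \<rho>) = {q \<in> fst h. snd h q \<in> ball (snd h p) (min r \<rho>)}"
      by (rule mball_flat_chart[OF h \<rho>(2)]) (use r \<rho> in auto)
    moreover have "mball p (min r \<rho>) \<subseteq> S" using r(2) mball_subset_concentric[of "min r \<rho>" r p] by auto
    moreover have "p \<in> mball p (min r \<rho>)" using r \<rho> by simp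
    ultimately show "\<exists>V. openin (mtop M) V \<and> p \<in> V \<and> V \<subseteq> S" by metis
  qed
next
  fix S assume S: "openin (mtop M) S"
  then have SM: "S \<subseteq> points M" by (rule openin_subset)
  show "openin mtopology S"
    unfolding openin_mtopology
  proof (intro conjI SM allI impI)
    fix p assume p: "p \<in> S"
    obtain h where h: "flat_chart h" "p \<in> fst h" using flat_chart_exists p SM by blast
    note hc = flat_chart_chart[OF h(1)]
    obtain \<rho> where \<rho>: "0 < \<rho>" "ball (snd h p) \<rho> \<subseteq> snd h ` fst h" using flat_chart_radius[OF h] .
    have "open (snd h ` (S \<inter> fst h))"
      using chart_open_map[OF hc, of "S \<inter> fst h"] S chart_openin[OF hc] by auto
    then obtain e where e: "0 < e" "ball (snd h p) e \<subseteq> snd h ` (S \<inter> fst h)"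
      using p h(2) unfolding open_contains_ball by blast
    have "mball p (min e \<rho>) = {q \<in> fst h. snd h q \<in> ball (snd h p) (min e \<rho>)}"
      by (rule mball_flat_chart[OF h \<rho>(2)]) (use e \<rho> in auto)
    also have "\<dots> \<subseteq> S"
    proof
      fix q assume q: "q \<in> {q \<in> fst h. snd h q \<in> ball (snd h p) (min e \<rho>)}"
      then have "snd h q \<in> snd h ` (S \<inter> fst h)" using e(2) by auto
      then obtain q' where "q' \<in> S" "q' \<in> fst h" "snd h q = snd h q'" by blast
      then show "q \<in> S" using chart_inj[OF hc] q by (auto simp: inj_on_def)
    qed
    finally show "\<exists>r>0. mball p r \<subseteq> S" using e(1) \<rho>(1) by (intro exI[of _ "min e \<rho>"]) auto
  qed
qed

lemma eucl_exists:
  assumes "p \<in> points M"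
  shows "\<exists>R. \<exists>\<phi>::'a \<Rightarrow> real ^ 'n. eucl p R \<phi>"
proof -
  obtain h where h: "flat_chart h" "p \<in> fst h" using flat_chart_exists[OF assms] by blast
  obtain \<rho> where \<rho>: "0 < \<rho>" "ball (snd h p) \<rho> \<subseteq> snd h ` fst h" using flat_chart_radius[OF h] .
  \<comment> \<open>Two points of \<open>mball p R\<close> are less than \<open>2 * R\<close> apart,
    and a coordinate ball of that radius around one of them must fit into the one of radius
    \<open>\<rho>\<close> around \<open>p\<close>: this takes \<open>3 * R\<close>.\<close>
  define R where "R = \<rho> / 3"
  have R: "0 < R" "3 * R = \<rho>" using \<rho>(1) by (auto simp: R_def)
  have ball: "mball p R = {q \<in> fst h. snd h q \<in> ball (snd h p) R}"
    by (rule mball_flat_chart[OF h \<rho>(2)]) (use R in auto)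
  have "dist (snd h x) (snd h y) = rdist x y" if xy: "x \<in> mball p R" "y \<in> mball p R" for x y
  proof -
    have x: "x \<in> fst h" "dist (snd h p) (snd h x) < R" and y: "y \<in> fst h" "dist (snd h p) (snd h y) < R"
      using xy unfolding ball by auto
    have "closed_segment (snd h x) (snd h y) \<subseteq> ball (snd h p) R"
      using x y by (intro closed_segment_subset) auto
    also have "\<dots> \<subseteq> snd h ` fst h" using \<rho>(2) R by (force simp: subset_iff)
    finally have le: "rdist x y \<le> dist (snd h x) (snd h y)" by (rule flat_chart_rdist_le[OF h(1) x(1) y(1)])
    have "dist (snd h x) (snd h y) < 2 * R"
      using dist_triangle3[of "snd h x" "snd h y" "snd h p"] x y by simp
    then have "rdist x y < 2 * R" using le by simp
    moreover have "ball (snd h x) (2 * R) \<subseteq> snd h ` fst h"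
    proof
      fix z assume "z \<in> ball (snd h x) (2 * R)"
      then have "dist (snd h p) z < \<rho>" using dist_triangle[of "snd h p" z "snd h x"] x(2) R by simp
      then show "z \<in> snd h ` fst h" using \<rho>(2) by auto
    qed
    moreover have "y \<in> points M" using xy by simp
    ultimately have "dist (snd h x) (snd h y) \<le> rdist x y" using flat_chart_rdist_less(2)[OF h(1) x(1)] by blast
    then show ?thesis using le by simp
  qed
  moreover have "snd h ` mball p R = ball (snd h p) R"
  proof (intro equalityI subsetI)
    fix z assume z: "z \<in> ball (snd h p) R"
    then have "z \<in> snd h ` fst h" using \<rho>(2) R by (force simp: subset_iff)
    then show "z \<in> snd h ` mball p R" using z unfolding ball by blast
  qed (auto simp: ball)
  ultimately have "eucl p R (snd h)" unfolding eucl_def using assms R(1) by blast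
  then show ?thesis by blast
qed

text \<open>Covering sets lie in \<open>points M\<close>, where the two distance functions
  agree.\<close>

lemma hausdorff_dim_rdist: "hausdorff_dim (points M) (riem_dist M) F = hausdorff_dim (points M) rdist F"
proof -
  have hw: "hweight (riem_dist M) s C = hweight rdist s C" if "C \<subseteq> points M" for s C
  proof -
    have "(SUP (x, y) \<in> C \<times> C. riem_dist M x y) = (SUP (x, y) \<in> C \<times> C. rdist x y)"
      using that by (intro SUP_cong) (auto simp: rdist_def subset_iff)
    then show ?thesis by (simp add: hweight_def)
  qed
  have "hausdorff_premeasure (points M) (riem_dist M) \<delta> s F = hausdorff_premeasure (points M) rdist \<delta> s F" for \<delta> s
  proof -
    have "(\<forall>i. C i \<subseteq> points M \<and> (\<forall>x\<in>C i. \<forall>y\<in>C i. riem_dist M x y \<le> \<delta>)) \<longleftrightarrow>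
        (\<forall>i. C i \<subseteq> points M \<and> (\<forall>x\<in>C i. \<forall>y\<in>C i. rdist x y \<le> \<delta>))" for C :: "nat \<Rightarrow> 'a set"
    proof -
      have "(\<forall>x\<in>C i. \<forall>y\<in>C i. riem_dist M x y \<le> \<delta>) \<longleftrightarrow> (\<forall>x\<in>C i. \<forall>y\<in>C i. rdist x y \<le> \<delta>)"
        if "C i \<subseteq> points M" for i
        using that by (intro ball_cong refl) (auto simp: rdist_def subset_iff)
      then show ?thesis by blast
    qed
    moreover have "(\<Sum>i. hweight (riem_dist M) s (C i)) = (\<Sum>i. hweight rdist s (C i))"
      if "\<forall>i. C i \<subseteq> points M \<and> (\<forall>x\<in>C i. \<forall>y\<in>C i. rdist x y \<le> \<delta>)" for C :: "nat \<Rightarrow> 'a set"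
      using that hw by simp
    ultimately have "{(\<Sum>i. hweight (riem_dist M) s (C i)) | C :: nat \<Rightarrow> 'a set. F \<subseteq> (\<Union>i. C i) \<and>
         (\<forall>i. C i \<subseteq> points M \<and> (\<forall>x\<in>C i. \<forall>y\<in>C i. riem_dist M x y \<le> \<delta>))} =
      {(\<Sum>i. hweight rdist s (C i)) | C :: nat \<Rightarrow> 'a set. F \<subseteq> (\<Union>i. C i) \<and>
         (\<forall>i. C i \<subseteq> points M \<and> (\<forall>x\<in>C i. \<forall>y\<in>C i. rdist x y \<le> \<delta>))}"
      by (intro Collect_cong ex_cong1) auto
    then show ?thesis unfolding hausdorff_premeasure_def by simp
  qed
  then show ?thesis by (simp add: hausdorff_dim_def hausdorff_measure_def)
qed

end

section \<open>The incidence matrix as a transfer operator\<close>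

text \<open>For each edge the factor \<open>\<rho> e powr (s' - s)\<close> lies between the same
  powers of \<open>r\<close> and \<open>R\<close>; scaled monotonicity of the spectral radius
  carries this over to the matrices.\<close>

lemma spectral_radius_incidence_powr:
  assumes m: "0 < m" and fin: "finite (arcs G)" and r: "0 < r"
    and \<rho>: "\<And>e. e \<in> arcs G \<Longrightarrow> r \<le> \<rho> e \<and> \<rho> e \<le> R" and s: "s \<le> s'"
    and R: "0 < R"
  shows "r powr (s' - s) * spectral_radius (incidence_matrix m G \<rho> s) \<le> spectral_radius (incidence_matrix m G \<rho> s')"
    and "spectral_radius (incidence_matrix m G \<rho> s') \<le> R powr (s' - s) * spectral_radius (incidence_matrix m G \<rho> s)"
proof -
  define a where "a s i j = (\<Sum>e\<in>edges G (Suc i) (Suc j). \<rho> e powr s)" for s i j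
  have inc: "incidence_matrix m G \<rho> s = cmat m (a s)" for s
    by (simp add: incidence_matrix_def a_def)
  have a0: "0 \<le> a s i j" for s i j unfolding a_def by (intro sum_nonneg) simp
  have edge: "e \<in> arcs G" if "e \<in> edges G i j" for e i j using that by (simp add: edges_def)
  have "a s i j \<le> r powr (s - s') * a s' i j" for i j
    unfolding a_def sum_distrib_left
  proof (rule sum_mono)
    fix e assume "e \<in> edges G (Suc i) (Suc j)"
    then have e: "r \<le> \<rho> e" using \<rho> edge by blast
    have "\<rho> e powr s = \<rho> e powr (s - s') * \<rho> e powr s'" by (simp flip: powr_add)
    also have "\<dots> \<le> r powr (s - s') * \<rho> e powr s'"
      using e r s by (intro mult_right_mono powr_mono2') auto
    finally show "\<rho> e powr s \<le> r powr (s - s') * \<rho> e powr s'" .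
  qed
  then have "spectral_radius (cmat m (a s)) \<le> r powr (s - s') * spectral_radius (cmat m (a s'))"
    using r by (intro spectral_radius_mono_scaled m a0) auto
  then have "r powr (s' - s) * spectral_radius (cmat m (a s))
      \<le> r powr (s' - s) * (r powr (s - s') * spectral_radius (cmat m (a s')))"
    by (intro mult_left_mono) auto
  also have "\<dots> = spectral_radius (cmat m (a s'))"
    using r by (simp add: mult.assoc[symmetric] flip: powr_add)
  finally show "r powr (s' - s) * spectral_radius (incidence_matrix m G \<rho> s) \<le> spectral_radius (incidence_matrix m G \<rho> s')"
    unfolding inc .
  have "a s' i j \<le> R powr (s' - s) * a s i j" for i j
    unfolding a_def sum_distrib_left
  proof (rule sum_mono)
    fix e assume "e \<in> edges G (Suc i) (Suc j)"
    then have e: "0 \<le> \<rho> e" "\<rho> e \<le> R" using \<rho> edge r by force+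
    have "\<rho> e powr s' = \<rho> e powr (s' - s) * \<rho> e powr s" by (simp flip: powr_add)
    also have "\<dots> \<le> R powr (s' - s) * \<rho> e powr s"
      using e s by (intro mult_right_mono powr_mono2) auto
    finally show "\<rho> e powr s' \<le> R powr (s' - s) * \<rho> e powr s" .
  qed
  then show "spectral_radius (incidence_matrix m G \<rho> s') \<le> R powr (s' - s) * spectral_radius (incidence_matrix m G \<rho> s)"
    unfolding inc using R by (intro spectral_radius_mono_scaled m a0) auto
qed

context similitude_graph
begin

definition incidence :: "real \<Rightarrow> nat \<Rightarrow> nat \<Rightarrow> real" where
  "incidence s i j = (\<Sum>e\<in>edges G (Suc i) (Suc j). \<rho> e powr s)"

lemma incidence_matrix_eq: "incidence_matrix m G \<rho> s = cmat m (incidence s)"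
  by (simp add: incidence_matrix_def incidence_def)

lemma incidence_nonneg: "0 \<le> incidence s i j"
  unfolding incidence_def by (intro sum_nonneg) simp

text \<open>Index \<open>i\<close> of the matrix stands for vertex \<open>Suc i\<close>; the edges
  out of a vertex are grouped by their heads.\<close>

lemma matop_incidence:
  assumes "verts G = {1..m}"
  shows "matop m (incidence s) (\<lambda>j. h (Suc j)) i = transfer (\<lambda>e. \<rho> e powr s) h (Suc i)"
proof -
  have "out (Suc i) = (\<Union>j\<in>{..<m}. edges G (Suc i) (Suc j))"
  proof (intro equalityI subsetI)
    fix e assume e: "e \<in> out (Suc i)"
    then have "head G e \<in> {1..m}" using arcs_wf(2) assms by (auto simp: out_def)
    then obtain j where "j < m" "head G e = Suc j" by (cases "head G e") auto
    then show "e \<in> (\<Union>j\<in>{..<m}. edges G (Suc i) (Suc j))" using e by (auto simp: out_def edges_def)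
  qed (auto simp: out_def edges_def)
  moreover have "finite (edges G i j)" for i j using finite_arcs by (simp add: edges_def)
  ultimately have "transfer (\<lambda>e. \<rho> e powr s) h (Suc i)
      = (\<Sum>j<m. \<Sum>e\<in>edges G (Suc i) (Suc j). \<rho> e powr s * h (head G e))"
    unfolding transfer_def by (simp add: sum.UNION_disjoint edges_def disjoint_iff)
  also have "\<dots> = (\<Sum>j<m. incidence s i j * h (Suc j))"
    unfolding incidence_def sum_distrib_right by (intro sum.cong refl) (auto simp: edges_def)
  finally show ?thesis by (simp add: matop_def)
qed

lemma funpow_matop_incidence:
  assumes "verts G = {1..m}"
  shows "(matop m (incidence s) ^^ q) (\<lambda>j. h (Suc j)) i = (transfer (\<lambda>e. \<rho> e powr s) ^^ q) h (Suc i)"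
proof (induction q arbitrary: i)
  case (Suc q)
  have "(matop m (incidence s) ^^ q) (\<lambda>j. h (Suc j)) = (\<lambda>j. (transfer (\<lambda>e. \<rho> e powr s) ^^ q) h (Suc j))"
    using Suc by blast
  then show ?case by (simp add: matop_incidence[OF assms])
qed simp

lemma transfer_tendsto_0:
  assumes V: "verts G = {1..m}" and sr: "spectral_radius (incidence_matrix m G \<rho> s) < 1" and i: "i \<in> verts G"
  shows "(\<lambda>q. (transfer (\<lambda>e. \<rho> e powr s) ^^ q) (\<lambda>_. 1) i) \<longlonglongrightarrow> 0"
proof -
  obtain k where k: "i = Suc k" "k < m" using i V by (cases i) auto
  then have "(\<lambda>q. (matop m (incidence s) ^^ q) (\<lambda>_. 1) k) \<longlonglongrightarrow> 0"
    using sr by (intro funpow_matop_tendsto_0) (auto simp: incidence_matrix_eq)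
  then show ?thesis using funpow_matop_incidence[OF V, where s = s and h = "\<lambda>_. 1" and i = k] by (simp add: k(1))
qed

text \<open>At exponent 0 the iterated transfer operator counts words.\<close>

lemma spectral_radius_incidence_0:
  assumes V: "verts G = {1..m}" and words: "\<And>q. \<exists>i\<in>verts G. words i q \<noteq> {}"
  shows "1 \<le> spectral_radius (incidence_matrix m G \<rho> 0)"
proof (rule ccontr)
  assume "\<not> ?thesis"
  then have "(\<lambda>q. \<Sum>i\<in>verts G. (transfer (\<lambda>e. \<rho> e powr 0) ^^ q) (\<lambda>_. 1) i) \<longlonglongrightarrow> 0"
    using transfer_tendsto_0[OF V, of 0] by (intro tendsto_null_sum) auto
  moreover have "1 \<le> (\<Sum>i\<in>verts G. (transfer (\<lambda>e. \<rho> e powr 0) ^^ q) (\<lambda>_. 1) i)" for q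
  proof -
    have wt1: "wt (\<lambda>e. \<rho> e powr 0) es = 1" if "es \<in> words i q" for i es
      using that wt_powr[of i es 0] ratio_pos[of i es] by (auto simp: words_def)
    have eq: "(transfer (\<lambda>e. \<rho> e powr 0) ^^ q) (\<lambda>_. 1) i = real (card (words i q))" for i
      unfolding funpow_transfer using wt1 by simp
    obtain i where i: "i \<in> verts G" "words i q \<noteq> {}" using words by blast
    have "1 \<le> card (words i q)" using i(2) by (simp add: Suc_le_eq card_gt_0_iff)
    also have "\<dots> \<le> (\<Sum>i\<in>verts G. card (words i q))"
      using i(1) finite_verts by (intro member_le_sum) auto
    finally have "1 \<le> real (\<Sum>i\<in>verts G. card (words i q))" by linarith
    then show ?thesis unfolding eq by simp
  qed
  ultimately have "(1::real) \<le> 0" by (intro LIMSEQ_le_const) auto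
  then show False by simp
qed

text \<open>Damping each row of a subinvariant vector makes it invariant. This replaces the Perron--Frobenius
  eigenvector, and no irreducibility is required.\<close>

lemma invariant_weights:
  assumes V: "verts G = {1..m}" and m: "0 < m" and sr: "1 \<le> spectral_radius (incidence_matrix m G \<rho> s)"
  obtains c h i0 where "\<And>i. 0 \<le> h i" "i0 \<in> verts G" "0 < h i0" "\<And>i. i \<in> verts G \<Longrightarrow> transfer c h i = h i"
    "\<And>e. e \<in> arcs G \<Longrightarrow> 0 \<le> c e \<and> c e \<le> \<rho> e powr s"
proof -
  obtain h0 k where h0: "\<And>i. 0 \<le> h0 i" "k < m" "0 < h0 k"
    "\<And>i. i < m \<Longrightarrow> spectral_radius (cmat m (incidence s)) * h0 i \<le> matop m (incidence s) h0 i"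
    by (rule spectral_radius_subinvariant[OF m, of "incidence s"]) (use incidence_nonneg in auto)
  define h where "h i = h0 (i - 1)" for i
  define t where "t = transfer (\<lambda>e. \<rho> e powr s) h"
  have ht: "h i \<le> t i" if "i \<in> verts G" for i
  proof -
    obtain j where j: "i = Suc j" "j < m" using \<open>i \<in> verts G\<close> V by (cases i) auto
    have "h i \<le> spectral_radius (cmat m (incidence s)) * h0 j"
      using sr mult_right_mono[of 1 _ "h0 j"] h0(1) by (simp add: h_def j incidence_matrix_eq)
    also have "\<dots> \<le> matop m (incidence s) h0 j" using h0(4) j by blast
    also have "\<dots> = t i" using matop_incidence[OF V, of s h j] by (simp add: h_def t_def j)
    finally show ?thesis .
  qed
  have hn: "0 \<le> h i" for i using h0(1) by (simp add: h_def)
  \<comment> \<open>Where \<open>t\<close> vanishes at a vertex, so does \<open>h\<close>, as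
    \<open>0 \<le> h \<le> t\<close> there; division by 0 then makes the weights of the row 0, and
    invariance holds trivially.\<close>
  define c where "c e = h (tail G e) / t (tail G e) * \<rho> e powr s" for e
  show ?thesis
  proof (rule that[of h "Suc k" c])
    show "0 \<le> h i" for i by (rule hn)
    show "Suc k \<in> verts G" "0 < h (Suc k)" using V h0 by (auto simp: h_def)
    show "transfer c h i = h i" if i: "i \<in> verts G" for i
    proof -
      have "transfer c h i = (\<Sum>e\<in>out i. h i / t i * (\<rho> e powr s * h (head G e)))"
        unfolding transfer_def by (intro sum.cong) (auto simp: out_def c_def)
      also have "\<dots> = h i / t i * t i" by (simp add: t_def transfer_def sum_distrib_left)
      also have "\<dots> = h i" using ht[OF i] hn[of i] by (cases "t i = 0") auto
      finally show ?thesis .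
    qed
    show "0 \<le> c e \<and> c e \<le> \<rho> e powr s" if "e \<in> arcs G" for e
    proof -
      have v: "h (tail G e) \<le> t (tail G e)" using ht arcs_wf(1) that by blast
      then have "0 \<le> h (tail G e) / t (tail G e)" "h (tail G e) / t (tail G e) \<le> 1"
        using hn[of "tail G e"] by (auto simp: divide_le_eq_1)
      then show ?thesis unfolding c_def by (intro conjI mult_nonneg_nonneg mult_left_le_one_le) auto
    qed
  qed
qed

end

section \<open>The dimension of the limit set\<close>

context gosc_graph
begin

lemma level_bounded: obtains D where "0 < D" "\<And>j x y. j \<in> verts G \<Longrightarrow> x \<in> W j \<Longrightarrow> y \<in> W j \<Longrightarrow> d x y \<le> D"
proof -
  obtain D where D: "0 < D" "\<forall>x\<in>level W 0. \<forall>y\<in>level W 0. d x y \<le> D"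
    using compactin_imp_mbounded[OF level_compact, of 0] unfolding mbounded_alt_pos by blast
  have "x \<in> level W 0" if "j \<in> verts G" "x \<in> W j" for j x
    using level_memI[of j "[]" x W] that by simp
  then show ?thesis using D by (intro that[of D]) auto
qed

lemma hausdorff_dim_limit_set:
  assumes V: "verts G = {1..m}" and m: "0 < m" and ne: "\<And>q. level W q \<noteq> {}"
  shows "\<exists>\<alpha>\<ge>0. spectral_radius (incidence_matrix m G \<rho> \<alpha>) = 1 \<and>
    (\<forall>\<beta>\<ge>0. spectral_radius (incidence_matrix m G \<rho> \<beta>) = 1 \<longrightarrow> \<beta> = \<alpha>) \<and>
    hausdorff_dim M d limit_set = ereal \<alpha>"
proof -
  define g where "g s = spectral_radius (incidence_matrix m G \<rho> s)" for s
  obtain r where r: "0 < r" "r < 1" "\<And>e. e \<in> arcs G \<Longrightarrow> r \<le> \<rho> e" using min_ratio by blast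
  obtain R where R: "0 < R" "R < 1" "\<And>e. e \<in> arcs G \<Longrightarrow> \<rho> e \<le> R" using ratio_words_bound by metis
  have "\<exists>i\<in>verts G. words i q \<noteq> {}" for q using ne[of q] by (auto simp: level_def)
  then have "1 \<le> g 0" unfolding g_def by (intro spectral_radius_incidence_0 V) blast
  moreover have rR: "r \<le> \<rho> e \<and> \<rho> e \<le> R" if "e \<in> arcs G" for e using r(3) R(3) that by blast
  have "r powr (s' - s) * g s \<le> g s'" "g s' \<le> R powr (s' - s) * g s" if "s \<le> s'" for s s'
    unfolding g_def by (rule spectral_radius_incidence_powr[OF m finite_arcs r(1) rR that R(1)]; assumption)+
  moreover have "0 \<le> g s" for s
    unfolding g_def incidence_matrix_eq by (rule spectral_radius_nonneg[OF m])
  ultimately have "\<exists>\<alpha>\<ge>0. g \<alpha> = 1 \<and> (\<forall>\<beta>\<ge>0. g \<beta> = 1 \<longrightarrow> \<beta> = \<alpha>) \<and> (\<forall>\<beta>>\<alpha>. g \<beta> < 1) \<and>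
      (\<forall>\<beta>\<ge>0. \<beta> \<le> \<alpha> \<longrightarrow> 1 \<le> g \<beta>)"
    by (intro unique_level_one[OF r(1) R(1,2)]) auto
  then obtain \<alpha> where \<alpha>: "0 \<le> \<alpha>" "g \<alpha> = 1" "\<forall>\<beta>\<ge>0. g \<beta> = 1 \<longrightarrow> \<beta> = \<alpha>"
    "\<And>\<beta>. \<alpha> < \<beta> \<Longrightarrow> g \<beta> < 1" "\<And>\<beta>. 0 \<le> \<beta> \<Longrightarrow> \<beta> \<le> \<alpha> \<Longrightarrow> 1 \<le> g \<beta>"
    by blast
  obtain D where D: "0 < D" "\<And>j x y. j \<in> verts G \<Longrightarrow> x \<in> W j \<Longrightarrow> y \<in> W j \<Longrightarrow> d x y \<le> D"
    by (rule level_bounded) blast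
  have above: "hausdorff_measure M d s limit_set = 0" if s: "\<alpha> < s" for s
  proof (rule hausdorff_measure_zero[OF W_X])
    show "limit_set \<subseteq> level W q" for q by (auto simp: limit_set_def)
    show "(\<lambda>q. (transfer (\<lambda>e. \<rho> e powr s) ^^ q) (\<lambda>_. 1) i) \<longlonglongrightarrow> 0" if "i \<in> verts G" for i
      by (rule transfer_tendsto_0[OF V _ that]) (use \<alpha>(4)[OF s] in \<open>simp add: g_def\<close>)
    show "d x y \<le> D" if "j \<in> verts G" "x \<in> W j" "y \<in> W j" for j x y using D(2) that .
  qed (use s \<alpha>(1) D(1) in auto)
  \<comment> \<open>The critical exponent is included: the measure is nonzero in dimension
    \<open>\<alpha>\<close> itself.\<close>
  have below: "hausdorff_measure M d s limit_set \<noteq> 0" if s: "0 \<le> s" "s \<le> \<alpha>" for s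
  proof -
    have "1 \<le> spectral_radius (incidence_matrix m G \<rho> s)" using \<alpha>(5)[OF s] by (simp add: g_def)
    then obtain c h i0 where "\<And>i. 0 \<le> h i" "i0 \<in> verts G" "0 < h i0" "\<And>i. i \<in> verts G \<Longrightarrow> transfer c h i = h i"
      "\<And>e. e \<in> arcs G \<Longrightarrow> 0 \<le> c e \<and> c e \<le> \<rho> e powr s"
      by (rule invariant_weights[OF V m]) blast
    then show ?thesis using s(1) by (intro hausdorff_measure_limit_set_nonzero) auto
  qed
  have "hausdorff_dim M d limit_set = ereal \<alpha>"
  proof (rule antisym)
    have "hausdorff_dim M d limit_set \<le> ereal s" if "\<alpha> < s" for s
      unfolding hausdorff_dim_def using above[OF that] that \<alpha>(1) by (intro Inf_lower) auto
    note up = this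
    show "hausdorff_dim M d limit_set \<le> ereal \<alpha>"
    proof (rule ereal_le_epsilon2)
      fix e :: real assume "0 < e"
      then show "hausdorff_dim M d limit_set \<le> ereal \<alpha> + ereal e" using up[of "\<alpha> + e"] by simp
    qed
    have "\<alpha> \<le> s" if "0 \<le> s" "hausdorff_measure M d s limit_set = 0" for s
      using below[of s] that by force
    then show "ereal \<alpha> \<le> hausdorff_dim M d limit_set"
      unfolding hausdorff_dim_def by (intro Inf_greatest) auto
  qed
  then show ?thesis using \<alpha>(1-3) unfolding g_def by blast
qed

end

section \<open>Iterated relation systems\<close>

text \<open>The association condition speaks of unions over relation words; identifying them with
  the levels \<open>k + q\<close> makes it a description of the sets whose intersection is the
  attractor.\<close>

lemma rel_word_levels:
  "(\<Union>ts\<in>{ts. set ts \<subseteq> {1..N} \<and> length ts = q}. rel_word R ts `` irs_level N E0 R k) = irs_level N E0 R (k + q)"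
proof (induction q)
  case (Suc q)
  have words: "{ts. set ts \<subseteq> {1..N} \<and> length ts = Suc q}
      = (\<Union>t\<in>{1..N}. (#) t ` {ts. set ts \<subseteq> {1..N} \<and> length ts = q})"
    by (auto simp: length_Suc_conv)
  have "(\<Union>ts\<in>{ts. set ts \<subseteq> {1..N} \<and> length ts = Suc q}. rel_word R ts `` irs_level N E0 R k)
      = (\<Union>t\<in>{1..N}. R t `` (\<Union>ts\<in>{ts. set ts \<subseteq> {1..N} \<and> length ts = q}. rel_word R ts `` irs_level N E0 R k))"
    unfolding words by (auto simp: relcomp_Image Image_UN)
  also have "\<dots> = irs_level N E0 R (k + Suc q)" using Suc by simp
  finally show ?case .
qed simp

context
  fixes T :: "'a topology" and N E0 R
  assumes irs: "IRS T N E0 R"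
begin

lemma irs_level_compact: "irs_level N E0 R k \<subseteq> E0 \<and> irs_level N E0 R k \<noteq> {} \<and> compactin T (irs_level N E0 R k)"
proof (induction k)
  case 0
  then show ?case using irs by (simp add: IRS_def)
next
  case (Suc k)
  have R: "R t `` irs_level N E0 R k \<noteq> {} \<and> compactin T (R t `` irs_level N E0 R k) \<and> R t `` irs_level N E0 R k \<subseteq> E0"
    if "t \<in> {1..N}" for t
  proof -
    have "R t `` irs_level N E0 R k \<subseteq> R t `` E0" using Suc by blast
    also have "\<dots> \<subseteq> E0" using irs that unfolding IRS_def by blast
    finally show ?thesis using irs that Suc unfolding IRS_def by blast
  qed
  have one: "1 \<in> {1..N}" using irs by (simp add: IRS_def)
  obtain x where "x \<in> R 1 `` irs_level N E0 R k" using R[OF one] by blast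
  then have "x \<in> irs_level N E0 R (Suc k)" unfolding irs_level.simps by (rule UN_I[OF one])
  then have "irs_level N E0 R (Suc k) \<noteq> {}" by blast
  moreover have "compactin T (\<Union>t\<in>{1..N}. R t `` irs_level N E0 R k)"
    using R by (intro compactin_Union) auto
  moreover have "irs_level N E0 R (Suc k) \<subseteq> E0" unfolding irs_level.simps using R by blast
  ultimately show ?case unfolding irs_level.simps by blast
qed

lemma irs_level_decreasing: "irs_level N E0 R (Suc k) \<subseteq> irs_level N E0 R k"
proof (induction k)
  case 0
  then show ?case using irs unfolding IRS_def by auto
next
  case (Suc k)
  then show ?case by (simp only: irs_level.simps(2)) blast
qed

lemma attractor_shift: "attractor N E0 R = (\<Inter>q. irs_level N E0 R (k + q))"
proof -
  have "decseq (irs_level N E0 R)" using irs_level_decreasing by (simp add: decseq_Suc_iff)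
  then have "irs_level N E0 R (k + q) \<subseteq> irs_level N E0 R q" for q by (simp add: decseqD)
  then show ?thesis unfolding attractor_def by blast
qed

end

theorem theorem1p2:
  fixes M :: "('a, 'n::finite) riemannian"
    and N m :: nat
    and E0 :: "'a set"
    and R :: "nat \<Rightarrow> 'a rel"
    and G :: "(nat, 'e) pre_digraph"
    and X :: "nat \<Rightarrow> 'a set"
    and f :: "'e \<Rightarrow> 'a \<Rightarrow> 'a"
    and \<rho> :: "'e \<Rightarrow> real"
  assumes "riemannian_manifold M"
    and "complete_manifold M"
    and "orientable M"
    and "locally_euclidean M"
    and "IRS (mtop M) N E0 R"
    and "GIFS (points M) (riem_dist M) m G X f"
    and "contractive_similitudes (riem_dist M) G X f \<rho>"
    and "associated (mtop M) N E0 R m G X f"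
    and "GOSC (mtop M) (riem_dist M) m G X f"
  shows "\<exists>\<alpha>\<ge>0. spectral_radius (incidence_matrix m G \<rho> \<alpha>) = 1 \<and>
           (\<forall>\<beta>\<ge>0. spectral_radius (incidence_matrix m G \<rho> \<beta>) = 1 \<longrightarrow> \<beta> = \<alpha>) \<and>
           hausdorff_dim (points M) (riem_dist M) (attractor N E0 R) = ereal \<alpha>"
proof -
  interpret fm: flat_manifold M by unfold_locales (use assms in auto)
  have V: "verts G = {1..m}" and X: "\<And>j. j \<in> {1..m} \<Longrightarrow> X j \<subseteq> points M" and fd: "fin_digraph G"
    and maps: "\<And>i j e. i \<in> {1..m} \<Longrightarrow> j \<in> {1..m} \<Longrightarrow> e \<in> edges G i j \<Longrightarrow> f e ` X j \<subseteq> X i"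
    using assms(6) unfolding GIFS_def by blast+
  interpret fin_digraph G by (rule fd)
  have ends: "tail G e \<in> {1..m}" "head G e \<in> {1..m}" "e \<in> edges G (tail G e) (head G e)" if "e \<in> arcs G" for e
    using that V by (auto simp: edges_def)
  have fX: "f e ` X (head G e) \<subseteq> X (tail G e)" if "e \<in> arcs G" for e
    using maps ends[OF that] by blast
  have sim: "0 < \<rho> e" "\<rho> e < 1" "\<And>x y. x \<in> X (head G e) \<Longrightarrow> y \<in> X (head G e) \<Longrightarrow> riem_dist M (f e x) (f e y) = \<rho> e * riem_dist M x y"
    if "e \<in> arcs G" for e
    using assms(7) that unfolding contractive_similitudes_def by blast+
  obtain k W where kW: "irs_level N E0 R k = (\<Union>j\<in>{1..m}. W j) \<and>
      (\<forall>j\<in>{1..m}. W j \<noteq> {} \<and> compactin (mtop M) (W j) \<and> W j \<subseteq> irs_level N E0 R k \<and> W j \<subseteq> X j) \<and>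
      (\<forall>q\<ge>1. (\<Union>ts\<in>{ts. set ts \<subseteq> {1..N} \<and> length ts = q}. rel_word R ts `` irs_level N E0 R k)
        = (\<Union>i\<in>{1..m}. \<Union>j\<in>{1..m}. \<Union>es\<in>paths G q i j. foldr f es ` W j))"
    using assms(8) unfolding associated_def by (elim exE) (rule that)
  note W1 = kW[THEN conjunct1]
    and W2 = kW[THEN conjunct2, THEN conjunct1, rule_format]
    and paths = kW[THEN conjunct2, THEN conjunct2, rule_format]
  obtain U where UU: "(\<forall>j\<in>{1..m}. U j \<noteq> {} \<and> openin (mtop M) (U j) \<and>
        Metric_space.mbounded (points M) (riem_dist M) (U j) \<and> U j \<subseteq> X j) \<and>
      (\<forall>i\<in>{1..m}. (\<forall>j\<in>{1..m}. (\<Union>e\<in>edges G i j. f e ` U j) \<subseteq> U i) \<and>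
        (\<forall>j\<^sub>1\<in>{1..m}. \<forall>j\<^sub>2\<in>{1..m}. \<forall>e\<in>edges G i j\<^sub>1. \<forall>e'\<in>edges G i j\<^sub>2.
          e \<noteq> e' \<longrightarrow> f e ` U j\<^sub>1 \<inter> f e' ` U j\<^sub>2 = {}))"
    using assms(9) unfolding GOSC_def by (elim exE) (rule that)
  have U: "\<And>j. j \<in> {1..m} \<Longrightarrow> U j \<noteq> {} \<and> openin (mtop M) (U j) \<and> U j \<subseteq> X j"
    using UU by blast
  have U_inv: "f e ` U j \<subseteq> U i" if "i \<in> {1..m}" "j \<in> {1..m}" "e \<in> edges G i j" for i j e
    using UU that by blast
  have U_dis: "f e ` U j \<inter> f e' ` U j' = {}"
    if "i \<in> {1..m}" "j \<in> {1..m}" "j' \<in> {1..m}" "e \<in> edges G i j" "e' \<in> edges G i j'" "e \<noteq> e'" for i j j' e e'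
    using UU[THEN conjunct2, THEN bspec, OF that(1), THEN conjunct2, THEN bspec, OF that(2), THEN bspec,
        OF that(3), THEN bspec, OF that(4), THEN bspec, OF that(5)] that(6) by (rule mp)
  interpret sg: similitude_graph "points M" fm.rdist G X f \<rho>
  proof unfold_locales
    show "fm.rdist (f e x) (f e y) = \<rho> e * fm.rdist x y"
      if e: "e \<in> arcs G" and xy: "x \<in> X (head G e)" "y \<in> X (head G e)" for e x y
    proof -
      have "x \<in> points M" "y \<in> points M" "f e x \<in> points M" "f e y \<in> points M"
        using X ends[OF e] fX[OF e] xy by blast+
      then show ?thesis using sim(3)[OF e xy] by (simp add: fm.rdist_def)
    qed
  qed (use V X fX sim ends in auto)
  \<comment> \<open>The case \<open>q = 0\<close> is the decomposition into the \<open>W j\<close>,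
    and \<open>q \<ge> 1\<close> is the association condition. A path determines its end vertex
    \<open>j\<close>, so the union over \<open>j\<close> disappears.\<close>
  have level: "sg.level W q = irs_level N E0 R (k + q)" for q
  proof (cases "q = 0")
    case True
    then show ?thesis by (simp add: sg.level_def W1 V)
  next
    case False
    have p: "paths G q i j = {es \<in> sg.words i q. sg.endv i es = j}" if "i \<in> {1..m}" for i j
      using that V by (auto simp: paths_def sg.words_def sg.awalk_iff)
    have "sg.level W q = (\<Union>i\<in>{1..m}. \<Union>j\<in>{1..m}. \<Union>es\<in>paths G q i j. foldr f es ` W j)"
      unfolding sg.level_def V
    proof (intro SUP_cong refl)
      fix i assume i: "i \<in> {1..m}"
      have "sg.endv i es \<in> {1..m}" if "es \<in> sg.words i q" for es
        using sg.endv_verts[of i es] that i V by (auto simp: sg.words_def)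
      then show "(\<Union>es\<in>sg.words i q. foldr f es ` W (sg.endv i es)) = (\<Union>j\<in>{1..m}. \<Union>es\<in>paths G q i j. foldr f es ` W j)"
        unfolding p[OF i] by blast
    qed
    then show ?thesis using paths[of q] False rel_word_levels[where N = N and q = q and R = R and k = k] by simp
  qed
  have irs: "irs_level N E0 R j \<noteq> {}" "compactin fm.mtopology (irs_level N E0 R j)" for j
    using irs_level_compact[OF assms(5), of j] by (auto simp: fm.mtopology_eq)
  interpret gg: gosc_graph "points M" fm.rdist G X f \<rho> U W "TYPE(real ^ 'n)"
  proof unfold_locales
    show "\<exists>R. \<exists>\<phi>::'a \<Rightarrow> real ^ 'n. fm.eucl p R \<phi>" if "p \<in> points M" for p
      using fm.eucl_exists[OF that] .
    show "sg.level W (Suc q) \<subseteq> sg.level W q" for q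
      using irs_level_decreasing[OF assms(5), of "k + q"] by (simp only: level add_Suc_right)
    show "compactin fm.mtopology (sg.level W q)" for q by (simp only: level irs)
    show "f e ` U (head G e) \<subseteq> U (tail G e)" if "e \<in> arcs G" for e using U_inv ends[OF that] by blast
    show "f e ` U (head G e) \<inter> f e' ` U (head G e') = {}"
      if "e \<in> arcs G" "e' \<in> arcs G" "tail G e = tail G e'" "e \<noteq> e'" for e e'
      using U_dis[of "tail G e" "head G e" "head G e'" e e'] ends[OF that(1)] ends[OF that(2)] that by simp
  qed (use U W2 V in \<open>auto simp: fm.mtopology_eq\<close>)
  \<comment> \<open>Without vertices the nonempty level \<open>k\<close> would be an empty
    union.\<close>
  have m: "0 < m" using irs(1)[of k] W1 by (cases m) auto
  have "gg.limit_set = attractor N E0 R"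
    unfolding gg.limit_set_def level attractor_shift[OF assms(5), of k] ..
  then show ?thesis
    using gg.hausdorff_dim_limit_set[OF V m] irs(1) by (simp add: level fm.hausdorff_dim_rdist)
qed

end
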